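(* Let $N\in\mathbb N$ and let $Y(t)$, $t\ge0$, be the multilevel TASEP on $\mathbb{GT}^{(N)}$, with an initial condition $Y(0)\in\mathbb{GT}^{(N)}$ (not depending on $n$, and independent of the exponential clocks). Then, as $n\to\infty$, the laws on $D([0,\infty),\mathbb R^{N(N+1)/2})$ of the processes $$\frac{Y(nt)-tn}{\sqrt n},\qquad t\ge0$$ (where $tn$ is subtracted from every coordinate), converge to the law of the process $W$ of reflected interlacing Brownian motions started from $0$ (that is, $W_i^j(0)=0$ for all $i,j$).
   Context: **Interlacing configurations.** $\mathbb{GT}^{(N)}$ is the set of integer arrays $(x_i^j)_{1\le i\le j\le N}$ with $x_{i-1}^j<x_{i-1}^{j-1}\le x_i^j$ for all $2\le i\le j\le N$. $\mathbb{GT}^{(N)}_c$ is the set of real arrays $(x_i^j)_{1\le i\le j\le N}$ with $x_{i-1}^j\le x_{i-1}^{j-1}\le x_i^j$ for all $2\le i\le j\le N$. **Multilevel TASEP.** $Y$ is the continuous-time Markov chain on $\mathbb{GT}^{(N)}$ defined as follows. Each of the $N(N+1)/2$ particles $Y_i^j$ has an independent exponential clock of rate $1$ (the ringing times of the clocks are independent standard Poisson processes). If the clock of particle $Y_i^j$ rings at time $t$: if $i<j$ and $Y_i^{j-1}(t-)=Y_i^j(t-)+1$, nothing happens; otherwise $Y_i^j(t)=Y_i^j(t-)+1$, and if moreover $Y_i^j(t-)=Y_{i+1}^{j+1}(t-)=\dots=Y_{i+k}^{j+k}(t-)$, then also $Y_{i+m}^{j+m}(t)=Y_{i+m}^{j+m}(t-)+1$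 for $m=1,\dots,k$ (with $k$ maximal). All other particles do not move at time $t$. **The process $W$ (Warren).** Let $W(0)$ be a $\mathbb{GT}^{(N)}_c$-valued random variable, and let $B_i^j$, $1\le i\le j\le N$, be independent standard Brownian motions started at $0$, independent of $W(0)$. $W$ is the $\mathbb{GT}^{(N)}_c$-valued continuous process with initial value $W(0)$, defined level by level: $W_1^1=W_1^1(0)+B_1^1$, and for $k\ge2$, $W_i^k$ is the Brownian motion $W_i^k(0)+B_i^k$ reflected on the trajectories of $W_{i-1}^{k-1}$ (from below, if $i>1$) and $W_i^{k-1}$ (from above, if $i<k$). That is, $$W_i^k(t)=W_i^k(0)+B_i^k(t)+L_i^{k,-}(t)-L_i^{k,+}(t),$$ where $L_i^{k,\pm}$ are continuous nondecreasing processes starting at $0$, $L_i^{k,-}$ increases only at times when $W_i^k=W_{i-1}^{k-1}$, $L_i^{k,+}$ increases only at times when $W_i^k=W_i^{k-1}$, and $L_1^{k,-}\equiv0$, $L_k^{k,+}\equiv0$. **Function space.** $D([0,\infty),\mathbb R^d)$ is the space of right-continuous functions $[0,\infty)\to\mathbb R^d$ with left limits, with the topology of uniform convergence on compact sets. It carries the $\sigma$-algebra generated by the coordinate evaluations, and convergence of laws means convergence of expectations of all bounded functionals that are continuous in this topology and measurable with respect to this $\sigma$-algebra. *)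

theory Defs
  imports "HOL-Probability.Probability"
begin

section \<open>Interlacing arrays\<close>

text \<open>The entry \<open>x\<^sub>i\<^sup>j\<close> of an array (position \<open>i\<close> on level \<open>j\<close>) is \<open>x (i, j)\<close>.
  Arrays are extensional functions on the index set, so that two arrays are equal iff
  their entries are.\<close>

definition gt_index :: "nat \<Rightarrow> (nat \<times> nat) set" where
  "gt_index N = {(i, j). 1 \<le> i \<and> i \<le> j \<and> j \<le> N}"

definition GT :: "nat \<Rightarrow> (nat \<times> nat \<Rightarrow> int) set" where
  "GT N = {x \<in> gt_index N \<rightarrow>\<^sub>E UNIV.
     \<forall>i j. 2 \<le> i \<and> i \<le> j \<and> j \<le> N \<longrightarrow>
       x (i - 1, j) < x (i - 1, j - 1) \<and> x (i - 1, j - 1) \<le> x (i, j)}"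

definition GTc :: "nat \<Rightarrow> (nat \<times> nat \<Rightarrow> real) set" where
  "GTc N = {x \<in> gt_index N \<rightarrow>\<^sub>E UNIV.
     \<forall>i j. 2 \<le> i \<and> i \<le> j \<and> j \<le> N \<longrightarrow>
       x (i - 1, j) \<le> x (i - 1, j - 1) \<and> x (i - 1, j - 1) \<le> x (i, j)}"


section \<open>The path space with the topology of uniform convergence on compact sets\<close>

text \<open>Paths \<open>[0, \<infinity>) \<rightarrow> \<real>\<^sup>I\<close> for a finite coordinate set \<open>I\<close>. A path is extensional in the
  time variable (on \<open>{0..}\<close>) and in the coordinate (on \<open>I\<close>).\<close>

definition cadlag :: "'i set \<Rightarrow> (real \<Rightarrow> 'i \<Rightarrow> real) set" where
  "cadlag I = {x \<in> {0..} \<rightarrow>\<^sub>E (I \<rightarrow>\<^sub>E UNIV).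
     \<forall>p\<in>I. (\<forall>t\<ge>0. ((\<lambda>s. x s p) \<longlongrightarrow> x t p) (at_right t)) \<and>
           (\<forall>t>0. \<exists>l. ((\<lambda>s. x s p) \<longlongrightarrow> l) (at_left t))}"

definition ucc_topology :: "'i set \<Rightarrow> (real \<Rightarrow> 'i \<Rightarrow> real) topology" where
  "ucc_topology I = topology (\<lambda>U. U \<subseteq> cadlag I \<and>
     (\<forall>x\<in>U. \<exists>T\<ge>0. \<exists>\<epsilon>>0. \<forall>y\<in>cadlag I.
        (\<forall>t\<in>{0..T}. \<forall>p\<in>I. \<bar>y t p - x t p\<bar> < \<epsilon>) \<longrightarrow> y \<in> U))"

lemma openin_ucc_topology:
  "openin (ucc_topology I) U \<longleftrightarrow> U \<subseteq> cadlag I \<and>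
     (\<forall>x\<in>U. \<exists>T\<ge>0. \<exists>\<epsilon>>0. \<forall>y\<in>cadlag I.
        (\<forall>t\<in>{0..T}. \<forall>p\<in>I. \<bar>y t p - x t p\<bar> < \<epsilon>) \<longrightarrow> y \<in> U)"
proof -
  let ?near = "\<lambda>T \<epsilon> x y. \<forall>t\<in>{0..T}. \<forall>p\<in>I. \<bar>y t p - x t p\<bar> < (\<epsilon>::real)"
  let ?P = "\<lambda>U. U \<subseteq> cadlag I \<and>
     (\<forall>x\<in>U. \<exists>T\<ge>0. \<exists>\<epsilon>>0. \<forall>y\<in>cadlag I. ?near T \<epsilon> x y \<longrightarrow> y \<in> U)"
  have "?P (U \<inter> V)" if U: "?P U" and V: "?P V" for U V
  proof (intro conjI ballI)
    show "U \<inter> V \<subseteq> cadlag I" using U by blast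
    fix x assume x: "x \<in> U \<inter> V"
    obtain T1 e1 where 1: "T1 \<ge> 0" "e1 > 0" "\<forall>y\<in>cadlag I. ?near T1 e1 x y \<longrightarrow> y \<in> U"
      using U x by blast
    obtain T2 e2 where 2: "T2 \<ge> 0" "e2 > 0" "\<forall>y\<in>cadlag I. ?near T2 e2 x y \<longrightarrow> y \<in> V"
      using V x by blast
    have "\<forall>y\<in>cadlag I. ?near (max T1 T2) (min e1 e2) x y \<longrightarrow> y \<in> U \<inter> V"
    proof (intro ballI impI)
      fix y assume y: "y \<in> cadlag I" "?near (max T1 T2) (min e1 e2) x y"
      have "?near T1 e1 x y" "?near T2 e2 x y" using y(2) by (auto simp: le_max_iff_disj)
      then show "y \<in> U \<inter> V" using 1(3) 2(3) y(1) by blast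
    qed
    moreover have "max T1 T2 \<ge> 0" "min e1 e2 > 0" using 1 2 by auto
    ultimately show "\<exists>T\<ge>0. \<exists>\<epsilon>>0. \<forall>y\<in>cadlag I. ?near T \<epsilon> x y \<longrightarrow> y \<in> U \<inter> V" by blast
  qed
  moreover have "?P (\<Union>\<K>)" if K: "\<forall>V\<in>\<K>. ?P V" for \<K>
  proof (intro conjI ballI)
    show "\<Union>\<K> \<subseteq> cadlag I" using K by blast
    fix x assume "x \<in> \<Union>\<K>"
    then obtain V where V: "V \<in> \<K>" "x \<in> V" by blast
    then obtain T e where "T \<ge> 0" "e > 0" "\<forall>y\<in>cadlag I. ?near T e x y \<longrightarrow> y \<in> V"
      using K by blast
    with V(1) show "\<exists>T\<ge>0. \<exists>\<epsilon>>0. \<forall>y\<in>cadlag I. ?near T \<epsilon> x y \<longrightarrow> y \<in> \<Union>\<K>" by blast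
  qed
  ultimately have "istopology ?P" unfolding istopology_def by blast
  then show ?thesis unfolding ucc_topology_def by (simp add: topology_inverse')
qed

text \<open>The \<open>\<sigma>\<close>-algebra generated by the evaluations \<open>x \<mapsto> x t p\<close>.\<close>

definition path_algebra :: "'i set \<Rightarrow> (real \<Rightarrow> 'i \<Rightarrow> real) measure" where
  "path_algebra I =
     restrict_space (Pi\<^sub>M {0..} (\<lambda>_. Pi\<^sub>M I (\<lambda>_. borel))) (cadlag I)"

definition path_law :: "'a measure \<Rightarrow> 'i set \<Rightarrow> (real \<Rightarrow> 'a \<Rightarrow> 'i \<Rightarrow> real)
    \<Rightarrow> (real \<Rightarrow> 'i \<Rightarrow> real) measure" where
  "path_law M I X = distr M (path_algebra I) (\<lambda>\<omega>. \<lambda>t\<in>{0..}. X t \<omega>)"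

definition laws_converge :: "'i set \<Rightarrow> (nat \<Rightarrow> (real \<Rightarrow> 'i \<Rightarrow> real) measure)
    \<Rightarrow> (real \<Rightarrow> 'i \<Rightarrow> real) measure \<Rightarrow> bool" where
  "laws_converge I \<mu> \<nu> \<longleftrightarrow>
     (\<forall>f :: (real \<Rightarrow> 'i \<Rightarrow> real) \<Rightarrow> real.
        f \<in> borel_measurable (path_algebra I) \<and>
        continuous_map (ucc_topology I) euclideanreal f \<and>
        (\<exists>C. \<forall>x\<in>cadlag I. \<bar>f x\<bar> \<le> C) \<longrightarrow>
        (\<lambda>n. \<integral>x. f x \<partial>(\<mu> n)) \<longlonglongrightarrow> (\<integral>x. f x \<partial>\<nu>))"


section \<open>Multilevel TASEP\<close>

text \<open>The array after the clock of particle \<open>(i, j)\<close> rings, when \<open>y\<close> is the array just before.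
  If the particle is not blocked, it moves together with the maximal run
  \<open>(i + 1, j + 1), \<dots>, (i + k, j + k)\<close> of particles at the same location.\<close>

definition tasep_jump :: "nat \<Rightarrow> nat \<times> nat \<Rightarrow> (nat \<times> nat \<Rightarrow> int) \<Rightarrow> nat \<times> nat \<Rightarrow> int" where
  "tasep_jump N = (\<lambda>(i, j) y.
     if i < j \<and> y (i, j - 1) = y (i, j) + 1 then y
     else (\<lambda>q. if \<exists>m. q = (i + m, j + m) \<and> j + m \<le> N \<and> (\<forall>l\<le>m. y (i + l, j + l) = y (i, j))
               then y q + 1 else y q))"

text \<open>The clock of particle \<open>p\<close> has independent exponential waiting times \<open>\<xi> p 0, \<xi> p 1, \<dots>\<close>.\<close>

definition ring_times :: "(nat \<times> nat \<Rightarrow> nat \<Rightarrow> 'a \<Rightarrow> real) \<Rightarrow> 'a \<Rightarrow> nat \<times> nat \<Rightarrow> real set" where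
  "ring_times \<xi> \<omega> p = {\<Sum>k\<le>m. \<xi> p k \<omega> |m. True}"

text \<open>In \<open>dynamics\<close>, \<open>z\<close> is the left limit \<open>Y(t-)\<close>. The condition is imposed almost surely only
  because simultaneous rings, for which no rule is specified, form a nonempty null event.\<close>

locale multilevel_tasep = prob_space M for M :: "'a measure" +
  fixes N :: nat
    and \<xi> :: "nat \<times> nat \<Rightarrow> nat \<Rightarrow> 'a \<Rightarrow> real"
    and Y :: "real \<Rightarrow> 'a \<Rightarrow> nat \<times> nat \<Rightarrow> int"
  assumes clock_exponential:
      "\<And>p k. p \<in> gt_index N \<Longrightarrow> distributed M lborel (\<xi> p k) (exponential_density 1)"
    and clocks_indep:
      "indep_vars (\<lambda>_. borel) (\<lambda>(p, k). \<xi> p k) (gt_index N \<times> UNIV)"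
    and initial_indep:
      "indep_set
         (sets (vimage_algebra (space M) (Y 0) (Pi\<^sub>M (gt_index N) (\<lambda>_. count_space UNIV))))
         (sets (vimage_algebra (space M) (\<lambda>\<omega>. \<lambda>(p, k)\<in>gt_index N \<times> UNIV. \<xi> p k \<omega>)
            (Pi\<^sub>M (gt_index N \<times> UNIV) (\<lambda>_. borel))))"
    and Y_measurable:
      "\<And>t. t \<ge> 0 \<Longrightarrow> Y t \<in> M \<rightarrow>\<^sub>M Pi\<^sub>M (gt_index N) (\<lambda>_. count_space UNIV)"
    and Y_in_GT: "\<And>t \<omega>. t \<ge> 0 \<Longrightarrow> \<omega> \<in> space M \<Longrightarrow> Y t \<omega> \<in> GT N"
    and Y_cadlag:
      "\<And>\<omega>. \<omega> \<in> space M \<Longrightarrow>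
         (\<lambda>t\<in>{0..}. \<lambda>p\<in>gt_index N. real_of_int (Y t \<omega> p)) \<in> cadlag (gt_index N)"
    and dynamics:
      "AE \<omega> in M. \<forall>t>0. \<exists>z. (\<forall>\<^sub>F s in at_left t. Y s \<omega> = z) \<and>
         ((\<forall>p\<in>gt_index N. t \<notin> ring_times \<xi> \<omega> p) \<longrightarrow> Y t \<omega> = z) \<and>
         (\<forall>p\<in>gt_index N. t \<in> ring_times \<xi> \<omega> p \<longrightarrow> Y t \<omega> = tasep_jump N p z)"


section \<open>Reflected interlacing Brownian motions\<close>

locale standard_brownian_motion = prob_space M for M :: "'b measure" +
  fixes B :: "real \<Rightarrow> 'b \<Rightarrow> real"
  assumes B_measurable: "\<And>t. t \<ge> 0 \<Longrightarrow> B t \<in> borel_measurable M"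
    and B_zero: "AE \<omega> in M. B 0 \<omega> = 0"
    and B_continuous: "AE \<omega> in M. continuous_on {0..} (\<lambda>t. B t \<omega>)"
    and B_increment:
      "\<And>s t. 0 \<le> s \<Longrightarrow> s < t \<Longrightarrow>
         distributed M lborel (\<lambda>\<omega>. B t \<omega> - B s \<omega>) (normal_density 0 (sqrt (t - s)))"
    and B_indep_increments:
      "\<And>(\<tau> :: nat \<Rightarrow> real) n. 0 \<le> \<tau> 0 \<Longrightarrow> mono \<tau> \<Longrightarrow>
         indep_vars (\<lambda>_. borel) (\<lambda>k \<omega>. B (\<tau> (Suc k)) \<omega> - B (\<tau> k) \<omega>) {..<n}"

text \<open>A continuous nondecreasing function \<open>L\<close> on \<open>[0, \<infinity>)\<close> increases only at times in \<open>A\<close> if it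
  is locally constant around every time outside \<open>A\<close>. For closed \<open>A\<close>, this means that the
  Stieltjes measure \<open>dL\<close> does not charge the complement of \<open>A\<close>.\<close>

definition increases_only_on :: "(real \<Rightarrow> real) \<Rightarrow> real set \<Rightarrow> bool" where
  "increases_only_on L A \<longleftrightarrow>
     (\<forall>t\<ge>0. t \<notin> A \<longrightarrow> (\<forall>\<^sub>F s in at t within {0..}. L s = L t))"

locale reflected_interlacing_bm = prob_space M for M :: "'b measure" +
  fixes N :: nat
    and B Lm Lp :: "nat \<times> nat \<Rightarrow> real \<Rightarrow> 'b \<Rightarrow> real"
    and W :: "real \<Rightarrow> 'b \<Rightarrow> nat \<times> nat \<Rightarrow> real"
  assumes B_brownian: "\<And>p. p \<in> gt_index N \<Longrightarrow> standard_brownian_motion M (B p)"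
    and B_indep:
      "indep_vars (\<lambda>_. Pi\<^sub>M {0..} (\<lambda>_. borel)) (\<lambda>p \<omega>. \<lambda>t\<in>{0..}. B p t \<omega>) (gt_index N)"
    and initial_indep:
      "indep_set
         (sets (vimage_algebra (space M) (W 0) (Pi\<^sub>M (gt_index N) (\<lambda>_. borel))))
         (sets (vimage_algebra (space M) (\<lambda>\<omega>. \<lambda>(p, t)\<in>gt_index N \<times> {0..}. B p t \<omega>)
            (Pi\<^sub>M (gt_index N \<times> {0..}) (\<lambda>_. borel))))"
    and W_measurable: "\<And>t. t \<ge> 0 \<Longrightarrow> W t \<in> M \<rightarrow>\<^sub>M Pi\<^sub>M (gt_index N) (\<lambda>_. borel)"
    and W_in_GTc: "\<And>t \<omega>. t \<ge> 0 \<Longrightarrow> \<omega> \<in> space M \<Longrightarrow> W t \<omega> \<in> GTc N"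
    and W_continuous:
      "\<And>p \<omega>. p \<in> gt_index N \<Longrightarrow> \<omega> \<in> space M \<Longrightarrow> continuous_on {0..} (\<lambda>t. W t \<omega> p)"
    and L_measurable:
      "\<And>p t. p \<in> gt_index N \<Longrightarrow> t \<ge> 0 \<Longrightarrow>
         Lm p t \<in> borel_measurable M \<and> Lp p t \<in> borel_measurable M"
    and L_regular:
      "AE \<omega> in M. \<forall>p\<in>gt_index N. \<forall>L\<in>{Lm p, Lp p}.
         L 0 \<omega> = 0 \<and> continuous_on {0..} (\<lambda>t. L t \<omega>) \<and> mono_on {0..} (\<lambda>t. L t \<omega>)"
    and decomposition:
      "AE \<omega> in M. \<forall>p\<in>gt_index N. \<forall>t\<ge>0.
         W t \<omega> p = W 0 \<omega> p + B p t \<omega> + Lm p t \<omega> - Lp p t \<omega>"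
    and reflection_from_below:
      "AE \<omega> in M. \<forall>(i, k)\<in>gt_index N.
         if i = 1 then \<forall>t\<ge>0. Lm (i, k) t \<omega> = 0
         else increases_only_on (\<lambda>t. Lm (i, k) t \<omega>) {t. W t \<omega> (i, k) = W t \<omega> (i - 1, k - 1)}"
    and reflection_from_above:
      "AE \<omega> in M. \<forall>(i, k)\<in>gt_index N.
         if i = k then \<forall>t\<ge>0. Lp (i, k) t \<omega> = 0
         else increases_only_on (\<lambda>t. Lp (i, k) t \<omega>) {t. W t \<omega> (i, k) = W t \<omega> (i, k - 1)}"

end

theory Submission
  imports Defs
begin

text \<open>A particle that is pushed from below and blocked from above solves a reflection problem whose
  driver is its own clock. Two solutions of such problems differ, level by level, by at most a
  constant times the distance of their drivers, so both TASEP and the reflected Brownian motions are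
  uniformly close to an Euler scheme that clamps the increments of the driver on a grid of mesh
  \<open>1 / k\<close>. For TASEP the driver is the centred renewal process of the clock, which is the negative
  of the centred random walk of the waiting times, up to an oscillation controlled by a maximal
  inequality. For fixed \<open>k\<close> the scheme is a continuous function of independent increments, to which
  the central limit theorem applies; then \<open>k\<close> tends to infinity. As the test functional \<open>f\<close> is only continuous, on a
  nonseparable space, one first selects an open set of increments of large probability on which \<open>f\<close>
  oscillates little near the curve of the scheme.\<close>

section \<open>Stability of reflected interlacing systems\<close>

text \<open>An invariance principle for the clocks cannot simply be pushed through the reflection
  map: in a nonseparable path space a continuous functional has no uniform modulus, and an almost
  sure representation of whole paths is delicate. Convergence in law is therefore used only for
  countably many real increments, which can be coupled coordinate by coordinate; everything on the
  level of paths is a deterministic estimate. The order of limits is forced: \<open>n\<close> tends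
  to infinity for a fixed mesh, and the error of the mesh has to be bounded uniformly in large
  \<open>n\<close>. This is why fourth moments appear. A horizon \<open>m\<close> contains about
  \<open>m * k\<close> blocks; second moments give each block an exceptional probability of order
  \<open>1 / k\<close>, a sum that need not be small, whereas fourth moments give
  \<open>1 / k\<^sup>2\<close>. TASEP and the Brownian system are compared with the scheme by the
  same stability result, which must therefore tolerate jumps of solutions and barriers.\<close>

lemma real_interval_induct [consumes 1, case_names base left right]:
  fixes T :: real
  assumes t: "t \<in> {0..T}"
    and base: "Q 0"
    and left: "\<And>t. 0 < t \<Longrightarrow> t \<le> T \<Longrightarrow> (\<And>s. 0 \<le> s \<Longrightarrow> s < t \<Longrightarrow> Q s) \<Longrightarrow> Q t"
    and right: "\<And>t. 0 \<le> t \<Longrightarrow> t < T \<Longrightarrow> Q t \<Longrightarrow> \<forall>\<^sub>F s in at_right t. Q s"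
  shows "Q t"
proof (rule ccontr)
  assume nQ: "\<not> Q t"
  define B where "B = {t\<in>{0..T}. \<not> Q t}"
  have tB: "t \<in> B" using t nQ by (simp add: B_def)
  have bdd: "bdd_below B" by (rule bdd_belowI[of _ 0]) (simp add: B_def)
  define m where "m = Inf B"
  have m0: "0 \<le> m" unfolding m_def using tB by (intro cInf_greatest) (auto simp: B_def)
  have mt: "m \<le> t" unfolding m_def using tB bdd by (rule cInf_lower)
  have below: "Q s" if "0 \<le> s" "s < m" for s
  proof (rule ccontr)
    assume "\<not> Q s"
    then have "s \<in> B" using that mt t by (simp add: B_def)
    then have "m \<le> s" unfolding m_def using bdd by (rule cInf_lower)
    then show False using that by simp
  qed
  have Qm: "Q m"
    using base left[of m] below m0 mt t by (cases "m = 0") auto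
  then have "m < t" using mt nQ by (cases "m = t") auto
  then have "\<forall>\<^sub>F s in at_right m. Q s" using right m0 t Qm by simp
  then obtain b where b: "b > m" "\<forall>y>m. y < b \<longrightarrow> Q y"
    unfolding eventually_at_right_field by blast
  have "b \<le> s" if "s \<in> B" for s
  proof -
    have "m \<le> s" unfolding m_def using that bdd by (rule cInf_lower)
    moreover have "s \<noteq> m" using Qm that by (auto simp: B_def)
    ultimately show ?thesis using b(2) that by (force simp: B_def not_le)
  qed
  then have "b \<le> m" unfolding m_def using tB by (intro cInf_greatest) auto
  then show False using b by simp
qed

text \<open>Nearby values are compared with the value at \<open>t\<close> only, not with each other.
  This is what an induction along the line consumes; it admits downward jumps at \<open>t\<close>
  and excludes upward ones.\<close>

definition nonincreasing_at :: "(real \<Rightarrow> real) \<Rightarrow> real \<Rightarrow> bool" where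
  "nonincreasing_at f t \<longleftrightarrow>
     (\<forall>\<^sub>F s in at_right t. f s \<le> f t) \<and> (0 < t \<longrightarrow> (\<forall>\<^sub>F s in at_left t. f t \<le> f s))"

lemma nonincreasing_at_add:
  assumes "nonincreasing_at f t" "nonincreasing_at g t"
  shows "nonincreasing_at (\<lambda>s. f s + g s) t"
proof -
  have "\<forall>\<^sub>F s in at_right t. f s + g s \<le> f t + g t"
    using assms[unfolded nonincreasing_at_def, THEN conjunct1] by eventually_elim simp
  moreover have "\<forall>\<^sub>F s in at_left t. f t + g t \<le> f s + g s" if "0 < t"
    using assms[unfolded nonincreasing_at_def, THEN conjunct2, rule_format, OF that]
    by eventually_elim simp
  ultimately show ?thesis by (simp add: nonincreasing_at_def)
qed

text \<open>\<open>D + e\<close> stands for the difference of two solutions, split into the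
  difference \<open>e\<close> of the drivers and a remainder \<open>D\<close> that cannot increase
  while the sum exceeds \<open>c\<close>. Since \<open>D\<close> may jump, the argument is an
  induction along the line instead of a last exit from the level \<open>c\<close>.\<close>

lemma one_sided_comparison:
  fixes D e :: "real \<Rightarrow> real"
  assumes dec: "\<And>t. t \<in> {0..T} \<Longrightarrow> c < D t + e t \<Longrightarrow> nonincreasing_at D t"
    and cont: "\<And>t. 0 \<le> t \<Longrightarrow> t < T \<Longrightarrow> ((\<lambda>s. D s + e s) \<longlongrightarrow> D t + e t) (at_right t)"
    and e: "\<And>t. t \<in> {0..T} \<Longrightarrow> \<bar>e t\<bar> \<le> \<epsilon>"
    and init: "D 0 + e 0 \<le> c"
    and t: "t \<in> {0..T}"
  shows "D t + e t \<le> c + 2 * \<epsilon>"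
proof (rule field_le_epsilon)
  fix \<eta> :: real assume \<eta>: "0 < \<eta>"
  \<comment> \<open>The invariant must concern \<open>D\<close>: the sum can still grow through
    \<open>e\<close> while \<open>D\<close> falls. Passing from the sum to \<open>D\<close> and back
    costs \<epsilon> each time.\<close>
  have "D t \<le> c + \<eta> + \<epsilon>" using t
  proof (induction t rule: real_interval_induct)
    case base
    have "\<bar>e 0\<bar> \<le> \<epsilon>" using t by (intro e) auto
    then show ?case using init \<eta> by linarith
  next
    case (left t)
    show ?case
    proof (cases "c < D t + e t")
      case True
      then have "\<forall>\<^sub>F s in at_left t. D t \<le> D s"
        using dec[of t] left by (auto simp: nonincreasing_at_def)
      moreover have "\<forall>\<^sub>F s in at_left t. s \<in> {0<..<t}"
        using left by (auto simp: eventually_at_left_field intro!: exI[of _ 0])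
      ultimately have "\<forall>\<^sub>F s in at_left t. D t \<le> D s \<and> s \<in> {0<..<t}"
        by eventually_elim auto
      then obtain s where "D t \<le> D s" "s \<in> {0<..<t}"
        by (auto dest!: eventually_happens simp: trivial_limit_at_left_real)
      then show ?thesis using left(3)[of s] by auto
    next
      case False
      then show ?thesis using e[of t] left \<eta> by auto
    qed
  next
    case (right t)
    show ?case
    \<comment> \<open>The slack \<eta> separates two open regimes: a strict bound persists to the
      right by continuity, and otherwise the sum is strictly above \<open>c\<close>, so
      \<open>D\<close> cannot rise.\<close>
    proof (cases "D t + e t < c + \<eta>")
      case True
      then have "\<forall>\<^sub>F s in at_right t. D s + e s < c + \<eta>"
        using cont[of t] right by (auto dest: order_tendstoD)
      moreover have "\<forall>\<^sub>F s in at_right t. s \<in> {t<..<T}"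
        using right by (auto simp: eventually_at_right_field intro!: exI[of _ T])
      ultimately show ?thesis
      proof eventually_elim
        case (elim s)
        then show ?case using e[of s] right by auto
      qed
    next
      case False
      then have "\<forall>\<^sub>F s in at_right t. D s \<le> D t"
        using dec[of t] right \<eta> by (auto simp: nonincreasing_at_def)
      then show ?thesis using right by (auto elim: eventually_mono)
    qed
  qed
  then show "D t + e t \<le> c + 2 * \<epsilon> + \<eta>" using e[OF t] by auto
qed

text \<open>The local monotonicity of \<open>y - \<beta>\<close> away from a barrier says where the regulators act without
  introducing them; the slack \<open>\<theta>\<close> absorbs the lattice spacing of TASEP.\<close>

definition reflected_system ::
  "nat \<Rightarrow> real \<Rightarrow> real \<Rightarrow> (real \<Rightarrow> nat \<times> nat \<Rightarrow> real) \<Rightarrow> (real \<Rightarrow> nat \<times> nat \<Rightarrow> real) \<Rightarrow> bool" where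
  "reflected_system N \<theta> T y \<beta> \<longleftrightarrow>
     (\<forall>i k. (i, k) \<in> gt_index N \<longrightarrow> (\<forall>t\<in>{0..T}.
        (1 < i \<longrightarrow> y t (i - 1, k - 1) \<le> y t (i, k)) \<and>
        (i < k \<longrightarrow> y t (i, k) \<le> y t (i, k - 1)) \<and>
        ((1 < i \<longrightarrow> y t (i - 1, k - 1) + \<theta> < y t (i, k)) \<longrightarrow>
           nonincreasing_at (\<lambda>s. y s (i, k) - \<beta> s (i, k)) t) \<and>
        ((i < k \<longrightarrow> y t (i, k) + \<theta> < y t (i, k - 1)) \<longrightarrow>
           nonincreasing_at (\<lambda>s. \<beta> s (i, k) - y s (i, k)) t)))"

lemma reflected_systemD:
  assumes "reflected_system N \<theta> T y \<beta>" "(i, k) \<in> gt_index N" "t \<in> {0..T}"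
  shows "1 < i \<Longrightarrow> y t (i - 1, k - 1) \<le> y t (i, k)"
    and "i < k \<Longrightarrow> y t (i, k) \<le> y t (i, k - 1)"
    and "(1 < i \<Longrightarrow> y t (i - 1, k - 1) + \<theta> < y t (i, k)) \<Longrightarrow>
           nonincreasing_at (\<lambda>s. y s (i, k) - \<beta> s (i, k)) t"
    and "(i < k \<Longrightarrow> y t (i, k) + \<theta> < y t (i, k - 1)) \<Longrightarrow>
           nonincreasing_at (\<lambda>s. \<beta> s (i, k) - y s (i, k)) t"
  using assms unfolding reflected_system_def by blast+

lemma reflected_system_one_sided:
  assumes Y: "reflected_system N \<theta> T y \<beta>" and W: "reflected_system N \<theta> T w \<gamma>"
    and p: "(i, k) \<in> gt_index N"
    and lower: "\<And>t. t \<in> {0..T} \<Longrightarrow> 1 < i \<Longrightarrow> y t (i - 1, k - 1) - w t (i - 1, k - 1) \<le> E"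
    and upper: "\<And>t. t \<in> {0..T} \<Longrightarrow> i < k \<Longrightarrow> y t (i, k - 1) - w t (i, k - 1) \<le> E"
    and init: "y 0 (i, k) - w 0 (i, k) \<le> E + \<theta> + \<epsilon>"
    and driver: "\<And>t. t \<in> {0..T} \<Longrightarrow> \<bar>\<beta> t (i, k) - \<gamma> t (i, k)\<bar> \<le> \<epsilon>"
    and cont: "\<And>t. 0 \<le> t \<Longrightarrow> t < T \<Longrightarrow>
       ((\<lambda>s. y s (i, k) - w s (i, k)) \<longlongrightarrow> y t (i, k) - w t (i, k)) (at_right t)"
    and t: "t \<in> {0..T}"
  shows "y t (i, k) - w t (i, k) \<le> E + \<theta> + 3 * \<epsilon>"
proof -
  define D where "D s = (y s (i, k) - \<beta> s (i, k)) + (\<gamma> s (i, k) - w s (i, k))" for s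
  define e where "e s = \<beta> s (i, k) - \<gamma> s (i, k)" for s
  have De: "D s + e s = y s (i, k) - w s (i, k)" for s by (simp add: D_def e_def)
  have \<epsilon>: "0 \<le> \<epsilon>" using driver[OF t] by linarith
  \<comment> \<open>Exchanging the barriers of the two systems costs \<open>E\<close>. Hence above
    \<open>E + \<theta>\<close> the particle of \<open>y\<close> is more than \<theta> over its
    lower barrier and that of \<open>w\<close> more than \<theta> under its upper one. The
    \<epsilon> in the threshold covers the initial difference.\<close>
  have "D t + e t \<le> (E + \<theta> + \<epsilon>) + 2 * \<epsilon>"
  proof (rule one_sided_comparison[OF _ _ _ _ t])
    fix t assume t: "t \<in> {0..T}" and gt: "E + \<theta> + \<epsilon> < D t + e t"
    have "nonincreasing_at (\<lambda>s. y s (i, k) - \<beta> s (i, k)) t"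
      using reflected_systemD(1)[OF W p t] lower[OF t] gt \<epsilon> unfolding De
      by (intro reflected_systemD(3)[OF Y p t]) linarith
    moreover have "nonincreasing_at (\<lambda>s. \<gamma> s (i, k) - w s (i, k)) t"
      using reflected_systemD(2)[OF Y p t] upper[OF t] gt \<epsilon> unfolding De
      by (intro reflected_systemD(4)[OF W p t]) linarith
    ultimately show "nonincreasing_at D t"
      unfolding D_def by (rule nonincreasing_at_add)
  next
    show "\<bar>e t\<bar> \<le> \<epsilon>" if "t \<in> {0..T}" for t
      using driver[OF that] by (simp add: e_def)
  qed (use init cont in \<open>simp_all add: De\<close>)
  then show ?thesis by (simp add: De)
qed

lemma finite_gt_index: "finite (gt_index N)"
  by (rule finite_subset[of _ "{..N} \<times> {..N}"]) (auto simp: gt_index_def)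

lemma gt_index_parents:
  assumes "(i, k) \<in> gt_index N"
  shows "1 < i \<Longrightarrow> (i - 1, k - 1) \<in> gt_index N" "i < k \<Longrightarrow> (i, k - 1) \<in> gt_index N"
  using assms by (auto simp: gt_index_def)

text \<open>Stability of two-sided reflection needs no regularity of the barriers, which may even
  collide: while \<open>y - w\<close> exceeds the distance of the barriers, \<open>y\<close> is away from its lower
  and \<open>w\<close> away from its upper barrier, so apart from the drivers \<open>y - w\<close> can only decrease.\<close>

proposition reflected_system_stable:
  assumes Y: "reflected_system N \<theta> T y \<beta>" and W: "reflected_system N \<theta> T w \<gamma>" and \<theta>: "0 \<le> \<theta>"
    and init: "\<And>p. p \<in> gt_index N \<Longrightarrow> \<bar>y 0 p - w 0 p\<bar> \<le> \<epsilon>"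
    and driver: "\<And>p t. p \<in> gt_index N \<Longrightarrow> t \<in> {0..T} \<Longrightarrow> \<bar>\<beta> t p - \<gamma> t p\<bar> \<le> \<epsilon>"
    and cont: "\<And>p t. p \<in> gt_index N \<Longrightarrow> 0 \<le> t \<Longrightarrow> t < T \<Longrightarrow>
       ((\<lambda>s. y s p - w s p) \<longlongrightarrow> y t p - w t p) (at_right t)"
    and p: "p \<in> gt_index N" and t: "t \<in> {0..T}"
  shows "\<bar>y t p - w t p\<bar> \<le> real N * (\<theta> + 3 * \<epsilon>)"
proof -
  have \<epsilon>: "0 \<le> \<epsilon>" using driver[OF p t] by linarith
  \<comment> \<open>Both barriers of a particle on level \<open>k\<close> sit on level
    \<open>k - 1\<close>, so each level adds one \<open>\<theta> + 3 * \<epsilon>\<close>.\<close>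
  have "\<bar>y t (i, k) - w t (i, k)\<bar> \<le> real k * (\<theta> + 3 * \<epsilon>)" if "(i, k) \<in> gt_index N" "t \<in> {0..T}" for i k t
    using that
  proof (induction k arbitrary: i t)
    case 0
    then show ?case by (simp add: gt_index_def)
  next
    case (Suc k)
    note p = Suc.prems(1)
    have E: "0 \<le> real k * (\<theta> + 3 * \<epsilon>)" using \<theta> \<epsilon> by simp
    have low: "\<bar>y t (i - 1, k) - w t (i - 1, k)\<bar> \<le> real k * (\<theta> + 3 * \<epsilon>)" if "t \<in> {0..T}" "1 < i" for t
      using Suc.IH[OF _ that(1)] gt_index_parents(1)[OF p that(2)] by simp
    have up: "\<bar>y t (i, k) - w t (i, k)\<bar> \<le> real k * (\<theta> + 3 * \<epsilon>)" if "t \<in> {0..T}" "i < Suc k" for t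
      using Suc.IH[OF _ that(1)] gt_index_parents(2)[OF p that(2)] by simp
    have "y t (i, Suc k) - w t (i, Suc k) \<le> real k * (\<theta> + 3 * \<epsilon>) + \<theta> + 3 * \<epsilon>"
    proof (rule reflected_system_one_sided[OF Y W p])
      show "y 0 (i, Suc k) - w 0 (i, Suc k) \<le> real k * (\<theta> + 3 * \<epsilon>) + \<theta> + \<epsilon>"
        using init[OF p] E \<theta> by linarith
    qed (use low up Suc.prems cont[OF p] driver[OF p] in \<open>force+\<close>)
    moreover have "w t (i, Suc k) - y t (i, Suc k) \<le> real k * (\<theta> + 3 * \<epsilon>) + \<theta> + 3 * \<epsilon>"
    proof (rule reflected_system_one_sided[OF W Y p])
      show "w 0 (i, Suc k) - y 0 (i, Suc k) \<le> real k * (\<theta> + 3 * \<epsilon>) + \<theta> + \<epsilon>"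
        using init[OF p] E \<theta> by linarith
      show "((\<lambda>s. w s (i, Suc k) - y s (i, Suc k)) \<longlongrightarrow> w t (i, Suc k) - y t (i, Suc k)) (at_right t)"
        if "0 \<le> t" "t < T" for t
        using tendsto_minus[OF cont[OF p that]] by simp
    qed (use low up Suc.prems driver[OF p] in \<open>force simp: abs_minus_commute abs_le_iff\<close>)+
    ultimately show ?case by (auto simp: algebra_simps)
  qed
  moreover obtain i k where ik: "p = (i, k)" by (cases p)
  ultimately have "\<bar>y t p - w t p\<bar> \<le> real k * (\<theta> + 3 * \<epsilon>)" using p t by simp
  also have "\<dots> \<le> real N * (\<theta> + 3 * \<epsilon>)"
    using p ik \<theta> \<epsilon> by (intro mult_right_mono) (auto simp: gt_index_def)
  finally show ?thesis .
qed

section \<open>The clamped Euler scheme\<close>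

text \<open>\<open>clamp_scheme u l j i\<close> is the particle at position \<open>i\<close> on level \<open>l\<close> after \<open>j\<close> steps, and
  \<open>u (p, j)\<close> is the \<open>j\<close>-th increment of the driver of \<open>p\<close>. A level is clamped to the positions
  that the level below has after the same step.\<close>

fun clamp_scheme :: "((nat \<times> nat) \<times> nat \<Rightarrow> real) \<Rightarrow> nat \<Rightarrow> nat \<Rightarrow> nat \<Rightarrow> real" where
  "clamp_scheme u 0 j i = 0"
| "clamp_scheme u (Suc l) 0 i = 0"
| "clamp_scheme u (Suc l) (Suc j) i =
    (let x = clamp_scheme u (Suc l) j i + u ((i, Suc l), j);
         x' = (if i < Suc l then min x (clamp_scheme u l (Suc j) i) else x)
     in if 1 < i then max x' (clamp_scheme u l (Suc j) (i - 1)) else x')"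

lemma clamp_scheme_zero [simp]: "clamp_scheme u l 0 i = 0"
  by (cases l) auto

text \<open>A step applies \<open>min\<close> and then \<open>max\<close>, so the upper bound
  survives only if the two barriers are ordered. That ordering is the interlacing of the level below
  with the one beneath it, whence the induction on levels.\<close>

lemma clamp_scheme_interlacing:
  assumes "1 \<le> i" "i \<le> l"
  shows "1 < i \<Longrightarrow> clamp_scheme u (l - 1) j (i - 1) \<le> clamp_scheme u l j i"
    and "i < l \<Longrightarrow> clamp_scheme u l j i \<le> clamp_scheme u (l - 1) j i"
proof -
  have "(1 < i \<longrightarrow> clamp_scheme u (l - 1) j (i - 1) \<le> clamp_scheme u l j i) \<and>
        (i < l \<longrightarrow> clamp_scheme u l j i \<le> clamp_scheme u (l - 1) j i)"
    using assms
  proof (induction l arbitrary: i)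
    case 0
    then show ?case by simp
  next
    case (Suc l)
    have mid: "clamp_scheme u l j (i - 1) \<le> clamp_scheme u l j i" if i: "1 < i" "i < Suc l"
    proof -
      have "clamp_scheme u l j (i - 1) \<le> clamp_scheme u (l - 1) j (i - 1)"
        using Suc.IH[of "i - 1"] i by auto
      also have "\<dots> \<le> clamp_scheme u l j i" using Suc.IH[of i] i by auto
      finally show ?thesis .
    qed
    show ?case
    proof (cases j)
      case (Suc j')
      then show ?thesis using mid by (auto simp: Let_def)
    qed simp
  qed
  then show "1 < i \<Longrightarrow> clamp_scheme u (l - 1) j (i - 1) \<le> clamp_scheme u l j i"
    and "i < l \<Longrightarrow> clamp_scheme u l j i \<le> clamp_scheme u (l - 1) j i" by auto
qed

text \<open>Discrete form of the reflection rule: a barrier alters a step only if the step ends on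
  that barrier.\<close>

lemma clamp_scheme_step:
  shows "(1 < i \<Longrightarrow> clamp_scheme u l (Suc j) (i - 1) < clamp_scheme u (Suc l) (Suc j) i) \<Longrightarrow>
          clamp_scheme u (Suc l) (Suc j) i \<le> clamp_scheme u (Suc l) j i + u ((i, Suc l), j)"
    and "(i < Suc l \<Longrightarrow> clamp_scheme u (Suc l) (Suc j) i < clamp_scheme u l (Suc j) i) \<Longrightarrow>
          clamp_scheme u (Suc l) j i + u ((i, Suc l), j) \<le> clamp_scheme u (Suc l) (Suc j) i"
  by (auto simp: Let_def min_def max_def split: if_splits)

definition scheme_path ::
  "((nat \<times> nat) \<times> nat \<Rightarrow> real) \<Rightarrow> real \<Rightarrow> real \<Rightarrow> nat \<times> nat \<Rightarrow> real" where
  "scheme_path u \<delta> t p = clamp_scheme u (snd p) (nat \<lfloor>t / \<delta>\<rfloor>) (fst p)"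

definition step_driver ::
  "((nat \<times> nat) \<times> nat \<Rightarrow> real) \<Rightarrow> real \<Rightarrow> real \<Rightarrow> nat \<times> nat \<Rightarrow> real" where
  "step_driver u \<delta> t p = (\<Sum>j<nat \<lfloor>t / \<delta>\<rfloor>. u (p, j))"

lemma floor_grid_at_right:
  fixes \<delta> :: real
  assumes "0 < \<delta>"
  shows "\<forall>\<^sub>F s in at_right t. \<lfloor>s / \<delta>\<rfloor> = \<lfloor>t / \<delta>\<rfloor>"
proof -
  have lt: "t < (of_int \<lfloor>t / \<delta>\<rfloor> + 1) * \<delta>" using assms floor_correct[of "t / \<delta>"] by (simp add: pos_divide_less_eq[symmetric])
  have "\<forall>\<^sub>F s in at_right t. t < s \<and> s < (of_int \<lfloor>t / \<delta>\<rfloor> + 1) * \<delta>"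
    unfolding eventually_at_right_field using lt by blast
  then show ?thesis
  proof eventually_elim
    case (elim s)
    have "of_int \<lfloor>t / \<delta>\<rfloor> \<le> t / \<delta>" by simp
    also have "\<dots> \<le> s / \<delta>" using elim assms by (simp add: divide_right_mono)
    finally have "of_int \<lfloor>t / \<delta>\<rfloor> \<le> s / \<delta>" .
    then show ?case using elim assms by (intro floor_unique) (auto simp: pos_divide_less_eq)
  qed
qed

text \<open>The ceiling minus one is the floor at \<open>t\<close> off the grid and one less on it,
  so both cases are covered by one formula.\<close>

lemma floor_grid_at_left:
  fixes \<delta> :: real
  assumes "0 < \<delta>"
  shows "\<forall>\<^sub>F s in at_left t. \<lfloor>s / \<delta>\<rfloor> = \<lceil>t / \<delta>\<rceil> - 1"
proof -
  have "of_int \<lceil>t / \<delta>\<rceil> - 1 < t / \<delta>" by linarith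
  then have lt: "(of_int \<lceil>t / \<delta>\<rceil> - 1) * \<delta> < t" using assms by (simp add: pos_less_divide_eq)
  have "\<forall>\<^sub>F s in at_left t. (of_int \<lceil>t / \<delta>\<rceil> - 1) * \<delta> < s \<and> s < t"
    unfolding eventually_at_left_field using lt by (intro exI[of _ "(of_int \<lceil>t / \<delta>\<rceil> - 1) * \<delta>"]) auto
  then show ?thesis
  proof eventually_elim
    case (elim s)
    have "s / \<delta> < t / \<delta>" using elim assms by (simp add: divide_strict_right_mono)
    also have "\<dots> \<le> of_int \<lceil>t / \<delta>\<rceil>" by simp
    finally have "s / \<delta> < of_int \<lceil>t / \<delta>\<rceil>" .
    moreover have "of_int \<lceil>t / \<delta>\<rceil> - 1 \<le> s / \<delta>" using elim assms by (simp add: pos_le_divide_eq)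
    ultimately show ?case by (intro floor_unique) auto
  qed
qed

lemma scheme_path_at_right:
  fixes \<delta> :: real
  assumes "0 < \<delta>"
  shows "\<forall>\<^sub>F s in at_right t. scheme_path u \<delta> s = scheme_path u \<delta> t \<and> step_driver u \<delta> s = step_driver u \<delta> t"
  using floor_grid_at_right[OF assms, of t]
  by eventually_elim (simp add: scheme_path_def step_driver_def fun_eq_iff)

lemma scheme_path_at_left:
  assumes \<delta>: "0 < \<delta>" and t: "0 < t"
  obtains j where "nat \<lfloor>t / \<delta>\<rfloor> = j \<or> nat \<lfloor>t / \<delta>\<rfloor> = Suc j"
    "\<forall>\<^sub>F s in at_left t. \<forall>p. scheme_path u \<delta> s p = clamp_scheme u (snd p) j (fst p) \<and>
       step_driver u \<delta> s p = (\<Sum>j'<j. u (p, j'))"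
proof
  have "0 < t / \<delta>" using assms by simp
  then have "0 < \<lceil>t / \<delta>\<rceil>" by simp
  then show "nat \<lfloor>t / \<delta>\<rfloor> = nat (\<lceil>t / \<delta>\<rceil> - 1) \<or> nat \<lfloor>t / \<delta>\<rfloor> = Suc (nat (\<lceil>t / \<delta>\<rceil> - 1))"
    by linarith
  show "\<forall>\<^sub>F s in at_left t. \<forall>p. scheme_path u \<delta> s p = clamp_scheme u (snd p) (nat (\<lceil>t / \<delta>\<rceil> - 1)) (fst p) \<and>
       step_driver u \<delta> s p = (\<Sum>j'<nat (\<lceil>t / \<delta>\<rceil> - 1). u (p, j'))"
    using floor_grid_at_left[OF \<delta>, of t]
    by eventually_elim (simp add: scheme_path_def step_driver_def)
qed

lemma scheme_path_reflected:
  assumes \<delta>: "0 < \<delta>" and \<theta>: "0 \<le> \<theta>"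
  shows "reflected_system N \<theta> T (scheme_path u \<delta>) (step_driver u \<delta>)"
  unfolding reflected_system_def
proof (intro allI impI ballI)
  fix i k t assume p: "(i, k) \<in> gt_index N" and t: "t \<in> {0..T}"
  let ?y = "scheme_path u \<delta>" and ?d = "step_driver u \<delta>"
  have ik: "1 \<le> i" "i \<le> k" using p by (auto simp: gt_index_def)
  then obtain l where k: "k = Suc l" by (cases k) auto
  have right: "\<forall>\<^sub>F s in at_right t. ?y s = ?y t \<and> ?d s = ?d t"
    by (rule scheme_path_at_right[OF \<delta>])
  \<comment> \<open>The sign \<open>c\<close> is 1 for the lower and -1 for the upper barrier. All
    paths are constant off the grid, so only the single step that ends at \<open>t\<close> has to be
    examined.\<close>
  have step: "nonincreasing_at (\<lambda>s. c * (?y s (i, k) - ?d s (i, k))) t"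
    if c: "\<And>j. nat \<lfloor>t / \<delta>\<rfloor> = Suc j \<Longrightarrow> c * (clamp_scheme u k (Suc j) i - u ((i, k), j)) \<le> c * clamp_scheme u k j i"
    for c
    unfolding nonincreasing_at_def
  proof (intro conjI impI)
    show "\<forall>\<^sub>F s in at_right t. c * (?y s (i, k) - ?d s (i, k)) \<le> c * (?y t (i, k) - ?d t (i, k))"
      using right by eventually_elim simp
    assume "0 < t"
    obtain j where j: "nat \<lfloor>t / \<delta>\<rfloor> = j \<or> nat \<lfloor>t / \<delta>\<rfloor> = Suc j"
      and ev: "\<forall>\<^sub>F s in at_left t. \<forall>p. ?y s p = clamp_scheme u (snd p) j (fst p) \<and> ?d s p = (\<Sum>j'<j. u (p, j'))"
      by (rule scheme_path_at_left[OF \<delta> \<open>0 < t\<close>])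
    from ev show "\<forall>\<^sub>F s in at_left t. c * (?y t (i, k) - ?d t (i, k)) \<le> c * (?y s (i, k) - ?d s (i, k))"
    proof eventually_elim
      case (elim s)
      show ?case using j
      proof
        assume "nat \<lfloor>t / \<delta>\<rfloor> = j"
        then show ?thesis using elim by (simp add: scheme_path_def step_driver_def)
      next
        assume j: "nat \<lfloor>t / \<delta>\<rfloor> = Suc j"
        from c[OF this] elim j show ?thesis
          by (simp add: scheme_path_def step_driver_def right_diff_distrib distrib_left del: clamp_scheme.simps)
      qed
    qed
  qed
  have "nonincreasing_at (\<lambda>s. ?y s (i, k) - ?d s (i, k)) t"
    if "1 < i \<longrightarrow> ?y t (i - 1, k - 1) + \<theta> < ?y t (i, k)"
  proof -
    have "1 * (clamp_scheme u k (Suc j) i - u ((i, k), j)) \<le> 1 * clamp_scheme u k j i" if "nat \<lfloor>t / \<delta>\<rfloor> = Suc j" for j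
    proof -
      have "clamp_scheme u (Suc l) (Suc j) i \<le> clamp_scheme u (Suc l) j i + u ((i, Suc l), j)"
        by (rule clamp_scheme_step(1)) (use \<open>1 < i \<longrightarrow> _\<close> that \<theta> k in \<open>simp add: scheme_path_def\<close>)
      then show ?thesis by (simp add: k del: clamp_scheme.simps)
    qed
    from step[OF this] show ?thesis by simp
  qed
  moreover have "nonincreasing_at (\<lambda>s. ?d s (i, k) - ?y s (i, k)) t"
    if "i < k \<longrightarrow> ?y t (i, k) + \<theta> < ?y t (i, k - 1)"
  proof -
    have "- 1 * (clamp_scheme u k (Suc j) i - u ((i, k), j)) \<le> - 1 * clamp_scheme u k j i" if "nat \<lfloor>t / \<delta>\<rfloor> = Suc j" for j
    proof -
      have "clamp_scheme u (Suc l) j i + u ((i, Suc l), j) \<le> clamp_scheme u (Suc l) (Suc j) i"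
        by (rule clamp_scheme_step(2)) (use \<open>i < k \<longrightarrow> _\<close> that \<theta> k in \<open>simp add: scheme_path_def\<close>)
      then show ?thesis by (simp add: k del: clamp_scheme.simps)
    qed
    from step[OF this] show ?thesis by simp
  qed
  ultimately show "(1 < i \<longrightarrow> ?y t (i - 1, k - 1) \<le> ?y t (i, k)) \<and>
      (i < k \<longrightarrow> ?y t (i, k) \<le> ?y t (i, k - 1)) \<and>
      ((1 < i \<longrightarrow> ?y t (i - 1, k - 1) + \<theta> < ?y t (i, k)) \<longrightarrow>
        nonincreasing_at (\<lambda>s. ?y s (i, k) - ?d s (i, k)) t) \<and>
      ((i < k \<longrightarrow> ?y t (i, k) + \<theta> < ?y t (i, k - 1)) \<longrightarrow>
        nonincreasing_at (\<lambda>s. ?d s (i, k) - ?y s (i, k)) t)"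
    using clamp_scheme_interlacing[OF ik] by (simp add: scheme_path_def)
qed

section \<open>Reflected Brownian motions as a reflected system\<close>

lemma continuous_reflection_nonincreasing:
  assumes t: "0 \<le> t" and l: "increases_only_on l A" "t \<notin> A"
    and l': "mono_on {0..} l'"
  shows "nonincreasing_at (\<lambda>s. l s - l' s) t"
proof -
  \<comment> \<open>Off its contact set the regulator \<open>l\<close> is flat, so only the opposite
    regulator \<open>l'\<close>, which enters with a minus sign, can change the difference.\<close>
  have ev: "\<forall>\<^sub>F s in at t within {0..}. l s = l t"
    using assms by (simp add: increases_only_on_def)
  have "\<forall>\<^sub>F s in at_right t. l s - l' s \<le> l t - l' t"
  proof -
    have "\<forall>\<^sub>F s in at_right t. l s = l t"
      by (rule filter_leD[OF at_le ev]) (use t in auto)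
    moreover have "\<forall>\<^sub>F s in at_right t. t < s" by (simp add: eventually_at_right_less)
    ultimately show ?thesis by eventually_elim (use l' t in \<open>auto simp: mono_on_def\<close>)
  qed
  moreover have "\<forall>\<^sub>F s in at_left t. l t - l' t \<le> l s - l' s" if "0 < t"
  proof -
    have "\<forall>\<^sub>F s in at_left t. s \<in> {0<..<t}"
      using that by (auto simp: eventually_at_left_field intro!: exI[of _ 0])
    moreover obtain d where d: "0 < d" "\<And>s. 0 \<le> s \<Longrightarrow> s \<noteq> t \<Longrightarrow> dist s t < d \<Longrightarrow> l s = l t"
      using ev unfolding eventually_at by auto
    have "\<forall>\<^sub>F s in at_left t. l s = l t"
      unfolding eventually_at_left_field
      using that d by (intro exI[of _ "max 0 (t - d)"]) (auto simp: dist_real_def)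
    ultimately show ?thesis by eventually_elim (use l' t in \<open>auto simp: mono_on_def\<close>)
  qed
  ultimately show ?thesis by (simp add: nonincreasing_at_def)
qed

text \<open>An absent barrier becomes one with empty contact set, so particles at the edge follow
  the general rule.\<close>

lemma increases_only_on_zero: "\<forall>t\<ge>0. l t = 0 \<Longrightarrow> increases_only_on l {}"
  unfolding increases_only_on_def by (auto simp: eventually_at_topological)

lemma reflected_interlacing_system:
  assumes dec: "\<And>p t. p \<in> gt_index N \<Longrightarrow> 0 \<le> t \<Longrightarrow> w t p - b t p = lm p t - lp p t"
    and GTc: "\<And>t. 0 \<le> t \<Longrightarrow> w t \<in> GTc N"
    and mono: "\<And>p. p \<in> gt_index N \<Longrightarrow> mono_on {0..} (lm p) \<and> mono_on {0..} (lp p)"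
    and below: "\<And>i k. (i, k) \<in> gt_index N \<Longrightarrow> if i = 1 then \<forall>t\<ge>0. lm (i, k) t = 0
      else increases_only_on (lm (i, k)) {t. w t (i, k) = w t (i - 1, k - 1)}"
    and above: "\<And>i k. (i, k) \<in> gt_index N \<Longrightarrow> if i = k then \<forall>t\<ge>0. lp (i, k) t = 0
      else increases_only_on (lp (i, k)) {t. w t (i, k) = w t (i, k - 1)}"
    and \<theta>: "0 \<le> \<theta>"
  shows "reflected_system N \<theta> T w b"
  unfolding reflected_system_def
proof (intro allI impI ballI)
  fix i k t assume p: "(i, k) \<in> gt_index N" and t: "t \<in> {0..T}"
  then have t0: "0 \<le> t" by simp
  have ik: "1 \<le> i" "i \<le> k" "k \<le> N" using p by (auto simp: gt_index_def)
  \<comment> \<open>The decomposition is known for nonnegative times only; both one-sided filters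
    eventually stay there, because the left one is consulted only for positive
    \<open>t\<close>.\<close>
  have cong: "nonincreasing_at f t \<longleftrightarrow> nonincreasing_at g t" if "\<And>s. 0 \<le> s \<Longrightarrow> f s = g s" for f g
  proof -
    have "\<forall>\<^sub>F s in at_right t. 0 \<le> s"
      using eventually_at_right_less[of t] by eventually_elim (use t0 in auto)
    then have "(\<forall>\<^sub>F s in at_right t. f s \<le> f t) \<longleftrightarrow> (\<forall>\<^sub>F s in at_right t. g s \<le> g t)"
      by (intro eventually_subst) (auto elim: eventually_mono simp: that t0)
    moreover have "(\<forall>\<^sub>F s in at_left t. f t \<le> f s) \<longleftrightarrow> (\<forall>\<^sub>F s in at_left t. g t \<le> g s)" if "0 < t"
    proof -
      have "\<forall>\<^sub>F s in at_left t. 0 \<le> s"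
        using that by (auto simp: eventually_at_left_field intro!: exI[of _ 0])
      then show ?thesis by (intro eventually_subst) (auto elim!: eventually_mono simp: \<open>\<And>s. 0 \<le> s \<Longrightarrow> f s = g s\<close> t0)
    qed
    ultimately show ?thesis by (simp add: nonincreasing_at_def)
  qed
  have GT: "w t (i - 1, j) \<le> w t (i - 1, j - 1) \<and> w t (i - 1, j - 1) \<le> w t (i, j)"
    if "2 \<le> i" "i \<le> j" "j \<le> N" for i j
    using GTc[OF t0] that unfolding GTc_def by blast
  \<comment> \<open>The upper barrier of particle \<open>i\<close> is the condition of
    \<open>GTc\<close> at index \<open>i + 1\<close>.\<close>
  have G: "1 < i \<longrightarrow> w t (i - 1, k - 1) \<le> w t (i, k)" "i < k \<longrightarrow> w t (i, k) \<le> w t (i, k - 1)"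
    using GT[of i k] GT[of "i + 1" k] ik by auto
  have "nonincreasing_at (\<lambda>s. w s (i, k) - b s (i, k)) t"
    if "1 < i \<longrightarrow> w t (i - 1, k - 1) + \<theta> < w t (i, k)"
  proof -
    have "nonincreasing_at (\<lambda>s. lm (i, k) s - lp (i, k) s) t"
      using below[OF p] mono[OF p] that ik t0 \<theta>
      by (cases "i = 1")
        (rule continuous_reflection_nonincreasing[OF t0 increases_only_on_zero], simp_all,
         rule continuous_reflection_nonincreasing[OF t0], auto)
    then show ?thesis using dec[OF p] cong[of "\<lambda>s. w s (i, k) - b s (i, k)"] by simp
  qed
  moreover have "nonincreasing_at (\<lambda>s. b s (i, k) - w s (i, k)) t"
    if "i < k \<longrightarrow> w t (i, k) + \<theta> < w t (i, k - 1)"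
  proof -
    have "nonincreasing_at (\<lambda>s. lp (i, k) s - lm (i, k) s) t"
      using above[OF p] mono[OF p] that ik t0 \<theta>
      by (cases "i = k")
        (rule continuous_reflection_nonincreasing[OF t0 increases_only_on_zero], simp_all,
         rule continuous_reflection_nonincreasing[OF t0], auto)
    moreover have "b s (i, k) - w s (i, k) = lp (i, k) s - lm (i, k) s" if "0 \<le> s" for s
      using dec[OF p that] by linarith
    ultimately show ?thesis using cong[of "\<lambda>s. b s (i, k) - w s (i, k)"] by simp
  qed
  ultimately show "(1 < i \<longrightarrow> w t (i - 1, k - 1) \<le> w t (i, k)) \<and>
      (i < k \<longrightarrow> w t (i, k) \<le> w t (i, k - 1)) \<and>
      ((1 < i \<longrightarrow> w t (i - 1, k - 1) + \<theta> < w t (i, k)) \<longrightarrow>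
        nonincreasing_at (\<lambda>s. w s (i, k) - b s (i, k)) t) \<and>
      ((i < k \<longrightarrow> w t (i, k) + \<theta> < w t (i, k - 1)) \<longrightarrow>
        nonincreasing_at (\<lambda>s. b s (i, k) - w s (i, k)) t)"
    using G by blast
qed

section \<open>Multilevel TASEP as a reflected system\<close>

definition arrivals :: "(nat \<Rightarrow> real) \<Rightarrow> real \<Rightarrow> nat" where
  "arrivals S t = card {m. S m \<le> t}"

lemma arrivals_eqI:
  assumes "strict_mono S" and "\<And>m. m < k \<Longrightarrow> S m \<le> t" and "t < S k"
  shows "arrivals S t = k"
proof -
  have "m < k" if "S m \<le> t" for m
  proof (rule ccontr)
    assume "\<not> m < k"
    then have "S k \<le> S m" using assms(1) by (simp add: strict_mono_less_eq)
    then show False using that assms(3) by simp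
  qed
  then have "{m. S m \<le> t} = {..<k}" using assms(2) by auto
  then show ?thesis by (simp add: arrivals_def)
qed

text \<open>The existence of a later ring keeps the counted set finite; for an infinite set
  \<open>card\<close> would return 0.\<close>

lemma arrivals_props:
  assumes "strict_mono S" "\<exists>m. t < S m"
  shows "t < S (arrivals S t)" "m < arrivals S t \<Longrightarrow> S m \<le> t"
proof -
  define k where "k = (LEAST m. t < S m)"
  have k: "t < S k" unfolding k_def using assms(2) by (rule LeastI_ex)
  have below: "S m \<le> t" if "m < k" for m using not_less_Least[of m "\<lambda>m. t < S m"] that by (simp add: k_def not_less)
  have "arrivals S t = k" using assms(1) below k by (rule arrivals_eqI)
  then show "t < S (arrivals S t)" "m < arrivals S t \<Longrightarrow> S m \<le> t" using k below by auto
qed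

lemma arrivals_at_right:
  assumes "strict_mono S" "\<exists>m. t < S m"
  shows "\<forall>\<^sub>F s in at_right t. arrivals S s = arrivals S t"
proof -
  have "\<forall>\<^sub>F s in at_right t. t < s \<and> s < S (arrivals S t)"
    unfolding eventually_at_right_field using arrivals_props(1)[OF assms] by blast
  then show ?thesis
    by eventually_elim
      (use arrivals_props(2)[OF assms] in \<open>force intro!: arrivals_eqI assms(1)\<close>)
qed

lemma arrivals_at_left:
  assumes "strict_mono S" "\<exists>m. t < S m"
  shows "\<forall>\<^sub>F s in at_left t. arrivals S t = arrivals S s + (if t \<in> range S then 1 else 0)"
proof -
  \<comment> \<open>\<open>k\<close> counts the rings strictly before \<open>t\<close>, which is the
    value of the counting function just to the left of \<open>t\<close>.\<close>
  obtain k where k: "\<And>m. m < k \<Longrightarrow> S m < t" "t \<le> S k"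
    "arrivals S t = k + (if t \<in> range S then 1 else 0)"
  proof (cases "t \<in> range S")
    case True
    then obtain m where m: "t = S m" by auto
    have "arrivals S t = Suc m"
      using assms(1) unfolding m by (intro arrivals_eqI) (auto simp: strict_mono_less_eq strict_mono_less)
    then show ?thesis using that[of m] True m assms(1) by (auto simp: strict_mono_less)
  next
    case False
    then have "S m < t" if "m < arrivals S t" for m
      using arrivals_props(2)[OF assms that] by (auto simp: less_le)
    then show ?thesis using that[of "arrivals S t"] arrivals_props(1)[OF assms] False by auto
  qed
  have "\<forall>\<^sub>F s in at_left t. S m < s" if "S m < t" for m
    unfolding eventually_at_left_field using that by blast
  then have "\<forall>\<^sub>F s in at_left t. \<forall>m\<in>{..<k}. S m < s"
    using k(1) by (intro eventually_ball_finite) auto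
  moreover have "\<forall>\<^sub>F s in at_left t. s < t"
    by (simp add: eventually_at_filter)
  ultimately show ?thesis
  proof eventually_elim
    case (elim s)
    then have "arrivals S s = k" using k assms(1) by (intro arrivals_eqI) (auto intro: less_imp_le)
    then show ?case using k(3) by simp
  qed
qed

section \<open>Jumps of TASEP as pushes and blockings\<close>

lemma tasep_jump_bounds: "z p \<le> tasep_jump N q z p" "tasep_jump N q z p \<le> z p + 1"
  by (auto simp: tasep_jump_def split: prod.splits)

text \<open>A run at one location moves as a whole, so a particle displaced by a foreign clock ends
  level with its predecessor on the diagonal. Pushing therefore occurs only in contact with the
  lower barrier.\<close>

lemma tasep_jump_pushed:
  assumes q: "q \<in> gt_index N" and moved: "tasep_jump N q z (i, k) \<noteq> z (i, k)" and neq: "(i, k) \<noteq> q"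
  shows "1 < i" "tasep_jump N q z (i - 1, k - 1) = tasep_jump N q z (i, k)"
proof -
  obtain a b where q_eq: "q = (a, b)" by (cases q)
  have unblocked: "\<not> (a < b \<and> z (a, b - 1) = z (a, b) + 1)"
    using moved by (auto simp: tasep_jump_def q_eq)
  have J: "tasep_jump N q z r = (if \<exists>m. r = (a + m, b + m) \<and> b + m \<le> N \<and>
      (\<forall>l\<le>m. z (a + l, b + l) = z (a, b)) then z r + 1 else z r)" for r
    unfolding tasep_jump_def q_eq prod.case if_not_P[OF unblocked] ..
  then obtain m where m: "(i, k) = (a + m, b + m)" "b + m \<le> N" "\<forall>l\<le>m. z (a + l, b + l) = z (a, b)"
    using moved J[of "(i, k)"] by (auto split: if_splits)
  have "m \<noteq> 0" using m(1) neq q_eq by auto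
  then obtain m' where m': "m = Suc m'" by (cases m) auto
  have "1 \<le> a" using q q_eq by (simp add: gt_index_def)
  then show "1 < i" using m(1) m' by auto
  have z1: "z (i - 1, k - 1) = z (a, b)" using m(1,3) m' by auto
  have "tasep_jump N q z (i - 1, k - 1) = z (i - 1, k - 1) + 1"
    using m m' by (subst J) (auto intro!: exI[of _ m'])
  moreover have "tasep_jump N q z (i, k) = z (i, k) + 1" using J[of "(i, k)"] m by auto
  ultimately show "tasep_jump N q z (i - 1, k - 1) = tasep_jump N q z (i, k)"
    using z1 m by auto
qed

lemma int_path_at_right:
  fixes f :: "real \<Rightarrow> int"
  assumes "((\<lambda>s. real_of_int (f s)) \<longlongrightarrow> real_of_int (f t)) F"
  shows "\<forall>\<^sub>F s in F. f s = f t"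
proof -
  have "\<forall>\<^sub>F s in F. dist (real_of_int (f s)) (real_of_int (f t)) < 1"
    using tendstoD[OF assms] by simp
  then show ?thesis by eventually_elim (auto simp: dist_real_def)
qed

lemma nonincreasing_at_divide:
  fixes c :: real
  assumes "0 < c" "nonincreasing_at f t"
  shows "nonincreasing_at (\<lambda>s. f s / c) t"
  using assms by (simp add: nonincreasing_at_def divide_le_cancel)

text \<open>Simultaneous rings are harmless here: each clock that rings at \<open>t\<close> only constrains how far
  its own particle has moved.\<close>

lemma tasep_reflected:
  fixes Y :: "real \<Rightarrow> nat \<times> nat \<Rightarrow> int" and S :: "nat \<times> nat \<Rightarrow> nat \<Rightarrow> real"
  assumes S: "\<And>p. p \<in> gt_index N \<Longrightarrow> strict_mono (S p) \<and> (\<exists>m. T < S p m)"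
    and GT: "\<And>t. 0 \<le> t \<Longrightarrow> Y t \<in> GT N"
    and cont: "\<And>p t. p \<in> gt_index N \<Longrightarrow> 0 \<le> t \<Longrightarrow>
       ((\<lambda>s. real_of_int (Y s p)) \<longlongrightarrow> real_of_int (Y t p)) (at_right t)"
    and dyn: "\<And>t. 0 < t \<Longrightarrow> \<exists>z. (\<forall>\<^sub>F s in at_left t. Y s = z) \<and>
         ((\<forall>p\<in>gt_index N. t \<notin> range (S p)) \<longrightarrow> Y t = z) \<and>
         (\<forall>p\<in>gt_index N. t \<in> range (S p) \<longrightarrow> Y t = tasep_jump N p z)"
    and c: "0 < c"
  shows "reflected_system N (1 / c) T (\<lambda>t p. (real_of_int (Y t p) - t) / c)
     (\<lambda>t p. (real (arrivals (S p) t) - t) / c)"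
  unfolding reflected_system_def
proof (intro allI impI ballI)
  fix i k t assume p: "(i, k) \<in> gt_index N" and t: "t \<in> {0..T}"
  let ?p = "(i, k)"
  let ?N = "\<lambda>s. arrivals (S ?p) s"
  let ?y = "\<lambda>t p. (real_of_int (Y t p) - t) / c" and ?b = "\<lambda>t p. (real (arrivals (S p) t) - t) / c"
  have t0: "0 \<le> t" using t by simp
  have ik: "1 \<le> i" "i \<le> k" "k \<le> N" using p by (auto simp: gt_index_def)
  have mono: "strict_mono (S ?p)" and ex: "\<exists>m. t < S ?p m"
    using S[OF p] t by (auto intro: le_less_trans)
  have GT': "Y t (i - 1, j) < Y t (i - 1, j - 1) \<and> Y t (i - 1, j - 1) \<le> Y t (i, j)"
    if "2 \<le> i" "i \<le> j" "j \<le> N" for i j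
    using GT[OF t0] that unfolding GT_def by blast
  have G: "1 < i \<longrightarrow> Y t (i - 1, k - 1) \<le> Y t ?p" "i < k \<longrightarrow> Y t ?p \<le> Y t (i, k - 1)"
    using GT'[of i k] GT'[of "i + 1" k] ik by auto
  have right: "\<forall>\<^sub>F s in at_right t. Y s ?p = Y t ?p \<and> ?N s = ?N t"
    using int_path_at_right[OF cont[OF p t0]] arrivals_at_right[OF mono ex]
    by eventually_elim simp
  let ?left = "\<lambda>z. \<forall>\<^sub>F s in at_left t. Y s = z \<and> ?N t = ?N s + (if t \<in> range (S ?p) then 1 else 0)"
  let ?idle = "\<lambda>z. (\<forall>p\<in>gt_index N. t \<notin> range (S p)) \<longrightarrow> Y t = z"
  let ?jump = "\<lambda>z. \<forall>p\<in>gt_index N. t \<in> range (S p) \<longrightarrow> Y t = tasep_jump N p z"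
  have left: "\<exists>z. ?left z \<and> ?idle z \<and> ?jump z" if pos: "0 < t"
  proof -
    obtain z where z: "\<forall>\<^sub>F s in at_left t. Y s = z"
         "?idle z" "?jump z"
      using dyn[OF pos] by blast
    show ?thesis using z eventually_conj[OF z(1) arrivals_at_left[OF mono ex]] by blast
  qed
  have "nonincreasing_at (\<lambda>s. ?y s ?p - ?b s ?p) t"
    if low: "1 < i \<longrightarrow> ?y t (i - 1, k - 1) + 1 / c < ?y t ?p"
  proof -
    have low': "1 < i \<longrightarrow> Y t (i - 1, k - 1) < Y t ?p"
      using low c by (auto simp: add_divide_distrib[symmetric] divide_less_cancel)
    have "nonincreasing_at (\<lambda>s. real_of_int (Y s ?p) - real (?N s)) t"
      unfolding nonincreasing_at_def
    proof (intro conjI impI)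
      assume "0 < t"
      from left[OF this] obtain z where z: "?left z" "?idle z" "?jump z" by blast
      \<comment> \<open>An own ring is matched by the count. On a foreign ring a move would be a
        push and hence contact with the lower barrier, which \<open>low'\<close> excludes.\<close>
      have "Y t ?p \<le> z ?p + (if t \<in> range (S ?p) then 1 else 0)"
      proof (cases "t \<in> range (S ?p)")
        case True
        then show ?thesis using z(3) p tasep_jump_bounds(2)[of N ?p z ?p] by simp
      next
        case False
        show ?thesis
        proof (cases "\<exists>q\<in>gt_index N. t \<in> range (S q)")
          case True
          then obtain q where q: "q \<in> gt_index N" "t \<in> range (S q)" by blast
          then have Yt: "Y t = tasep_jump N q z" "?p \<noteq> q" using z(3) False by auto
          have "tasep_jump N q z ?p = z ?p"
            using tasep_jump_pushed[OF q(1) _ Yt(2)] low' Yt(1) by fastforce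
          then show ?thesis using Yt False by simp
        qed (use z(2) False in auto)
      qed
      then show "\<forall>\<^sub>F s in at_left t. real_of_int (Y t ?p) - real (?N t) \<le> real_of_int (Y s ?p) - real (?N s)"
        by (intro eventually_mono[OF z(1)]) auto
    qed (use right in \<open>auto elim: eventually_mono\<close>)
    from nonincreasing_at_divide[OF c this] show ?thesis by (simp add: diff_divide_distrib)
  qed
  moreover have "nonincreasing_at (\<lambda>s. ?b s ?p - ?y s ?p) t"
    if up: "i < k \<longrightarrow> ?y t ?p + 1 / c < ?y t (i, k - 1)"
  proof -
    \<comment> \<open>Interlacing is strict at the upper barrier, so a blocked particle rests one
      lattice site below it. The slack \<open>1 / c\<close> is this site: with a larger gap the ring
      cannot have been suppressed.\<close>
    have up': "i < k \<longrightarrow> Y t ?p + 1 < Y t (i, k - 1)"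
      using up c by (auto simp: add_divide_distrib[symmetric] divide_less_cancel)
    have "nonincreasing_at (\<lambda>s. real (?N s) - real_of_int (Y s ?p)) t"
      unfolding nonincreasing_at_def
    proof (intro conjI impI)
      assume "0 < t"
      from left[OF this] obtain z where z: "?left z" "?idle z" "?jump z" by blast
      have "z ?p + (if t \<in> range (S ?p) then 1 else 0) \<le> Y t ?p"
      proof (cases "t \<in> range (S ?p)")
        case True
        then have Yt: "Y t = tasep_jump N ?p z" using z(3) p by blast
        have unblocked: "\<not> (i < k \<and> z (i, k - 1) = z ?p + 1)"
          using up' Yt by (auto simp: tasep_jump_def)
        have "tasep_jump N ?p z ?p = z ?p + 1"
          using unblocked ik by (auto simp: tasep_jump_def)
        then show ?thesis using True Yt by simp
      next
        case False
        show ?thesis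
        proof (cases "\<exists>q\<in>gt_index N. t \<in> range (S q)")
          case True
          then obtain q where "Y t = tasep_jump N q z" using z(3) by blast
          then show ?thesis using tasep_jump_bounds(1)[of z ?p N q] False by simp
        qed (use z(2) False in auto)
      qed
      then show "\<forall>\<^sub>F s in at_left t. real (?N t) - real_of_int (Y t ?p) \<le> real (?N s) - real_of_int (Y s ?p)"
        by (intro eventually_mono[OF z(1)]) auto
    qed (use right in \<open>auto elim: eventually_mono\<close>)
    from nonincreasing_at_divide[OF c this] show ?thesis by (simp add: diff_divide_distrib)
  qed
  ultimately show "(1 < i \<longrightarrow> ?y t (i - 1, k - 1) \<le> ?y t ?p) \<and>
      (i < k \<longrightarrow> ?y t ?p \<le> ?y t (i, k - 1)) \<and>
      ((1 < i \<longrightarrow> ?y t (i - 1, k - 1) + 1 / c < ?y t ?p) \<longrightarrow>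
        nonincreasing_at (\<lambda>s. ?y s ?p - ?b s ?p) t) \<and>
      ((i < k \<longrightarrow> ?y t ?p + 1 / c < ?y t (i, k - 1)) \<longrightarrow>
        nonincreasing_at (\<lambda>s. ?b s ?p - ?y s ?p) t)"
    using G c by (simp add: divide_right_mono)
qed


text \<open>The block ends \<open>n * j div k\<close> are not equally spaced; adding the remainders
  carries at most one, so each block has length \<open>n div k\<close> or one more.\<close>

lemma mult_div_block:
  fixes n k j :: nat
  assumes "0 < k"
  shows "n * j div k + n div k \<le> n * Suc j div k" "n * Suc j div k \<le> n * j div k + n div k + 1"
proof -
  have eq: "n * Suc j div k = n * j div k + n div k + (n * j mod k + n mod k) div k"
    using div_add1_eq[of "n * j" n k] by (simp add: algebra_simps)
  have "n * j mod k + n mod k < 2 * k"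
    using mod_less_divisor[OF assms, of "n * j"] mod_less_divisor[OF assms, of n] by linarith
  then have "(n * j mod k + n mod k) div k < 2" by (rule less_mult_imp_div_less)
  then show "n * j div k + n div k \<le> n * Suc j div k" "n * Suc j div k \<le> n * j div k + n div k + 1"
    using eq by linarith+
qed

text \<open>The count of arrivals \<open>\<nu>\<close> up to time \<open>t\<close> satisfies \<open>\<nu> + R \<nu> \<le> t < \<nu> + 1 + R (\<nu> + 1)\<close> with the
  centred walk \<open>R\<close>, so \<open>\<nu> - t\<close> is \<open>- R\<close> up to the oscillation of \<open>R\<close> between \<open>\<nu>\<close> and \<open>t\<close>.\<close>

lemma arrivals_close:
  fixes x :: "nat \<Rightarrow> real" and n m k :: nat
  defines "S \<equiv> \<lambda>m. \<Sum>i\<le>m. x i" and "R \<equiv> \<lambda>m. \<Sum>i<m. x i - 1"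
  assumes x: "\<And>i. 0 < x i" and k: "0 < k" and n: "0 < n"
    and osc: "\<And>j i. j < m * k + 2 \<Longrightarrow> i \<le> n div k + 1 \<Longrightarrow> \<bar>R (n * j div k + i) - R (n * j div k)\<bar> \<le> a"
    and a: "real (m * k + 2) * a + 1 < real (n div k)"
    and t: "0 \<le> t" "t \<le> real n * real m"
  shows "strict_mono S" "\<exists>i. t < S i"
    "\<bar>real (arrivals S t) - t + R (n * nat \<lfloor>t / (real n / real k)\<rfloor> div k)\<bar> \<le> 2 * a + 1"
proof -
  show S: "strict_mono S"
    using x by (intro strict_mono_Suc_iff[THEN iffD2]) (simp add: S_def)
  define J where "J = m * k + 2"
  define g where "g j = n * j div k" for j
  \<comment> \<open>The shift by one arises because \<open>S i\<close> includes the waiting time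
    with index \<open>i\<close>, while \<open>R\<close> sums strictly below its argument.\<close>
  have SR: "S i = real (Suc i) + R (Suc i)" for i
    by (simp add: S_def R_def sum_subtractf lessThan_Suc_atMost)
  have g_lo: "g j + n div k \<le> g (Suc j)" and g_up: "g (Suc j) \<le> g j + n div k + 1" for j
    using mult_div_block[OF k] by (auto simp: g_def)
  have R0: "R (g 0) = 0" by (simp add: g_def R_def)
  have a0: "0 \<le> a" using osc[of 0 0] by simp
  have osc': "\<bar>R i - R (g j)\<bar> \<le> a" if "j < J" "g j \<le> i" "i \<le> g (Suc j)" for i j
    using osc[of j "i - g j"] that g_up[of j] by (auto simp: g_def J_def)
  have Rg: "\<bar>R (g j)\<bar> \<le> real j * a" if "j \<le> J" for j
    using that
  proof (induction j)
    case (Suc j)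
    have "\<bar>R (g (Suc j)) - R (g j)\<bar> \<le> a" using Suc.prems g_lo[of j] by (intro osc') auto
    then show ?case using Suc by (auto simp: algebra_simps)
  qed (simp add: R0)
  have Rg': "\<bar>R (g j)\<bar> \<le> real J * a" if "j \<le> J" for j
    using Rg[OF that] mult_right_mono[of "real j" "real J" a] that a0 by simp
  define j where "j = nat \<lfloor>t / (real n / real k)\<rfloor>"
  have tk: "t / (real n / real k) = t * real k / real n" using k by simp
  have "real j \<le> t * real k / real n" using t n unfolding j_def tk by (simp add: of_nat_floor)
  then have jt: "real n * real j / real k \<le> t" using n k by (simp add: field_simps)
  have "t * real k / real n < real j + 1" unfolding j_def tk by linarith
  then have tj: "t < real n * real (Suc j) / real k" using n k by (simp add: field_simps)
  have "real j \<le> real (m * k)"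
  proof -
    have "t * real k / real n \<le> real (m * k)" using n mult_right_mono[OF t(2), of "real k"] by (simp add: field_simps)
    then show ?thesis using \<open>real j \<le> t * real k / real n\<close> by linarith
  qed
  then have jJ: "j + 2 \<le> J" unfolding J_def of_nat_le_iff by simp
  have g_t: "real (g j) \<le> t"
    using jt of_nat_div_le_of_nat[of "n * j" k, where ?'a = real] unfolding g_def by simp
  have "real (n * Suc j) / real k < real (g (Suc j)) + 1"
  proof -
    have "n * Suc j < (g (Suc j) + 1) * k" unfolding g_def using k dividend_less_div_times[of k "n * Suc j"] by simp
    then have "real (n * Suc j) < (real (g (Suc j)) + 1) * real k"
      by (metis of_nat_1 of_nat_add of_nat_less_iff of_nat_mult)
    then show ?thesis using k by (simp add: pos_divide_less_eq)
  qed
  then have t_g: "t < real (g (Suc j)) + 1" using tj by (simp add: algebra_simps)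
  \<comment> \<open>By assumption the walk moves by less than one block length over the whole
    window. So the count at \<open>t\<close> stays in the current block or an adjacent one, between
    \<open>g (j - 1)\<close> and \<open>G\<close>; for \<open>j = 0\<close> truncated subtraction
    gives the correct lower end 0.\<close>
  define G where "G = g (Suc (Suc j))"
  have nk: "real (n div k) > 1" using a a0 by (smt (verit) of_nat_0_le_iff mult_nonneg_nonneg)
  have G1: "0 < G" using g_lo[of "Suc j"] nk unfolding G_def by linarith
  have upper: "t < S (G - 1)"
  proof -
    have "real (g (Suc j)) + real (n div k) \<le> real G"
      using g_lo[of "Suc j"] unfolding G_def of_nat_add[symmetric] of_nat_le_iff .
    moreover have "\<bar>R G\<bar> \<le> real J * a" using jJ unfolding G_def by (intro Rg') simp
    ultimately show ?thesis using t_g a G1 SR[of "G - 1"] by (simp add: J_def)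
  qed
  then show ex: "\<exists>i. t < S i" by blast
  define \<nu> where "\<nu> = arrivals S t"
  note nu = arrivals_props[OF S ex, folded \<nu>_def]
  have "\<nu> < G"
  proof (rule ccontr)
    assume "\<not> \<nu> < G"
    then have "S (G - 1) \<le> t" using nu(2)[of "G - 1"] G1 by simp
    then show False using upper by simp
  qed
  have low: "g (j - 1) \<le> \<nu>"
  proof (rule ccontr)
    assume less: "\<not> g (j - 1) \<le> \<nu>"
    then obtain j' where j': "j = Suc j'" by (cases j) (auto simp: g_def)
    have "S \<nu> \<le> S (g j' - 1)" using S less j' by (simp add: strict_mono_less_eq)
    also have "\<dots> = real (g j') + R (g j')" using less j' SR[of "g j' - 1"] by simp
    also have "\<dots> \<le> real (g j') + real J * a" using Rg'[of j'] jJ j' by auto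
    also have "\<dots> \<le> real (g j') + real (n div k)" using a by (simp add: J_def)
    also have "\<dots> \<le> real (g j)" using g_lo[of j'] unfolding j' of_nat_add[symmetric] of_nat_le_iff .
    also have "\<dots> \<le> t" by (rule g_t)
    finally show False using nu(1) by simp
  qed
  \<comment> \<open>In an adjacent block the comparison passes through a common block end, at the
    price of two oscillations.\<close>
  have near: "\<bar>R i - R (g j)\<bar> \<le> 2 * a" if i: "g (j - 1) \<le> i" "i \<le> G" for i
  proof -
    consider "i < g j" | "g j \<le> i" "i \<le> g (Suc j)" | "g (Suc j) < i" by linarith
    then show ?thesis
    proof cases
      case 1
      then obtain j' where j': "j = Suc j'" using i by (cases j) auto
      have "\<bar>R i - R (g j')\<bar> \<le> a" using 1 i jJ j' by (intro osc') auto
      moreover have "\<bar>R (g j) - R (g j')\<bar> \<le> a" using 1 i jJ j' by (intro osc') auto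
      ultimately show ?thesis by linarith
    next
      case 2
      then show ?thesis using osc'[of j i] jJ a0 by auto
    next
      case 3
      have "\<bar>R i - R (g (Suc j))\<bar> \<le> a" using 3 i jJ by (intro osc') (auto simp: G_def)
      moreover have "\<bar>R (g (Suc j)) - R (g j)\<bar> \<le> a" using g_lo[of j] jJ by (intro osc') auto
      ultimately show ?thesis by linarith
    qed
  qed
  have "\<bar>R \<nu> - R (g j)\<bar> \<le> 2 * a" "\<bar>R (Suc \<nu>) - R (g j)\<bar> \<le> 2 * a"
    using low \<open>\<nu> < G\<close> by (auto intro!: near)
  moreover have "t < real \<nu> + 1 + R (Suc \<nu>)" using nu(1) SR[of \<nu>] by simp
  moreover have "real \<nu> + R \<nu> \<le> t"
  proof (cases \<nu>)
    case 0
    then show ?thesis using t by (simp add: R_def)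
  next
    case (Suc \<nu>')
    then show ?thesis using nu(2)[of \<nu>'] SR[of \<nu>'] by simp
  qed
  ultimately have "\<bar>real \<nu> - t + R (g j)\<bar> \<le> 2 * a + 1" by linarith
  then show "\<bar>real (arrivals S t) - t + R (n * nat \<lfloor>t / (real n / real k)\<rfloor> div k)\<bar> \<le> 2 * a + 1"
    by (simp add: \<nu>_def g_def j_def)
qed

section \<open>A fourth moment maximal inequality\<close>

context prob_space
begin

text \<open>All moment recursions below rest on this factorisation: \<open>F\<close> expresses that
  \<open>Z\<close> is determined by the steps before \<open>l\<close>.\<close>

lemma indep_past_times:
  fixes X :: "nat \<Rightarrow> 'a \<Rightarrow> real"
  assumes indep: "indep_vars (\<lambda>_. borel) X UNIV"
    and F: "F \<in> borel_measurable (Pi\<^sub>M {..<l} (\<lambda>_. borel))"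
    and Z: "\<And>\<omega>. \<omega> \<in> space M \<Longrightarrow> Z \<omega> = F (\<lambda>i\<in>{..<l}. X i \<omega>)"
    and int: "integrable M Z" "integrable M (\<lambda>\<omega>. X l \<omega> ^ q)"
  shows "integrable M (\<lambda>\<omega>. Z \<omega> * X l \<omega> ^ q)"
    and "expectation (\<lambda>\<omega>. Z \<omega> * X l \<omega> ^ q) = expectation Z * expectation (\<lambda>\<omega>. X l \<omega> ^ q)"
proof -
  have ind: "indep_var borel (F \<circ> (\<lambda>\<omega>. restrict (\<lambda>i. X i \<omega>) {..<l}))
      borel ((\<lambda>x. x l ^ q) \<circ> (\<lambda>\<omega>. restrict (\<lambda>i. X i \<omega>) {l}))"
    by (rule indep_var_compose[OF indep_var_restrict[OF indep] F]) auto
  have int': "integrable M (F \<circ> (\<lambda>\<omega>. restrict (\<lambda>i. X i \<omega>) {..<l}))"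
    "integrable M ((\<lambda>x. x l ^ q) \<circ> (\<lambda>\<omega>. restrict (\<lambda>i. X i \<omega>) {l}))"
    using int Z by (simp_all add: comp_def cong: Bochner_Integration.integrable_cong)
  show "integrable M (\<lambda>\<omega>. Z \<omega> * X l \<omega> ^ q)"
    using indep_var_integrable[OF ind int'] Z by (simp add: comp_def cong: Bochner_Integration.integrable_cong)
  show "expectation (\<lambda>\<omega>. Z \<omega> * X l \<omega> ^ q) = expectation Z * expectation (\<lambda>\<omega>. X l \<omega> ^ q)"
    using indep_var_lebesgue_integral[OF ind int'] Z by (simp add: comp_def cong: Bochner_Integration.integral_cong)
qed

end

locale centred_walk = prob_space +
  fixes X :: "nat \<Rightarrow> 'a \<Rightarrow> real" and C :: real
  assumes indep: "indep_vars (\<lambda>_. borel) X UNIV"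
    and int: "\<And>i q. integrable M (\<lambda>\<omega>. X i \<omega> ^ q)"
    and mean: "\<And>i. expectation (X i) = 0"
    and second: "\<And>i. expectation (\<lambda>\<omega>. X i \<omega> ^ 2) = 1"
    and fourth: "\<And>i. expectation (\<lambda>\<omega>. X i \<omega> ^ 4) \<le> C"
begin

definition walk :: "nat \<Rightarrow> 'a \<Rightarrow> real" where "walk l \<omega> = (\<Sum>i<l. X i \<omega>)"

lemma X_measurable [measurable]: "X i \<in> borel_measurable M"
  using indep by (auto simp: indep_vars_def)

lemma walk_measurable [measurable]: "walk l \<in> borel_measurable M"
  unfolding walk_def by measurable

lemma walk_Suc: "walk (Suc l) \<omega> = walk l \<omega> + X l \<omega>"
  by (simp add: walk_def)

lemma walk_past_times:
  assumes F: "F \<in> borel_measurable (Pi\<^sub>M {..<l} (\<lambda>_. borel))"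
    and Z: "\<And>\<omega>. \<omega> \<in> space M \<Longrightarrow> Z \<omega> = F (\<lambda>i\<in>{..<l}. X i \<omega>)"
    and Zint: "integrable M Z"
  shows "integrable M (\<lambda>\<omega>. Z \<omega> * X l \<omega> ^ q)"
    and "expectation (\<lambda>\<omega>. Z \<omega> * X l \<omega> ^ q) = expectation Z * expectation (\<lambda>\<omega>. X l \<omega> ^ q)"
  by (rule indep_past_times[OF indep F Z Zint int]; assumption)+

lemma walk_integrable: "integrable M (\<lambda>\<omega>. walk l \<omega> ^ q)"
proof (induction l arbitrary: q)
  case 0
  then show ?case by (simp add: walk_def)
next
  case (Suc l)
  have "integrable M (\<lambda>\<omega>. walk l \<omega> ^ k * X l \<omega> ^ (q - k))" for k
    by (rule walk_past_times(1)[where F = "\<lambda>x. (\<Sum>i<l. x i) ^ k", OF _ _ Suc.IH]) (auto simp: walk_def)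
  then show ?case
    unfolding walk_Suc binomial_ring by (auto simp: mult.assoc)
qed

lemma walk_power_times:
  "integrable M (\<lambda>\<omega>. walk l \<omega> ^ k * X l \<omega> ^ q)"
  "expectation (\<lambda>\<omega>. walk l \<omega> ^ k * X l \<omega> ^ q) =
     expectation (\<lambda>\<omega>. walk l \<omega> ^ k) * expectation (\<lambda>\<omega>. X l \<omega> ^ q)"
  by (rule walk_past_times[where F = "\<lambda>x. (\<Sum>i<l. x i) ^ k", OF _ _ walk_integrable]; simp add: walk_def)+

lemma walk_mean: "expectation (walk l) = 0"
proof -
  have "expectation (\<lambda>\<omega>. \<Sum>i<l. X i \<omega>) = 0"
    using int[of _ 1] by (subst Bochner_Integration.integral_sum) (auto simp: mean)
  then show ?thesis by (simp add: walk_def[abs_def])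
qed

lemma walk_second: "expectation (\<lambda>\<omega>. walk l \<omega> ^ 2) = real l"
proof (induction l)
  case 0
  then show ?case by (simp add: walk_def)
next
  case (Suc l)
  have "walk (Suc l) \<omega> ^ 2 = walk l \<omega> ^ 2 + 2 * (walk l \<omega> ^ 1 * X l \<omega> ^ 1) + X l \<omega> ^ 2" for \<omega>
    by (simp add: walk_Suc power2_eq_square algebra_simps)
  then show ?case
    using walk_power_times[of l 1 1] walk_integrable[of l 2] int[of l 2]
    by (simp add: Suc.IH second walk_mean)
qed

lemma walk_fourth: "expectation (\<lambda>\<omega>. walk l \<omega> ^ 4) \<le> (C + 3) * real l ^ 2"
proof -
  have C: "0 \<le> C"
    by (rule order_trans[OF Bochner_Integration.integral_nonneg fourth[of 0]]) simp
  \<comment> \<open>In the expansion of \<open>(walk + X) ^ 4\<close> the terms containing a first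
    power have mean zero. Each step thus adds \<open>6 * l\<close> plus at most \<open>C\<close>,
    and the terms \<open>6 * l\<close> sum to \<open>3 * l * (l - 1)\<close>.\<close>
  have "expectation (\<lambda>\<omega>. walk l \<omega> ^ 4) \<le> C * real l + 3 * real l * (real l - 1)"
  proof (induction l)
    case 0
    then show ?case by (simp add: walk_def)
  next
    case (Suc l)
    have eq: "walk (Suc l) \<omega> ^ 4 = walk l \<omega> ^ 4 + 4 * (walk l \<omega> ^ 3 * X l \<omega> ^ 1)
        + 6 * (walk l \<omega> ^ 2 * X l \<omega> ^ 2) + 4 * (walk l \<omega> ^ 1 * X l \<omega> ^ 3) + X l \<omega> ^ 4" for \<omega>
      by (simp add: walk_Suc power4_eq_xxxx power3_eq_cube power2_eq_square algebra_simps)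
    have "expectation (\<lambda>\<omega>. walk (Suc l) \<omega> ^ 4) =
        expectation (\<lambda>\<omega>. walk l \<omega> ^ 4) + 6 * real l + expectation (\<lambda>\<omega>. X l \<omega> ^ 4)"
      unfolding eq
      using walk_power_times[of l 3 1] walk_power_times[of l 2 2] walk_power_times[of l 1 3]
        walk_integrable[of l 4] int[of l 4]
      by (simp add: mean walk_second second walk_mean)
    also have "\<dots> \<le> C * real (Suc l) + 3 * real (Suc l) * (real (Suc l) - 1)"
      using Suc.IH fourth[of l] by (simp add: algebra_simps)
    finally show ?case .
  qed
  also have "\<dots> \<le> (C + 3) * real l ^ 2"
  proof -
    have "real l \<le> real l ^ 2" by (cases l) (auto simp: power2_eq_square)
    then have "C * real l \<le> C * real l ^ 2" using C by (intro mult_left_mono)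
    then show ?thesis by (simp add: algebra_simps power2_eq_square)
  qed
  finally show ?thesis .
qed

definition first_exit :: "real \<Rightarrow> nat \<Rightarrow> 'a \<Rightarrow> real" where
  "first_exit a m \<omega> = (if a \<le> \<bar>walk m \<omega>\<bar> \<and> (\<forall>l<m. \<bar>walk l \<omega>\<bar> < a) then 1 else 0)"

lemma first_exit_measurable [measurable]: "first_exit a m \<in> borel_measurable M"
  unfolding first_exit_def by measurable

lemma first_exit_walk_integrable: "integrable M (\<lambda>\<omega>. walk l \<omega> ^ q * first_exit a m \<omega>)"
  by (rule Bochner_Integration.integrable_bound[OF walk_integrable[of l q]])
    (auto simp: first_exit_def)

text \<open>The submartingale property on an event of the past: the cross term
  \<open>4 * walk ^ 3 * X\<close> has mean zero even after multiplication by the indicator, which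
  depends only on steps before \<open>m \<le> l\<close>.\<close>

lemma first_exit_mono:
  assumes "m \<le> l"
  shows "expectation (\<lambda>\<omega>. walk m \<omega> ^ 4 * first_exit a m \<omega>) \<le> expectation (\<lambda>\<omega>. walk l \<omega> ^ 4 * first_exit a m \<omega>)"
  using assms
proof (induction l rule: dec_induct)
  case (step l)
  let ?P = "Pi\<^sub>M {..<l} (\<lambda>_. borel :: real measure)"
  let ?Z = "\<lambda>\<omega>. walk l \<omega> ^ 3 * first_exit a m \<omega>"
  let ?F = "\<lambda>x. (\<Sum>i<l. x i) ^ 3 * (if a \<le> \<bar>\<Sum>i<m. x i\<bar> \<and> (\<forall>l<m. \<bar>\<Sum>i<l. x i\<bar> < a) then 1 else (0::real))"
  have F: "?F \<in> borel_measurable ?P"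
  proof -
    have sums: "(\<lambda>x. \<Sum>i<j. x i) \<in> borel_measurable (Pi\<^sub>M {..<l} (\<lambda>_. borel :: real measure))" if "j \<le> l" for j
      using that by (intro borel_measurable_sum measurable_component_singleton) auto
    have before: "Measurable.pred ?P (\<lambda>x. \<forall>j<m. \<bar>\<Sum>i<j. x i\<bar> < a)"
    proof (intro pred_intros_countable pred_intros_imp')
      fix j assume "j < m"
      then have [measurable]: "(\<lambda>x. \<Sum>i<j. x i) \<in> borel_measurable (Pi\<^sub>M {..<l} (\<lambda>_. borel :: real measure))"
        using step by (intro sums) simp
      show "Measurable.pred ?P (\<lambda>x. \<bar>\<Sum>i<j. x i\<bar> < a)" by measurable
    qed
    have exit: "Measurable.pred ?P (\<lambda>x. a \<le> \<bar>\<Sum>i<m. x i\<bar>)"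
      using sums[of m] step by simp
    show ?thesis
      by (intro borel_measurable_times borel_measurable_power measurable_If sums order_refl
          measurable_const) (use pred_intros_logic(3)[OF exit before] in \<open>auto simp: pred_def\<close>)
  qed
  have Z: "?Z \<omega> = ?F (\<lambda>i\<in>{..<l}. X i \<omega>)" for \<omega>
  proof -
    have "(\<Sum>i<j. (\<lambda>i\<in>{..<l}. X i \<omega>) i) = walk j \<omega>" if "j \<le> l" for j
      using that unfolding walk_def by (intro sum.cong) auto
    note this[of m] this[of l] this
    then show ?thesis using step by (auto simp add: first_exit_def)
  qed
  note past = walk_past_times[OF F Z first_exit_walk_integrable, of 1]
  have "walk l \<omega> ^ 4 * first_exit a m \<omega> + 4 * (?Z \<omega> * X l \<omega> ^ 1) \<le> walk (Suc l) \<omega> ^ 4 * first_exit a m \<omega>" for \<omega>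
  proof -
    \<comment> \<open>Convexity of the fourth power with its remainder written as a visibly
      nonnegative expression.\<close>
    have "walk l \<omega> ^ 4 + 4 * walk l \<omega> ^ 3 * X l \<omega> + X l \<omega> ^ 2 * (2 * walk l \<omega> ^ 2 + (2 * walk l \<omega> + X l \<omega>) ^ 2)
        = walk (Suc l) \<omega> ^ 4"
      by (simp add: walk_Suc power4_eq_xxxx power3_eq_cube power2_eq_square algebra_simps)
    moreover have "0 \<le> X l \<omega> ^ 2 * (2 * walk l \<omega> ^ 2 + (2 * walk l \<omega> + X l \<omega>) ^ 2)" by simp
    ultimately have "walk l \<omega> ^ 4 + 4 * walk l \<omega> ^ 3 * X l \<omega> \<le> walk (Suc l) \<omega> ^ 4" by linarith
    then show ?thesis by (auto simp: first_exit_def)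
  qed
  then have "expectation (\<lambda>\<omega>. walk l \<omega> ^ 4 * first_exit a m \<omega> + 4 * (?Z \<omega> * X l \<omega> ^ 1)) \<le>
      expectation (\<lambda>\<omega>. walk (Suc l) \<omega> ^ 4 * first_exit a m \<omega>)"
    using past(1) by (intro integral_mono Bochner_Integration.integrable_add first_exit_walk_integrable
      Bochner_Integration.integrable_mult_right) auto
  also have "expectation (\<lambda>\<omega>. walk l \<omega> ^ 4 * first_exit a m \<omega> + 4 * (?Z \<omega> * X l \<omega> ^ 1)) =
      expectation (\<lambda>\<omega>. walk l \<omega> ^ 4 * first_exit a m \<omega>)"
    using past first_exit_walk_integrable[of l 4 a m] by (simp add: mean)
  finally show ?case using step.IH by simp
qed simp

text \<open>Doob's maximal inequality for the submartingale \<open>walk\<^sup>4\<close>, by decomposing at the first exit.\<close>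

proposition walk_maximal:
  assumes a: "0 < a"
  shows "prob {\<omega>\<in>space M. \<exists>m\<le>r. a \<le> \<bar>walk m \<omega>\<bar>} \<le> (C + 3) * real r ^ 2 / a ^ 4"
proof -
  let ?E = "{\<omega>\<in>space M. \<exists>m\<le>r. a \<le> \<bar>walk m \<omega>\<bar>}"
  let ?f = "\<lambda>\<omega>. \<Sum>m\<le>r. first_exit a m \<omega>"
  have E [measurable]: "?E \<in> events" by measurable
  have int: "integrable M (first_exit a m)" for m
    using first_exit_walk_integrable[of 0 0 a m] by simp
  have ge: "indicat_real ?E \<omega> \<le> ?f \<omega>" if "\<omega> \<in> space M" for \<omega>
  proof (cases "\<exists>m\<le>r. a \<le> \<bar>walk m \<omega>\<bar>")
    case True
    define m where "m = (LEAST m. a \<le> \<bar>walk m \<omega>\<bar>)"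
    obtain m0 where m0: "m0 \<le> r" "a \<le> \<bar>walk m0 \<omega>\<bar>" using True by blast
    have m: "a \<le> \<bar>walk m \<omega>\<bar>" "m \<le> m0"
      unfolding m_def using m0(2) by (auto intro: LeastI Least_le)
    have "\<forall>l<m. \<bar>walk l \<omega>\<bar> < a" unfolding m_def using not_less_Least not_less by blast
    then have "first_exit a m \<omega> = 1" using m by (simp add: first_exit_def)
    moreover have "first_exit a m \<omega> \<le> ?f \<omega>"
      using m m0 by (intro member_le_sum) (auto simp: first_exit_def)
    ultimately show ?thesis by (auto simp: indicator_def)
  qed (auto simp: first_exit_def indicator_def intro!: sum_nonneg)
  have le: "?f \<omega> \<le> 1" for \<omega>
  proof (cases "\<exists>m\<le>r. first_exit a m \<omega> \<noteq> 0")
    case True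
    then obtain m where m: "m \<le> r" "first_exit a m \<omega> \<noteq> 0" by blast
    have "first_exit a l \<omega> = 0" if "l \<noteq> m" for l
      using m(2) that unfolding first_exit_def by (metis linorder_neqE_nat not_less)
    then have "?f \<omega> = first_exit a m \<omega>"
      using m(1) sum.mono_neutral_right[of "{..r}" "{m}" "\<lambda>m. first_exit a m \<omega>"] by auto
    then show ?thesis by (simp add: first_exit_def)
  qed auto
  have "prob ?E = expectation (indicat_real ?E)" by simp
  also have "\<dots> \<le> expectation ?f"
    using ge int by (intro integral_mono) (auto simp: integrable_real_indicator emeasure_eq_measure)
  finally have "a ^ 4 * prob ?E \<le> a ^ 4 * expectation ?f" by (intro mult_left_mono) auto
  also have "\<dots> = (\<Sum>m\<le>r. expectation (\<lambda>\<omega>. a ^ 4 * first_exit a m \<omega>))"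
    using int by (simp add: sum_distrib_left)
  also have "\<dots> \<le> (\<Sum>m\<le>r. expectation (\<lambda>\<omega>. walk m \<omega> ^ 4 * first_exit a m \<omega>))"
  proof (intro sum_mono integral_mono)
    fix m \<omega>
    show "a ^ 4 * first_exit a m \<omega> \<le> walk m \<omega> ^ 4 * first_exit a m \<omega>"
      using a power_mono[of a "\<bar>walk m \<omega>\<bar>" 4] by (auto simp: first_exit_def)
  qed (use int first_exit_walk_integrable in auto)
  also have "\<dots> \<le> (\<Sum>m\<le>r. expectation (\<lambda>\<omega>. walk r \<omega> ^ 4 * first_exit a m \<omega>))"
    by (intro sum_mono first_exit_mono) simp
  also have "\<dots> = expectation (\<lambda>\<omega>. walk r \<omega> ^ 4 * ?f \<omega>)"
    using first_exit_walk_integrable by (simp add: sum_distrib_left)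
  also have "\<dots> \<le> expectation (\<lambda>\<omega>. walk r \<omega> ^ 4)"
  proof (intro integral_mono walk_integrable)
    show "integrable M (\<lambda>\<omega>. walk r \<omega> ^ 4 * ?f \<omega>)"
      unfolding sum_distrib_left using first_exit_walk_integrable by auto
    show "walk r \<omega> ^ 4 * ?f \<omega> \<le> walk r \<omega> ^ 4" for \<omega>
      using mult_left_mono[OF le, of "walk r \<omega> ^ 4" \<omega>] by simp
  qed
  also have "\<dots> \<le> (C + 3) * real r ^ 2" by (rule walk_fourth)
  finally show ?thesis using a by (simp add: pos_le_divide_eq mult.commute)
qed

end

section \<open>Laws of the driving increments\<close>

text \<open>Finite rectangles determine a measure on an infinite product. The index set is left
  arbitrary so that a single law covers the increments up to every horizon.\<close>

lemma (in prob_space) distr_restrict_eq_PiM: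
  assumes rv: "\<And>i. i \<in> I \<Longrightarrow> X i \<in> M \<rightarrow>\<^sub>M N i"
    and prod: "\<And>J A. finite J \<Longrightarrow> J \<subseteq> I \<Longrightarrow> (\<And>i. i \<in> J \<Longrightarrow> A i \<in> sets (N i)) \<Longrightarrow>
      prob {\<omega>\<in>space M. \<forall>i\<in>J. X i \<omega> \<in> A i} = (\<Prod>i\<in>J. prob {\<omega>\<in>space M. X i \<omega> \<in> A i})"
  shows "distr M (Pi\<^sub>M I N) (\<lambda>\<omega>. \<lambda>i\<in>I. X i \<omega>) = Pi\<^sub>M I (\<lambda>i. distr M (N i) (X i))"
proof (rule measure_eqI_PiM_infinite[where I = I and M = N])
  let ?D = "distr M (Pi\<^sub>M I N) (\<lambda>\<omega>. \<lambda>i\<in>I. X i \<omega>)"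
  have X: "(\<lambda>\<omega>. \<lambda>i\<in>I. X i \<omega>) \<in> M \<rightarrow>\<^sub>M Pi\<^sub>M I N" by (rule measurable_restrict) (rule rv)
  show "sets (?D) = sets (Pi\<^sub>M I N)" by simp
  show "sets (Pi\<^sub>M I (\<lambda>i. distr M (N i) (X i))) = sets (Pi\<^sub>M I N)"
    by (intro sets_PiM_cong) auto
  interpret D: prob_space "?D"
    by (rule prob_space_distr[OF X])
  show "finite_measure (?D)"
    by (rule D.finite_measure_axioms)
  fix A J assume J: "finite J" "J \<subseteq> I" and A: "\<And>i. i \<in> J \<Longrightarrow> A i \<in> sets (N i)"
  let ?E = "prod_emb I N J (Pi\<^sub>E J A)"
  have vimage: "(\<lambda>\<omega>. \<lambda>i\<in>I. X i \<omega>) -` ?E \<inter> space M = {\<omega>\<in>space M. \<forall>i\<in>J. X i \<omega> \<in> A i}"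
    using J(2) measurable_space[OF rv] by (auto simp: prod_emb_def PiE_iff subset_iff)
  have "emeasure (?D) ?E = emeasure M {\<omega>\<in>space M. \<forall>i\<in>J. X i \<omega> \<in> A i}"
    using J A by (subst emeasure_distr[OF X]) (auto intro: sets_PiM_I simp: vimage)
  also have "\<dots> = ennreal (\<Prod>i\<in>J. prob {\<omega>\<in>space M. X i \<omega> \<in> A i})"
    using prod[OF J A] by (simp add: emeasure_eq_measure)
  also have "\<dots> = (\<Prod>i\<in>J. emeasure M {\<omega>\<in>space M. X i \<omega> \<in> A i})"
    by (simp add: emeasure_eq_measure prod_ennreal)
  also have "\<dots> = (\<Prod>i\<in>J. emeasure (distr M (N i) (X i)) (A i))"
  proof (rule prod.cong[OF refl])
    fix i assume i: "i \<in> J"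
    then have "X i \<in> M \<rightarrow>\<^sub>M N i" using J rv by auto
    from emeasure_distr[OF this A[OF i]]
    show "emeasure M {\<omega>\<in>space M. X i \<omega> \<in> A i} = emeasure (distr M (N i) (X i)) (A i)"
      by (simp add: vimage_def Int_def conj_commute)
  qed
  also have "\<dots> = emeasure (Pi\<^sub>M I (\<lambda>i. distr M (N i) (X i))) (prod_emb I (\<lambda>i. distr M (N i) (X i)) J (Pi\<^sub>E J A))"
    using J A rv by (intro emeasure_PiM_emb[symmetric] prob_space_distr) auto
  also have "prod_emb I (\<lambda>i. distr M (N i) (X i)) J (Pi\<^sub>E J A) = ?E"
    by (simp add: prod_emb_def PiE_def)
  finally show "emeasure (?D) ?E =
      emeasure (Pi\<^sub>M I (\<lambda>i. distr M (N i) (X i))) ?E" .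
qed

lemma (in prob_space) indep_vars_prob_prod:
  assumes "indep_vars N X I" "finite J" "J \<subseteq> I" "\<And>i. i \<in> J \<Longrightarrow> A i \<in> sets (N i)"
  shows "prob {\<omega>\<in>space M. \<forall>i\<in>J. X i \<omega> \<in> A i} = (\<Prod>i\<in>J. prob {\<omega>\<in>space M. X i \<omega> \<in> A i})"
proof (cases "J = {}")
  case True
  then show ?thesis by (simp add: prob_space)
next
  case False
  have "prob (\<Inter>i\<in>J. X i -` A i \<inter> space M) = (\<Prod>i\<in>J. prob (X i -` A i \<inter> space M))"
    using assms False by (intro indep_varsD[where I = I]) auto
  moreover have "(\<Inter>i\<in>J. X i -` A i \<inter> space M) = {\<omega>\<in>space M. \<forall>i\<in>J. X i \<omega> \<in> A i}"
    using False by auto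
  moreover have "X i -` A i \<inter> space M = {\<omega>\<in>space M. X i \<omega> \<in> A i}" for i by auto
  ultimately show ?thesis by simp
qed

lemma (in prob_space) distr_indep_vars_eq_PiM:
  assumes "indep_vars N X I"
  shows "distr M (Pi\<^sub>M I N) (\<lambda>\<omega>. \<lambda>i\<in>I. X i \<omega>) = Pi\<^sub>M I (\<lambda>i. distr M (N i) (X i))"
  using assms indep_vars_prob_prod[OF assms]
  by (intro distr_restrict_eq_PiM) (auto simp: indep_vars_def)

text \<open>Independent copies of one space carry every product law whose factors are realised on
  it; this lifts a scalar coupling to all coordinates at once.\<close>

lemma distr_PiM_coordinatewise:
  assumes \<Omega>: "prob_space \<Omega>" and f: "\<And>i. i \<in> I \<Longrightarrow> f i \<in> \<Omega> \<rightarrow>\<^sub>M N i"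
  shows "distr (Pi\<^sub>M I (\<lambda>_. \<Omega>)) (Pi\<^sub>M I N) (\<lambda>\<omega>. \<lambda>i\<in>I. f i (\<omega> i)) = Pi\<^sub>M I (\<lambda>i. distr \<Omega> (N i) (f i))"
proof -
  interpret \<Omega>: prob_space \<Omega> by fact
  interpret PI: prob_space "Pi\<^sub>M I (\<lambda>_. \<Omega>)" by (intro prob_space_PiM \<Omega>)
  interpret P: product_prob_space "\<lambda>_. \<Omega>" I by unfold_locales
  let ?P = "Pi\<^sub>M I (\<lambda>_. \<Omega>)"
  have meas: "(\<lambda>\<omega>. f i (\<omega> i)) \<in> ?P \<rightarrow>\<^sub>M N i" if "i \<in> I" for i
    using f[OF that] that by measurable
  have single: "measure ?P {\<omega>\<in>space ?P. f i (\<omega> i) \<in> A} =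
      measure \<Omega> {x\<in>space \<Omega>. f i x \<in> A}" if "i \<in> I" "A \<in> sets (N i)" for i A
  proof -
    have "{x\<in>space \<Omega>. f i x \<in> A} \<in> sets \<Omega>" using f[OF that(1)] that(2) by measurable
    from P.emeasure_PiM_Collect_single[OF that(1) this] that(1)
    have "emeasure ?P {\<omega>\<in>space ?P. f i (\<omega> i) \<in> A} =
      emeasure \<Omega> {x\<in>space \<Omega>. f i x \<in> A}"
      by (simp add: space_PiM PiE_iff cong: conj_cong)
    then show ?thesis by (simp add: measure_def)
  qed
  have "distr ?P (Pi\<^sub>M I N) (\<lambda>\<omega>. \<lambda>i\<in>I. f i (\<omega> i)) =
      Pi\<^sub>M I (\<lambda>i. distr ?P (N i) (\<lambda>\<omega>. f i (\<omega> i)))"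
  proof (rule PI.distr_restrict_eq_PiM)
    fix J A assume J: "finite J" "J \<subseteq> I" and A: "\<And>i. i \<in> J \<Longrightarrow> A i \<in> sets (N i)"
    have "{x\<in>space \<Omega>. f i x \<in> A i} \<in> sets \<Omega>" if "i \<in> J" for i
    proof -
      have "i \<in> I" using that J by auto
      show ?thesis using f[OF \<open>i \<in> I\<close>] A[OF that] by measurable
    qed
    from P.emeasure_PiM_Collect[OF J(2,1) this]
    have "emeasure ?P {\<omega>\<in>space ?P. \<forall>i\<in>J. f i (\<omega> i) \<in> A i} =
      (\<Prod>i\<in>J. emeasure \<Omega> {x\<in>space \<Omega>. f i x \<in> A i})"
    proof -
      have "{\<omega>\<in>space ?P. \<forall>i\<in>J. f i (\<omega> i) \<in> A i} =
          {\<omega>\<in>space ?P. \<forall>i\<in>J. \<omega> i \<in> {x\<in>space \<Omega>. f i x \<in> A i}}"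
        using J by (auto simp: space_PiM)
      then show ?thesis
        using P.emeasure_PiM_Collect[OF J(2,1) \<open>\<And>i. i \<in> J \<Longrightarrow> {x\<in>space \<Omega>. f i x \<in> A i} \<in> sets \<Omega>\<close>] by simp
    qed
    then have "measure ?P {\<omega>\<in>space ?P. \<forall>i\<in>J. f i (\<omega> i) \<in> A i} =
      (\<Prod>i\<in>J. measure \<Omega> {x\<in>space \<Omega>. f i x \<in> A i})"
      by (simp add: PI.emeasure_eq_measure \<Omega>.emeasure_eq_measure prod_ennreal measure_nonneg prod_nonneg)
    then show "measure ?P {\<omega>\<in>space ?P. \<forall>i\<in>J. f i (\<omega> i) \<in> A i} =
      (\<Prod>i\<in>J. measure ?P {\<omega>\<in>space ?P. f i (\<omega> i) \<in> A i})"
      using J A by (auto simp: single intro!: prod.cong)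
  qed (rule meas)
  also have "\<dots> = Pi\<^sub>M I (\<lambda>i. distr \<Omega> (N i) (f i))"
  proof (rule PiM_cong[OF refl])
    fix i assume i: "i \<in> I"
    have "distr ?P (N i) (\<lambda>\<omega>. f i (\<omega> i)) = distr (distr ?P \<Omega> (\<lambda>\<omega>. \<omega> i)) (N i) (f i)"
      using f[OF i] i by (subst distr_distr) (auto simp: comp_def)
    then show "distr ?P (N i) (\<lambda>\<omega>. f i (\<omega> i)) = distr \<Omega> (N i) (f i)"
      using P.PiM_component[OF i] by simp
  qed
  finally show ?thesis .
qed

lemma distributed_lborel_distr:
  assumes "distributed M lborel X f"
  shows "distr M borel X = density lborel f"
proof -
  have "distr M borel X = distr M lborel X" by (rule distr_cong) auto
  then show ?thesis using distributed_distr_eq_density[OF assms] by simp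
qed

section \<open>Increments of the Brownian motions\<close>

definition grid_increments :: "nat \<Rightarrow> ('p \<Rightarrow> real \<Rightarrow> real) \<Rightarrow> 'p \<times> nat \<Rightarrow> real" where
  "grid_increments k b = (\<lambda>(p, j). b p (real (Suc j) / real k) - b p (real j / real k))"

context reflected_interlacing_bm
begin

lemma B_measurable: "p \<in> gt_index N \<Longrightarrow> 0 \<le> t \<Longrightarrow> B p t \<in> borel_measurable M"
  using standard_brownian_motion.B_measurable[OF B_brownian] .

text \<open>Independence is given in two layers, between the paths of different particles and
  between the increments of one path. A finite rectangle is therefore grouped by particle, factored
  there, and then factored in time.\<close>

lemma grid_increments_law:
  assumes k: "0 < k"
  shows "distr M (Pi\<^sub>M (gt_index N \<times> UNIV) (\<lambda>_. borel))
      (\<lambda>\<omega>. \<lambda>q\<in>gt_index N \<times> UNIV. grid_increments k (\<lambda>p t. B p t \<omega>) q) =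
    Pi\<^sub>M (gt_index N \<times> UNIV) (\<lambda>_. density lborel (normal_density 0 (1 / sqrt (real k))))"
proof -
  let ?X = "\<lambda>q \<omega>. grid_increments k (\<lambda>p t. B p t \<omega>) q"
  have rv: "?X q \<in> borel_measurable M" if "q \<in> gt_index N \<times> UNIV" for q
    using that by (auto simp: grid_increments_def intro!: borel_measurable_diff B_measurable)
  have "distr M (Pi\<^sub>M (gt_index N \<times> UNIV) (\<lambda>_. borel)) (\<lambda>\<omega>. \<lambda>q\<in>gt_index N \<times> UNIV. ?X q \<omega>) =
      Pi\<^sub>M (gt_index N \<times> UNIV) (\<lambda>q. distr M borel (?X q))"
  proof (rule distr_restrict_eq_PiM)
    fix J :: "((nat \<times> nat) \<times> nat) set" and A :: "(nat \<times> nat) \<times> nat \<Rightarrow> real set"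
    assume J: "finite J" "J \<subseteq> gt_index N \<times> UNIV" and A: "\<And>i. i \<in> J \<Longrightarrow> A i \<in> sets borel"
    define L where "L p = {j. (p, j) \<in> J}" for p
    have fin: "finite (fst ` J)" "finite (L p)" for p
      using J(1) finite_subset[of "L p" "snd ` J"] by (force simp: L_def)+
    have J_eq: "J = (SIGMA p:fst ` J. L p)" by (force simp: L_def)
    have sub: "fst ` J \<subseteq> gt_index N" using J(2) by auto
    let ?G = "\<lambda>p j. {\<omega>\<in>space M. ?X (p, j) \<omega> \<in> A (p, j)}"
    let ?E = "\<lambda>p. {x\<in>space (Pi\<^sub>M UNIV (\<lambda>_. borel)). \<forall>j\<in>L p. x j \<in> A (p, j)}"
    let ?D = "\<lambda>x. \<lambda>j\<in>UNIV. x (real (Suc j) / real k) - x (real j / real k) :: real"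
    have ind: "indep_vars (\<lambda>_. Pi\<^sub>M UNIV (\<lambda>_. borel)) (\<lambda>p \<omega>. ?D (\<lambda>t\<in>{0..}. B p t \<omega>)) (gt_index N)"
      by (rule indep_vars_compose2[OF B_indep], rule measurable_restrict)
        (auto intro!: borel_measurable_diff measurable_component_singleton)
    have D: "?D (\<lambda>t\<in>{0..}. B p t \<omega>) = (\<lambda>j. ?X (p, j) \<omega>)" for p \<omega>
      by (simp add: grid_increments_def fun_eq_iff)
    have "prob {\<omega>\<in>space M. \<forall>q\<in>J. ?X q \<omega> \<in> A q} =
        prob {\<omega>\<in>space M. \<forall>p\<in>fst ` J. ?D (\<lambda>t\<in>{0..}. B p t \<omega>) \<in> ?E p}"
    proof -
      have "(\<forall>q\<in>J. ?X q \<omega> \<in> A q) \<longleftrightarrow> (\<forall>p\<in>fst ` J. \<forall>j\<in>L p. ?X (p, j) \<omega> \<in> A (p, j))" for \<omega>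
        by (force simp: L_def)
      then show ?thesis unfolding D by (simp add: space_PiM)
    qed
    also have "\<dots> = (\<Prod>p\<in>fst ` J. prob {\<omega>\<in>space M. ?D (\<lambda>t\<in>{0..}. B p t \<omega>) \<in> ?E p})"
    proof (rule indep_vars_prob_prod[OF ind fin(1) sub])
      fix p assume "p \<in> fst ` J"
      show "?E p \<in> sets (Pi\<^sub>M UNIV (\<lambda>_. borel))"
        using fin(2) A by (intro sets.sets_Collect_finite_All sets_Collect_single') (auto simp: L_def)
    qed
    also have "\<dots> = (\<Prod>p\<in>fst ` J. \<Prod>j\<in>L p. prob (?G p j))"
    proof (rule prod.cong[OF refl])
      fix p assume p: "p \<in> fst ` J"
      interpret Bp: standard_brownian_motion M "B p" using B_brownian sub p by blast
      obtain n where n: "L p \<subseteq> {..<n}" using fin(2) finite_nat_bounded by blast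
      have mono: "mono (\<lambda>j. real j / real k)" by (intro monoI divide_right_mono) auto
      have "indep_vars (\<lambda>_. borel) (\<lambda>j \<omega>. ?X (p, j) \<omega>) {..<n}"
        using Bp.B_indep_increments[OF _ mono, of n] by (simp add: grid_increments_def)
      from indep_vars_prob_prod[OF this fin(2) n, of "\<lambda>j. A (p, j)"]
      have "prob {\<omega>\<in>space M. \<forall>j\<in>L p. ?X (p, j) \<omega> \<in> A (p, j)} = (\<Prod>j\<in>L p. prob (?G p j))"
        using A by (auto simp: L_def)
      then show "prob {\<omega>\<in>space M. ?D (\<lambda>t\<in>{0..}. B p t \<omega>) \<in> ?E p} =
          (\<Prod>j\<in>L p. prob (?G p j))"
        unfolding D by (simp add: space_PiM)
    qed
    also have "\<dots> = (\<Prod>(p, j)\<in>(SIGMA p:fst ` J. L p). prob (?G p j))"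
      using fin by (intro prod.Sigma) auto
    also have "\<dots> = (\<Prod>q\<in>J. prob {\<omega>\<in>space M. ?X q \<omega> \<in> A q})"
      unfolding J_eq[symmetric] by (simp add: case_prod_unfold)
    finally show "prob {\<omega>\<in>space M. \<forall>q\<in>J. ?X q \<omega> \<in> A q} = (\<Prod>q\<in>J. prob {\<omega>\<in>space M. ?X q \<omega> \<in> A q})" .
  qed (rule rv)
  also have "\<dots> = Pi\<^sub>M (gt_index N \<times> UNIV) (\<lambda>_. density lborel (normal_density 0 (1 / sqrt (real k))))"
  proof (rule PiM_cong[OF refl])
    fix q assume "q \<in> gt_index N \<times> (UNIV :: nat set)"
    then obtain p j where q: "q = (p, j)" "p \<in> gt_index N" by auto
    interpret Bp: standard_brownian_motion M "B p" by (rule B_brownian[OF q(2)])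
    have "real (Suc j) / real k - real j / real k = 1 / real k" by (simp add: diff_divide_distrib[symmetric])
    then show "distr M borel (?X q) = density lborel (normal_density 0 (1 / sqrt (real k)))"
      using distributed_lborel_distr[OF Bp.B_increment[of "real j / real k" "real (Suc j) / real k"]] k
      by (simp add: q grid_increments_def divide_strict_right_mono real_sqrt_divide)
  qed
  finally show ?thesis .
qed

end

lemma block_length_tendsto:
  fixes k j :: nat
  assumes k: "0 < k"
  defines "r \<equiv> \<lambda>n. n * Suc j div k - n * j div k"
  shows "filterlim r at_top sequentially"
    and "(\<lambda>n. real (r n) / real n) \<longlonglongrightarrow> 1 / real k"
proof -
  have r: "n div k \<le> r n" "r n \<le> n div k + 1" for n
    using mult_div_block[OF k, of n j] by (auto simp: r_def)
  show "filterlim r at_top sequentially"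
    unfolding filterlim_at_top
  proof
    fix Z
    have "Z \<le> r n" if "Z * k \<le> n" for n
      using r(1)[of n] div_le_mono[OF that, of k] k by simp
    then show "\<forall>\<^sub>F n in sequentially. Z \<le> r n" by (rule eventually_sequentiallyI)
  qed
  show "(\<lambda>n. real (r n) / real n) \<longlonglongrightarrow> 1 / real k"
  proof (rule real_tendsto_sandwich)
    have lim: "(\<lambda>n. 1 / real n) \<longlonglongrightarrow> 0" by (rule lim_1_over_n)
    show "(\<lambda>n. 1 / real k - 1 / real n) \<longlonglongrightarrow> 1 / real k"
      using tendsto_diff[OF tendsto_const lim, of "1 / real k"] by simp
    show "(\<lambda>n. 1 / real k + 1 / real n) \<longlonglongrightarrow> 1 / real k"
      using tendsto_add[OF tendsto_const lim, of "1 / real k"] by simp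
    have bounds: "real n / real k - 1 \<le> real (r n)" "real (r n) \<le> real n / real k + 1" for n
    proof -
      have "real n / real k - 1 \<le> real (n div k)" 
        using floor_divide_of_nat_eq[of n k, where ?'a = real] by linarith
      then show "real n / real k - 1 \<le> real (r n)" using r(1)[of n] by linarith
      show "real (r n) \<le> real n / real k + 1"
        using r(2)[of n] of_nat_div_le_of_nat[of n k, where ?'a = real] by linarith
    qed
    show "\<forall>\<^sub>F n in sequentially. 1 / real k - 1 / real n \<le> real (r n) / real n"
      using eventually_gt_at_top[of 0]
    proof eventually_elim
      case (elim n)
      have "1 / real k - 1 / real n = (real n / real k - 1) / real n" using elim by (simp add: diff_divide_distrib)
      also have "\<dots> \<le> real (r n) / real n" by (intro divide_right_mono bounds) simp
      finally show ?case .
    qed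
    show "\<forall>\<^sub>F n in sequentially. real (r n) / real n \<le> 1 / real k + 1 / real n"
      using eventually_gt_at_top[of 0]
    proof eventually_elim
      case (elim n)
      have "real (r n) / real n \<le> (real n / real k + 1) / real n" by (intro divide_right_mono bounds) simp
      also have "\<dots> = 1 / real k + 1 / real n" using elim by (simp add: add_divide_distrib)
      finally show ?case .
    qed
  qed
qed

lemma distr_scaled_std_normal:
  assumes \<Omega>: "prob_space \<Omega>" and Z: "Z \<in> borel_measurable \<Omega>" "distr \<Omega> borel Z = std_normal_distribution"
    and c: "c \<noteq> 0"
  shows "distr \<Omega> borel (\<lambda>x. c * Z x) = density lborel (normal_density 0 \<bar>c\<bar>)"
proof -
  interpret prob_space \<Omega> by fact
  have "distr \<Omega> lborel Z = distr \<Omega> borel Z" by (rule distr_cong) auto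
  then have "distributed \<Omega> lborel Z std_normal_density"
    using Z by (simp add: distributed_def)
  from normal_density_affine[OF this, of c 0] c
  have "distributed \<Omega> lborel (\<lambda>x. c * Z x) (normal_density 0 \<bar>c\<bar>)" by simp
  then show ?thesis by (rule distributed_lborel_distr)
qed

section \<open>Increments of the clocks and their limit in law\<close>

context multilevel_tasep
begin

abbreviation "Idx \<equiv> gt_index N \<times> (UNIV :: nat set)"

abbreviation "increment_space \<equiv> Pi\<^sub>M Idx (\<lambda>_. borel :: real measure)"

text \<open>The blocks contain deterministic numbers of rings, not the rings of a time interval, so
  the increments are independent sums. As clocks have rate 1, block \<open>j\<close> stands for the
  scaled time from \<open>j / k\<close> to \<open>(j + 1) / k\<close>. The sign reflects that long
  waiting times mean few rings.\<close>

definition clock_increments :: "nat \<Rightarrow> nat \<Rightarrow> 'a \<Rightarrow> (nat \<times> nat) \<times> nat \<Rightarrow> real" where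
  "clock_increments n k \<omega> =
     (\<lambda>(p, j). - (\<Sum>i\<in>{n * j div k..<n * Suc j div k}. \<xi> p i \<omega> - 1) / sqrt (real n))"

lemma \<xi>_measurable: "p \<in> gt_index N \<Longrightarrow> \<xi> p i \<in> borel_measurable M"
  using distributed_measurable[OF clock_exponential] by simp

lemma clock_shift_indep:
  assumes "p \<in> gt_index N"
  shows "indep_vars (\<lambda>_. borel) (\<lambda>i. \<xi> p (b + i)) UNIV"
proof -
  have "indep_vars (\<lambda>i. Pi\<^sub>M {(p, b + i)} (\<lambda>_. borel))
      (\<lambda>i \<omega>. restrict (\<lambda>q. (\<lambda>(p, k). \<xi> p k) q \<omega>) {(p, b + i)}) UNIV"
    by (rule indep_vars_restrict[OF clocks_indep]) (use assms in \<open>auto simp: disjoint_family_on_def\<close>)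
  then have "indep_vars (\<lambda>_. borel)
      (\<lambda>i \<omega>. (restrict (\<lambda>q. (\<lambda>(p, k). \<xi> p k) q \<omega>) {(p, b + i)}) (p, b + i)) UNIV"
    by (rule indep_vars_compose2) auto
  then show ?thesis by simp
qed

lemma clock_indep: "p \<in> gt_index N \<Longrightarrow> indep_vars (\<lambda>_. borel) (\<xi> p) UNIV"
  using clock_shift_indep[of p 0] by simp

lemma clock_increments_measurable:
  "q \<in> Idx \<Longrightarrow> (\<lambda>\<omega>. clock_increments n k \<omega> q) \<in> borel_measurable M"
  by (auto simp: clock_increments_def intro!: borel_measurable_divide borel_measurable_sum borel_measurable_diff
      borel_measurable_uminus \<xi>_measurable)

lemma clock_increments_indep:
  shows "indep_vars (\<lambda>_. borel) (\<lambda>q \<omega>. clock_increments n k \<omega> q) Idx"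
proof -
  let ?block = "\<lambda>q :: (nat \<times> nat) \<times> nat. {n * snd q div k..<n * Suc (snd q) div k}"
  define K where "K = (\<lambda>(p :: nat \<times> nat, j). {p} \<times> {n * j div k..<n * Suc j div k})"
  let ?\<xi> = "\<lambda>\<omega> q. restrict (\<lambda>i. (\<lambda>(p, k). \<xi> p k) i \<omega>) (K q)"
  have mono: "n * i div k \<le> n * j div k" if "i \<le> j" for i j
    using that by (intro div_le_mono mult_le_mono2)
  have disj: "{n * i div k..<n * Suc i div k} \<inter> {n * j div k..<n * Suc j div k} = {}" if "i \<noteq> j" for i j
    using that mono[of "Suc i" j] mono[of "Suc j" i] by (cases "i < j") (auto simp: not_less)
  have "indep_vars (\<lambda>q. Pi\<^sub>M (K q) (\<lambda>_. borel)) (\<lambda>q \<omega>. ?\<xi> \<omega> q) Idx"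
  proof (rule indep_vars_restrict[OF clocks_indep])
    show "disjoint_family_on K Idx"
      unfolding disjoint_family_on_def
    proof (intro ballI impI)
      fix q q' :: "(nat \<times> nat) \<times> nat" assume "q \<noteq> q'"
      moreover obtain p j p' j' where "q = (p, j)" "q' = (p', j')" by (metis surj_pair)
      ultimately show "K q \<inter> K q' = {}"
        using disj[of j j'] by (cases "p = p'") (simp_all add: K_def Times_Int_Times)
    qed
  qed (auto simp: K_def)
  then have ind: "indep_vars (\<lambda>_. borel) (\<lambda>q \<omega>. (\<lambda>x. - (\<Sum>i\<in>?block q. x (fst q, i) - 1) / sqrt (real n))
      (?\<xi> \<omega> q)) Idx"
  proof (rule indep_vars_compose2)
    fix q
    have "(fst q, i) \<in> K q" if "i \<in> ?block q" for i
      using that by (simp add: K_def case_prod_unfold del: mult_Suc_right)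
    then show "(\<lambda>x. - (\<Sum>i\<in>?block q. x (fst q, i) - 1) / sqrt (real n))
        \<in> Pi\<^sub>M (K q) (\<lambda>_. borel) \<rightarrow>\<^sub>M (borel :: real measure)"
      by (intro borel_measurable_divide borel_measurable_sum borel_measurable_diff
        borel_measurable_uminus measurable_component_singleton measurable_const)  auto
  qed
  have "(\<Sum>i\<in>?block q. ?\<xi> \<omega> q (fst q, i) - 1) =
      (\<Sum>i\<in>?block q. \<xi> (fst q) i \<omega> - 1)" for q \<omega>
    by (intro sum.cong refl) (simp add: K_def case_prod_unfold del: mult_Suc_right)
  then have "(\<lambda>q \<omega>. clock_increments n k \<omega> q) =
      (\<lambda>q \<omega>. (\<lambda>x. - (\<Sum>i\<in>?block q. x (fst q, i) - 1) / sqrt (real n))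
      (?\<xi> \<omega> q))"
    by (simp add: clock_increments_def case_prod_unfold del: mult_Suc_right)
  then show ?thesis using ind by simp
qed

lemma clock_sum_char:
  assumes p: "p \<in> gt_index N"
  shows "char (distr M borel (\<lambda>\<omega>. \<Sum>i\<in>A. \<xi> p i \<omega> - 1)) t =
    char (distr (density lborel (exponential_density 1)) borel (\<lambda>x. x - 1)) t ^ card A"
proof -
  have "indep_vars (\<lambda>_. borel) (\<lambda>i \<omega>. \<xi> p i \<omega> - 1) A"
    by (rule indep_vars_compose2[OF indep_vars_subset[OF clock_indep[OF p]]]) auto
  then have "char (distr M borel (\<lambda>\<omega>. \<Sum>i\<in>A. \<xi> p i \<omega> - 1)) t = (\<Prod>i\<in>A. char (distr M borel (\<lambda>\<omega>. \<xi> p i \<omega> - 1)) t)"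
    by (rule char_distr_sum)
  moreover have "distr M borel (\<lambda>\<omega>. \<xi> p i \<omega> - 1) = distr (density lborel (exponential_density 1)) borel (\<lambda>x. x - 1)" for i
    unfolding distributed_lborel_distr[OF clock_exponential[OF p, of i], symmetric]
    using \<xi>_measurable[OF p] by (simp add: distr_distr comp_def)
  ultimately show ?thesis by simp
qed

text \<open>The characteristic function is a power with exponent the number of summands, so only the
  size of the block matters. Hence a limit theorem for one particle and initial segments serves all
  blocks of all particles.\<close>

lemma clock_sum_law:
  assumes "p \<in> gt_index N" "p' \<in> gt_index N" "card A = card A'"
  shows "distr M borel (\<lambda>\<omega>. \<Sum>i\<in>A. \<xi> p i \<omega> - 1) = distr M borel (\<lambda>\<omega>. \<Sum>i\<in>A'. \<xi> p' i \<omega> - 1)"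
proof (rule Levy_uniqueness)
  show "real_distribution (distr M borel (\<lambda>\<omega>. \<Sum>i\<in>A. \<xi> p i \<omega> - 1))"
    "real_distribution (distr M borel (\<lambda>\<omega>. \<Sum>i\<in>A'. \<xi> p' i \<omega> - 1))"
    using assms by (auto intro!: real_distribution_distr borel_measurable_sum borel_measurable_diff \<xi>_measurable)
  show "char (distr M borel (\<lambda>\<omega>. \<Sum>i\<in>A. \<xi> p i \<omega> - 1)) = char (distr M borel (\<lambda>\<omega>. \<Sum>i\<in>A'. \<xi> p' i \<omega> - 1))"
    using assms by (simp add: fun_eq_iff clock_sum_char)
qed

lemma clock_sum_clt:
  assumes p: "p \<in> gt_index N"
  shows "weak_conv_m (\<lambda>n. distr M borel (\<lambda>\<omega>. (\<Sum>i<n. \<xi> p i \<omega> - 1) / sqrt (real n))) std_normal_distribution"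
proof -
  have "weak_conv_m (\<lambda>n. distr M borel (\<lambda>x. (\<Sum>i<n. \<xi> p i x - 1) / sqrt (real n * 1\<^sup>2))) std_normal_distribution"
  proof (rule central_limit_theorem[where \<mu> = "density lborel (exponential_density 1)"])
    fix i
    show "expectation (\<xi> p i) = 1" using exponential_distributed_expectation[OF _ clock_exponential[OF p]] by simp
    show "variance (\<xi> p i) = 1\<^sup>2" using exponential_distributed_variance[OF _ clock_exponential[OF p]] by simp
    show "integrable M (\<lambda>x. (\<xi> p i x)\<^sup>2)" using erlang_ith_moment_integrable[OF _ clock_exponential[OF p]] by simp
    show "distr M borel (\<xi> p i) = density lborel (exponential_density 1)"
      by (rule distributed_lborel_distr[OF clock_exponential[OF p]])
  qed (use clock_indep[OF p] in auto)
  then show ?thesis by simp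
qed

text \<open>Skorohod's representation in each coordinate, on a product space, turns the convergence in
  law of the independent increments into pointwise convergence.\<close>

proposition clock_increments_representation:
  assumes k: "0 < k" and N: "gt_index N \<noteq> {}"
  obtains Q :: "((nat \<times> nat) \<times> nat \<Rightarrow> real) measure" and Us V where
    "prob_space Q" "\<And>n. Us n \<in> Q \<rightarrow>\<^sub>M increment_space" "V \<in> Q \<rightarrow>\<^sub>M increment_space"
    "\<And>n. distr Q (increment_space) (Us n) =
       distr M (increment_space) (\<lambda>\<omega>. \<lambda>q\<in>Idx. clock_increments n k \<omega> q)"
    "distr Q (increment_space) V = Pi\<^sub>M Idx (\<lambda>_. density lborel (normal_density 0 (1 / sqrt (real k))))"
    "\<And>x q. x \<in> space Q \<Longrightarrow> q \<in> Idx \<Longrightarrow> (\<lambda>n. Us n x q) \<longlonglongrightarrow> V x q"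
proof -
  obtain p where p: "p \<in> gt_index N" using N by blast
  define L where "L r = distr M borel (\<lambda>\<omega>. (\<Sum>i<r. \<xi> p i \<omega> - 1) / sqrt (real r))" for r
  have sum_meas [measurable]: "(\<lambda>\<omega>. \<Sum>i<r. \<xi> p i \<omega> - 1) \<in> borel_measurable M" for r
    using p by (auto intro!: borel_measurable_sum borel_measurable_diff \<xi>_measurable)
  \<comment> \<open>One scalar coupling, of the normalised sums of all lengths, is enough: every
    coordinate will use an independent copy of it.\<close>
  have "\<exists> (\<Omega> :: real measure) (Z_seq :: nat \<Rightarrow> real \<Rightarrow> real) (Z :: real \<Rightarrow> real).
      prob_space \<Omega> \<and> (\<forall>n. Z_seq n \<in> measurable \<Omega> borel) \<and> (\<forall>n. distr \<Omega> borel (Z_seq n) = L n) \<and>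
      Z \<in> measurable \<Omega> lborel \<and> distr \<Omega> borel Z = std_normal_distribution \<and>
      (\<forall>x \<in> space \<Omega>. (\<lambda>n. Z_seq n x) \<longlonglongrightarrow> Z x)"
    unfolding L_def by (rule Skorohod) (auto intro!: real_distribution_distr clock_sum_clt p real_dist_normal_dist)
  then obtain \<Omega> :: "real measure" and Zn Z where \<Omega>: "prob_space \<Omega>"
    and Zn': "\<forall>n. Zn n \<in> borel_measurable \<Omega>" and Zn_law': "\<forall>n. distr \<Omega> borel (Zn n) = L n"
    and Z': "Z \<in> measurable \<Omega> lborel" and Z_law: "distr \<Omega> borel Z = std_normal_distribution"
    and lim': "\<forall>x\<in>space \<Omega>. (\<lambda>n. Zn n x) \<longlonglongrightarrow> Z x"
    by (elim exE conjE) (rule that)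
  note Zn [measurable] = Zn'[rule_format] and Zn_law = Zn_law'[rule_format] and lim = lim'[rule_format]
  have Z [measurable]: "Z \<in> borel_measurable \<Omega>" using Z' by simp
  define r where "r n q = n * Suc (snd q) div k - n * snd q div k" for n and q :: "(nat \<times> nat) \<times> nat"
  \<comment> \<open>\<open>Zn\<close> is normalised by the length of the block and the increments by
    \<open>n\<close>; the square root converts one into the other and tends to
    \<open>1 / sqrt k\<close>.\<close>
  define f where "f n q x = - sqrt (real (r n q) / real n) * Zn (r n q) x" for n q x
  define g where "g x = - (1 / sqrt (real k)) * Z x" for x
  have f_meas: "f n q \<in> borel_measurable \<Omega>" for n q unfolding f_def by measurable
  have g_meas: "g \<in> borel_measurable \<Omega>" unfolding g_def by measurable
  let ?Q = "Pi\<^sub>M Idx (\<lambda>_. \<Omega>)"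
  show ?thesis
  proof (rule that[of ?Q "\<lambda>n \<omega>. \<lambda>q\<in>Idx. f n q (\<omega> q)" "\<lambda>\<omega>. \<lambda>q\<in>Idx. g (\<omega> q)"])
    show "prob_space ?Q" by (intro prob_space_PiM \<Omega>)
    show "(\<lambda>\<omega>. \<lambda>q\<in>Idx. f n q (\<omega> q)) \<in> ?Q \<rightarrow>\<^sub>M increment_space" for n
      by (rule measurable_restrict, rule measurable_compose[OF _ f_meas]) (rule measurable_component_singleton)
    show "(\<lambda>\<omega>. \<lambda>q\<in>Idx. g (\<omega> q)) \<in> ?Q \<rightarrow>\<^sub>M increment_space"
      by (rule measurable_restrict, rule measurable_compose[OF _ g_meas]) (rule measurable_component_singleton)
    show "distr ?Q (increment_space) (\<lambda>\<omega>. \<lambda>q\<in>Idx. g (\<omega> q)) =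
        Pi\<^sub>M Idx (\<lambda>_. density lborel (normal_density 0 (1 / sqrt (real k))))"
    proof -
      have "distr \<Omega> borel g = density lborel (normal_density 0 (1 / sqrt (real k)))"
        unfolding g_def using distr_scaled_std_normal[OF \<Omega> Z Z_law, of "- (1 / sqrt (real k))"] k by simp
      then show ?thesis
        using distr_PiM_coordinatewise[OF \<Omega>, of Idx "\<lambda>_. g" "\<lambda>_. borel"] g_meas by simp
    qed
    show "distr ?Q (increment_space) (\<lambda>\<omega>. \<lambda>q\<in>Idx. f n q (\<omega> q)) =
       distr M (increment_space) (\<lambda>\<omega>. \<lambda>q\<in>Idx. clock_increments n k \<omega> q)" for n
    proof -
      have "distr \<Omega> borel (f n q) = distr M borel (\<lambda>\<omega>. clock_increments n k \<omega> q)" if idx: "q \<in> Idx" for q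
      proof -
        obtain p' j where q: "q = (p', j)" "p' \<in> gt_index N" using idx by (cases q) auto
        let ?A = "{n * j div k..<n * Suc j div k}"
        have card: "card ?A = card {..<r n q}" by (simp add: r_def q)
        have [measurable]: "(\<lambda>\<omega>. \<Sum>i\<in>?A. \<xi> p' i \<omega> - 1) \<in> borel_measurable M"
          using q by (auto intro!: borel_measurable_sum borel_measurable_diff \<xi>_measurable)
        have "distr \<Omega> borel (f n q) = distr (L (r n q)) borel (\<lambda>x. - sqrt (real (r n q) / real n) * x)"
          unfolding Zn_law[symmetric] by (subst distr_distr) (auto simp: comp_def f_def[abs_def])
        also have "\<dots> = distr M borel (\<lambda>\<omega>. - sqrt (real (r n q) / real n) * ((\<Sum>i<r n q. \<xi> p i \<omega> - 1) / sqrt (real (r n q))))"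
          unfolding L_def by (subst distr_distr) (auto simp: comp_def)
        also have "\<dots> = distr M borel (\<lambda>\<omega>. - (\<Sum>i<r n q. \<xi> p i \<omega> - 1) / sqrt (real n))"
        proof -
          \<comment> \<open>Blocks can be empty when \<open>n < k\<close>; the sum is then 0, and
            both sides vanish.\<close>
          have "- sqrt (real (r n q) / real n) * (s / sqrt (real (r n q))) = - s / sqrt (real n)"
            if "r n q = 0 \<longrightarrow> s = 0" for s
            using that by (cases "r n q = 0") (simp_all add: real_sqrt_divide)
          then show ?thesis by simp
        qed
        also have "\<dots> = distr (distr M borel (\<lambda>\<omega>. \<Sum>i<r n q. \<xi> p i \<omega> - 1)) borel (\<lambda>x. - x / sqrt (real n))"
          by (subst distr_distr) (auto simp: comp_def)
        also have "distr M borel (\<lambda>\<omega>. \<Sum>i<r n q. \<xi> p i \<omega> - 1) = distr M borel (\<lambda>\<omega>. \<Sum>i\<in>?A. \<xi> p' i \<omega> - 1)"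
          by (rule clock_sum_law[OF p q(2) card[symmetric]])
        also have "distr \<dots> borel (\<lambda>x. - x / sqrt (real n)) = distr M borel (\<lambda>\<omega>. clock_increments n k \<omega> q)"
          by (subst distr_distr) (auto simp: comp_def clock_increments_def q simp del: mult_Suc_right)
        finally show ?thesis .
      qed
      then have law: "distr M borel (\<lambda>\<omega>. clock_increments n k \<omega> q) = distr \<Omega> borel (f n q)"
        if "q \<in> Idx" for q using that by simp
      have "distr M (increment_space) (\<lambda>\<omega>. \<lambda>q\<in>Idx. clock_increments n k \<omega> q) =
          Pi\<^sub>M Idx (\<lambda>q. distr M borel (\<lambda>\<omega>. clock_increments n k \<omega> q))"
        by (rule distr_indep_vars_eq_PiM[OF clock_increments_indep])
      also have "\<dots> = Pi\<^sub>M Idx (\<lambda>q. distr \<Omega> borel (f n q))"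
        by (rule PiM_cong[OF refl law])
      also have "\<dots> = distr ?Q (increment_space) (\<lambda>\<omega>. \<lambda>q\<in>Idx. f n q (\<omega> q))"
        by (rule distr_PiM_coordinatewise[symmetric]) (rule \<Omega> f_meas)+
      finally show ?thesis ..
    qed
    fix x q assume x: "x \<in> space ?Q" and q: "q \<in> Idx"
    then have "x q \<in> space \<Omega>" by (auto simp: space_PiM)
    note block = block_length_tendsto[OF k, of "snd q"]
    have "(\<lambda>n. Zn (r n q) (x q)) \<longlonglongrightarrow> Z (x q)"
      using filterlim_compose[OF lim[OF \<open>x q \<in> space \<Omega>\<close>] block(1)] by (simp add: r_def)
    moreover have "(\<lambda>n. - sqrt (real (r n q) / real n)) \<longlonglongrightarrow> - (1 / sqrt (real k))"
      using tendsto_minus[OF tendsto_real_sqrt[OF block(2)]] by (simp add: r_def real_sqrt_divide)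
    ultimately have "(\<lambda>n. - sqrt (real (r n q) / real n) * Zn (r n q) (x q)) \<longlonglongrightarrow> - (1 / sqrt (real k)) * Z (x q)"
      by (rule tendsto_mult[rotated])
    then show "(\<lambda>n. (\<lambda>q\<in>Idx. f n q (x q)) q) \<longlonglongrightarrow> (\<lambda>q\<in>Idx. g (x q)) q"
      by (simp only: f_def g_def restrict_apply' q)
  qed
qed

end

section \<open>TASEP and the scheme driven by its clocks\<close>

text \<open>\<open>min\<close> and \<open>max\<close> do not expand the supremum distance, so
  clamping is free and errors do not accumulate over levels; only the \<open>j\<close> increments
  contribute.\<close>

lemma clamp_scheme_lipschitz:
  assumes "\<And>p j. p \<in> gt_index N \<Longrightarrow> j < J \<Longrightarrow> \<bar>u (p, j) - v (p, j)\<bar> \<le> e"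
    and "(i, l) \<in> gt_index N" "j \<le> J"
  shows "\<bar>clamp_scheme u l j i - clamp_scheme v l j i\<bar> \<le> real j * e"
  using assms(2,3)
proof (induction l arbitrary: i j)
  case 0
  then show ?case by (simp add: gt_index_def)
next
  case (Suc l)
  note IH = Suc.IH
  from Suc.prems show ?case
  proof (induction j)
    case 0
    then show ?case by simp
  next
    case (Suc j)
    let ?x = "\<lambda>u. clamp_scheme u (Suc l) j i + u ((i, Suc l), j)"
    let ?E = "real (Suc j) * e"
    have x: "\<bar>?x u - ?x v\<bar> \<le> ?E"
      using Suc.IH Suc.prems assms(1)[OF Suc.prems(1), of j] by (simp add: algebra_simps abs_le_iff)
    have up: "\<bar>clamp_scheme u l (Suc j) i - clamp_scheme v l (Suc j) i\<bar> \<le> ?E" if "i < Suc l"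
      using gt_index_parents(2)[OF Suc.prems(1) that] Suc.prems(2) by (intro IH) auto
    have low: "\<bar>clamp_scheme u l (Suc j) (i - 1) - clamp_scheme v l (Suc j) (i - 1)\<bar> \<le> ?E" if "1 < i"
      using gt_index_parents(1)[OF Suc.prems(1) that] Suc.prems(2) by (intro IH) auto
    have lip: "\<bar>min a b - min c d\<bar> \<le> E" "\<bar>max a b - max c d\<bar> \<le> E"
      if "\<bar>a - c\<bar> \<le> E" "\<bar>b - d\<bar> \<le> E" for a b c d E :: real
      using that by (auto simp: min_def max_def abs_le_iff)
    have "\<bar>(if i < Suc l then min (?x u) (clamp_scheme u l (Suc j) i) else ?x u) -
        (if i < Suc l then min (?x v) (clamp_scheme v l (Suc j) i) else ?x v)\<bar> \<le> ?E" (is "\<bar>?x' u - ?x' v\<bar> \<le> _")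
      using lip(1)[OF x up] x by (cases "i < Suc l") simp_all
    then have "1 < i \<Longrightarrow> \<bar>max (?x' u) (clamp_scheme u l (Suc j) (i - 1)) - max (?x' v) (clamp_scheme v l (Suc j) (i - 1))\<bar> \<le> ?E"
      by (rule lip(2)[OF _ low])
    with \<open>\<bar>?x' u - ?x' v\<bar> \<le> ?E\<close> show ?case
      unfolding clamp_scheme.simps Let_def by (cases "1 < i") (simp_all only: if_True if_False)
  qed
qed

text \<open>The Lipschitz bound with \<open>e = 0\<close>.\<close>

lemma scheme_path_cong:
  assumes "\<And>p j. p \<in> gt_index N \<Longrightarrow> u (p, j) = v (p, j)" "p \<in> gt_index N"
  shows "scheme_path u \<delta> t p = scheme_path v \<delta> t p"
  using clamp_scheme_lipschitz[of N "nat \<lfloor>t / \<delta>\<rfloor>" u v 0 "fst p" "snd p" "nat \<lfloor>t / \<delta>\<rfloor>"] assms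
  by (simp add: scheme_path_def)

context multilevel_tasep
begin

definition clock_walk :: "nat \<times> nat \<Rightarrow> 'a \<Rightarrow> nat \<Rightarrow> real" where
  "clock_walk p \<omega> l = (\<Sum>i<l. \<xi> p i \<omega> - 1)"

lemma clock_moments:
  assumes p: "p \<in> gt_index N"
  shows "integrable M (\<lambda>\<omega>. (\<xi> p i \<omega> - 1) ^ q)"
    and "expectation (\<lambda>\<omega>. \<xi> p i \<omega> - 1) = 0"
    and "expectation (\<lambda>\<omega>. (\<xi> p i \<omega> - 1) ^ 2) = 1"
    and "expectation (\<lambda>\<omega>. (\<xi> p i \<omega> - 1) ^ 4) = 9"
proof -
  have int [simp]: "integrable M (\<lambda>\<omega>. \<xi> p i \<omega> ^ q)" for q
    by (rule erlang_ith_moment_integrable[OF _ clock_exponential[OF p]]) simp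
  have moment [simp]: "expectation (\<lambda>\<omega>. \<xi> p i \<omega> ^ q) = fact q" for q
    using erlang_ith_moment[OF _ clock_exponential[OF p, of i], of q] by simp
  have "(\<xi> p i \<omega> - 1) ^ q = (\<Sum>k\<le>q. of_nat (q choose k) * \<xi> p i \<omega> ^ k * (-1) ^ (q - k))" for \<omega> q
    using binomial_ring[of "\<xi> p i \<omega>" "-1" q] by simp
  then show "integrable M (\<lambda>\<omega>. (\<xi> p i \<omega> - 1) ^ q)" by simp
  have int1 [simp]: "integrable M (\<xi> p i)" and moment1 [simp]: "expectation (\<xi> p i) = 1"
    using int[of 1] moment[of 1] by simp_all
  show "expectation (\<lambda>\<omega>. \<xi> p i \<omega> - 1) = 0" by (simp add: prob_space)
  have "(\<xi> p i \<omega> - 1) ^ 2 = \<xi> p i \<omega> ^ 2 - 2 * \<xi> p i \<omega> + 1" for \<omega>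
    by (simp add: power2_eq_square algebra_simps)
  then show "expectation (\<lambda>\<omega>. (\<xi> p i \<omega> - 1) ^ 2) = 1"
    by (simp add: prob_space)
  \<comment> \<open>Exponential moments are factorials:
    \<open>24 - 4 * 6 + 6 * 2 - 4 + 1 = 9\<close>. This makes \<open>9 + 3 = 12\<close> the constant
    of the maximal inequality.\<close>
  have "(\<xi> p i \<omega> - 1) ^ 4 = \<xi> p i \<omega> ^ 4 - 4 * \<xi> p i \<omega> ^ 3 + 6 * \<xi> p i \<omega> ^ 2 - 4 * \<xi> p i \<omega> + 1" for \<omega>
    by (simp add: power4_eq_xxxx power3_eq_cube power2_eq_square algebra_simps)
  then show "expectation (\<lambda>\<omega>. (\<xi> p i \<omega> - 1) ^ 4) = 9"
    by (simp add: prob_space fact_numeral)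
qed

lemma clock_walk_measurable: "p \<in> gt_index N \<Longrightarrow> (\<lambda>\<omega>. clock_walk p \<omega> l) \<in> borel_measurable M"
  unfolding clock_walk_def by (intro borel_measurable_sum borel_measurable_diff \<xi>_measurable) auto

lemma clock_walk_maximal:
  assumes p: "p \<in> gt_index N" and a: "0 < a"
  shows "prob {\<omega>\<in>space M. \<exists>i\<le>r. a \<le> \<bar>clock_walk p \<omega> (b + i) - clock_walk p \<omega> b\<bar>} \<le> 12 * real r ^ 2 / a ^ 4"
proof -
  interpret W: centred_walk M "\<lambda>i \<omega>. \<xi> p (b + i) \<omega> - 1" 9
  proof
    show "indep_vars (\<lambda>_. borel) (\<lambda>i \<omega>. \<xi> p (b + i) \<omega> - 1) UNIV"
      by (rule indep_vars_compose2[OF clock_shift_indep[OF p]]) auto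
  qed (simp_all add: clock_moments[OF p])
  have "W.walk i \<omega> = clock_walk p \<omega> (b + i) - clock_walk p \<omega> b" for i \<omega>
    by (induction i) (simp_all add: W.walk_def clock_walk_def)
  then show ?thesis using W.walk_maximal[OF a, of r] by simp
qed

abbreviation "fluctuation n k p \<omega> j i \<equiv> \<bar>clock_walk p \<omega> (n * j div k + i) - clock_walk p \<omega> (n * j div k)\<bar>"

text \<open>The two extra blocks are the margin by which the count may run ahead of the block of the
  current time, and \<open>n div k + 1\<close> bounds the length of a block. The initial position is
  treated as one more perturbation of size \<open>a\<close>.\<close>

definition regular_event :: "nat \<Rightarrow> real \<Rightarrow> nat \<Rightarrow> nat \<Rightarrow> 'a set" where
  "regular_event m a k n = {\<omega>\<in>space M. \<forall>p\<in>gt_index N.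
     \<bar>real_of_int (Y 0 \<omega> p)\<bar> \<le> a * sqrt (real n) \<and>
     (\<forall>j<m * k + 2. \<forall>i\<le>n div k + 1.
        fluctuation n k p \<omega> j i \<le> a * sqrt (real n))}"

lemma Y_coordinate_measurable:
  assumes "0 \<le> t" "p \<in> gt_index N"
  shows "(\<lambda>\<omega>. real_of_int (Y t \<omega> p)) \<in> borel_measurable M"
proof -
  have "(\<lambda>\<omega>. Y t \<omega> p) \<in> M \<rightarrow>\<^sub>M count_space UNIV"
    by (rule measurable_compose[OF Y_measurable[OF assms(1)] measurable_component_singleton[OF assms(2)]])
  from measurable_compose[OF this, of real_of_int borel] show ?thesis by simp
qed

lemma regular_event_measurable: "regular_event m a k n \<in> events"
proof -
  have [measurable]: "(\<lambda>\<omega>. clock_walk p \<omega> l) \<in> borel_measurable M"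
    "(\<lambda>\<omega>. real_of_int (Y 0 \<omega> p)) \<in> borel_measurable M" if "p \<in> gt_index N" for p l
    using clock_walk_measurable Y_coordinate_measurable that by auto
  show ?thesis
    unfolding regular_event_def
    by (intro sets.sets_Collect_finite_All finite_gt_index sets.sets_Collect_conj) measurable
qed

abbreviation "large_start a n \<equiv> {\<omega>\<in>space M. \<exists>p\<in>gt_index N. a * sqrt (real n) < \<bar>real_of_int (Y 0 \<omega> p)\<bar>}"

text \<open>The initial configuration is one fixed random variable, so continuity from above
  applies; the finite sum of its absolute values shows that the intersection is empty.\<close>

lemma initial_negligible:
  assumes "0 < a"
  shows "(\<lambda>n. prob (large_start a n)) \<longlonglongrightarrow> 0"
proof -
  let ?A = "large_start a"
  have [measurable]: "(\<lambda>\<omega>. real_of_int (Y 0 \<omega> p)) \<in> borel_measurable M" if "p \<in> gt_index N" for p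
    using Y_coordinate_measurable that by auto
  have meas: "range ?A \<subseteq> events"
    by (auto intro!: sets.sets_Collect_finite_Ex finite_gt_index)
  have dec: "decseq ?A"
  proof (rule decseq_SucI)
    fix n
    have *: "a * sqrt (real n) \<le> a * sqrt (real (Suc n))" using assms by simp
    show "?A (Suc n) \<subseteq> ?A n" by (blast intro: le_less_trans[OF *])
  qed
  have empty: "(\<Inter>n. ?A n) = {}"
  proof safe
    fix \<omega> assume *: "\<omega> \<in> (\<Inter>n. ?A n)"
    define K where "K = (\<Sum>p\<in>gt_index N. \<bar>real_of_int (Y 0 \<omega> p)\<bar>)"
    obtain n :: nat where n: "(K / a) ^ 2 \<le> real n" using real_arch_simple by blast
    have K0: "0 \<le> K" by (simp add: K_def sum_nonneg)
    have "K / a \<le> sqrt (real n)" using n K0 assms by (intro real_le_rsqrt) auto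
    then have "K \<le> a * sqrt (real n)" using assms by (simp add: pos_divide_le_eq mult.commute)
    moreover obtain p where p: "p \<in> gt_index N" "a * sqrt (real n) < \<bar>real_of_int (Y 0 \<omega> p)\<bar>"
      using * by blast
    moreover have "\<bar>real_of_int (Y 0 \<omega> p)\<bar> \<le> K"
      unfolding K_def using finite_gt_index p by (intro member_le_sum) auto
    ultimately show "\<omega> \<in> {}" by linarith
  qed
  show ?thesis using finite_Lim_measure_decseq[OF meas dec] unfolding empty by simp
qed

text \<open>Since \<open>n div k + 1\<close> is at most \<open>2 * n / k\<close>, the maximal
  inequality bounds each block by \<open>12 * 4 / (a ^ 4 * k\<^sup>2)\<close>, free of
  \<open>n\<close>. There are at most \<open>(m + 2) * k\<close> blocks per particle, which leaves
  one factor \<open>1 / k\<close>.\<close>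

lemma irregular_prob:
  assumes a: "0 < a" and k: "0 < k" and n: "k \<le> n"
  shows "1 - prob (regular_event m a k n) \<le>
    prob (large_start a n) +
    real (card (gt_index N)) * (48 * real (m + 2) / (a ^ 4 * real k))"
proof -
  let ?A = "large_start a n"
  let ?D = "\<lambda>p j. {\<omega>\<in>space M. \<exists>i\<le>n div k + 1. a * sqrt (real n) \<le>
      fluctuation n k p \<omega> j i}"
  let ?J = "m * k + 2"
  have n0: "0 < n" using k n by simp
  have [measurable]: "(\<lambda>\<omega>. clock_walk p \<omega> l) \<in> borel_measurable M"
    "(\<lambda>\<omega>. real_of_int (Y 0 \<omega> p)) \<in> borel_measurable M" if "p \<in> gt_index N" for p l
    using clock_walk_measurable Y_coordinate_measurable that by auto
  have A: "?A \<in> events" by (auto intro!: sets.sets_Collect_finite_Ex finite_gt_index)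
  have D: "?D p j \<in> events" if "p \<in> gt_index N" for p j using that by measurable
  have "1 - prob (regular_event m a k n) = prob (space M - regular_event m a k n)"
    using prob_compl[OF regular_event_measurable] by simp
  also have "\<dots> \<le> prob (?A \<union> (\<Union>p\<in>gt_index N. \<Union>j\<in>{..<?J}. ?D p j))"
  proof (rule finite_measure_mono)
    show "space M - regular_event m a k n \<subseteq> ?A \<union> (\<Union>p\<in>gt_index N. \<Union>j\<in>{..<?J}. ?D p j)"
    proof (rule subsetI, rule ccontr)
      fix \<omega>
      assume \<omega>: "\<omega> \<in> space M - regular_event m a k n"
        and no: "\<omega> \<notin> ?A \<union> (\<Union>p\<in>gt_index N. \<Union>j\<in>{..<?J}. ?D p j)"
      have "\<bar>real_of_int (Y 0 \<omega> p)\<bar> \<le> a * sqrt (real n)" if "p \<in> gt_index N" for p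
        using no \<omega> that by (auto simp: not_less)
      moreover have "fluctuation n k p \<omega> j i \<le> a * sqrt (real n)"
        if "p \<in> gt_index N" "j < ?J" "i \<le> n div k + 1" for p j i
      proof (rule ccontr)
        assume "\<not> ?thesis"
        then have "\<omega> \<in> ?D p j" using \<omega> that(3) by (blast intro: less_imp_le not_le_imp_less)
        then show False using no that(1,2) by blast
      qed
      ultimately show False using \<omega> by (simp add: regular_event_def)
    qed
    show "?A \<union> (\<Union>p\<in>gt_index N. \<Union>j\<in>{..<?J}. ?D p j) \<in> events"
      using A D finite_gt_index by (intro sets.Un sets.finite_UN) auto
  qed
  also have "\<dots> \<le> prob ?A + prob (\<Union>p\<in>gt_index N. \<Union>j\<in>{..<?J}. ?D p j)"
    using A D finite_gt_index by (intro measure_Un_le sets.finite_UN) auto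
  also have "prob (\<Union>p\<in>gt_index N. \<Union>j\<in>{..<?J}. ?D p j) \<le> (\<Sum>p\<in>gt_index N. prob (\<Union>j\<in>{..<?J}. ?D p j))"
    using D finite_gt_index by (intro finite_measure_subadditive_finite) auto
  also have "\<dots> \<le> (\<Sum>p\<in>gt_index N. 48 * real (m + 2) / (a ^ 4 * real k))"
  proof (rule sum_mono)
    fix p assume p: "p \<in> gt_index N"
    have "real (n div k + 1) \<le> 2 * real n / real k"
    proof -
      have "real (n div k) \<le> real n / real k" by (rule of_nat_div_le_of_nat)
      moreover have "1 \<le> real n / real k" using n k by simp
      ultimately show ?thesis by simp
    qed
    then have "real (n div k + 1) ^ 2 \<le> (2 * real n / real k) ^ 2" by (intro power_mono) auto
    then have block: "12 * real (n div k + 1) ^ 2 / (a * sqrt (real n)) ^ 4 \<le> 48 / (a ^ 4 * real k ^ 2)"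
    proof -
      have "(sqrt (real n)) ^ 4 = real n ^ 2" using real_sqrt_pow2[of "real n"] by (simp add: power4_eq_xxxx power2_eq_square)
      then have "12 * real (n div k + 1) ^ 2 / (a * sqrt (real n)) ^ 4 \<le> 12 * (2 * real n / real k) ^ 2 / (a ^ 4 * real n ^ 2)"
        using \<open>real (n div k + 1) ^ 2 \<le> _\<close> a by (simp only: power_mult_distrib) (intro divide_right_mono mult_left_mono; simp)
      also have "\<dots> = 48 / (a ^ 4 * real k ^ 2)" using n0 k a by (simp add: power_divide power_mult_distrib)
      finally show ?thesis .
    qed
    have "prob (\<Union>j\<in>{..<?J}. ?D p j) \<le> (\<Sum>j<?J. prob (?D p j))"
      by (rule finite_measure_subadditive_finite) (use D[OF p] in blast)+
    also have "\<dots> \<le> (\<Sum>j<?J. 48 / (a ^ 4 * real k ^ 2))"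
      by (intro sum_mono order_trans[OF clock_walk_maximal[OF p] block]) (use a n0 in simp)
    also have "\<dots> = real ?J * (48 / (a ^ 4 * real k ^ 2))" by simp
    also have "\<dots> \<le> (real (m + 2) * real k) * (48 / (a ^ 4 * real k ^ 2))"
    proof (rule mult_right_mono)
      have "?J \<le> (m + 2) * k" using k by (simp add: algebra_simps)
      then show "real ?J \<le> real (m + 2) * real k" unfolding of_nat_mult[symmetric] of_nat_le_iff .
    qed (use a in simp)
    also have "\<dots> = 48 * real (m + 2) / (a ^ 4 * real k)" using k a by (simp add: power2_eq_square field_simps)
    finally show "prob (\<Union>j\<in>{..<?J}. ?D p j) \<le> 48 * real (m + 2) / (a ^ 4 * real k)" .
  qed
  also have "\<dots> = real (card (gt_index N)) * (48 * real (m + 2) / (a ^ 4 * real k))" by simp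
  finally show ?thesis by simp
qed

end

lemma cadlag_at_right:
  assumes "x \<in> cadlag I" "p \<in> I" "0 \<le> t"
  shows "((\<lambda>s. x s p) \<longlongrightarrow> x t p) (at_right t)"
  using assms by (simp add: cadlag_def)

lemma sqrt_real_at_top: "filterlim (\<lambda>n. sqrt (real n)) at_top sequentially"
  by (rule filterlim_compose[OF sqrt_at_top filterlim_real_sequentially])

lemma eventually_sqrt_less_div:
  fixes k :: nat
  assumes k: "0 < k"
  shows "\<forall>\<^sub>F n in sequentially. c * sqrt (real n) + 1 < real (n div k)"
proof -
  \<comment> \<open>The surplus 3 pays for the rounding in \<open>n div k\<close> and for the
    additional 1, each at most \<open>sqrt n\<close>.\<close>
  have "\<forall>\<^sub>F n in sequentially. max 1 (real k * (c + 3)) \<le> sqrt (real n)"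
    using sqrt_real_at_top unfolding filterlim_at_top by blast
  then show ?thesis
  proof eventually_elim
    case (elim n)
    then have one: "1 \<le> sqrt (real n)" and "real k * (c + 3) \<le> sqrt (real n)" by (simp_all only: max.bounded_iff)
    then have "c + 3 \<le> sqrt (real n) / real k" using k by (simp add: pos_le_divide_eq mult.commute)
    then have "sqrt (real n) * (c + 3) \<le> sqrt (real n) * (sqrt (real n) / real k)"
      by (rule mult_left_mono) simp
    also have "\<dots> = real n / real k" by simp
    finally have "c * sqrt (real n) + 3 * sqrt (real n) \<le> real n / real k" by (simp add: algebra_simps)
    moreover have "real n / real k < real (n div k) + 1"
      using floor_divide_of_nat_eq[of n k, where ?'a = real] by linarith
    ultimately show ?case using one by linarith
  qed
qed

section \<open>Closeness of rescaled TASEP to its scheme\<close>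

context multilevel_tasep
begin

abbreviation "scaled n t \<omega> p \<equiv> (real_of_int (Y (real n * t) \<omega> p) - t * real n) / sqrt (real n)"

abbreviation "discrepancy n k t \<omega> p \<equiv> \<bar>scaled n t \<omega> p - scheme_path (clock_increments n k \<omega>) (1 / real k) t p\<bar>"

lemma clocks_positive: "AE \<omega> in M. \<forall>p\<in>gt_index N. \<forall>i. 0 < \<xi> p i \<omega>"
proof -
  have "AE \<omega> in M. 0 < \<xi> p i \<omega>" if p: "p \<in> gt_index N" for p i
  proof -
    have "prob {\<omega>\<in>space M. 0 < \<xi> p i \<omega>} = 1"
      using exponential_distributedD_gt[OF clock_exponential[OF p], of 0] by simp
    from AE_prob_1[OF this] show ?thesis by eventually_elim simp
  qed
  then have "\<forall>p\<in>gt_index N. AE \<omega> in M. \<forall>i. 0 < \<xi> p i \<omega>" by (simp add: AE_all_countable)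
  then show ?thesis by (intro AE_finite_allI finite_gt_index) auto
qed

lemma step_driver_clock:
  "step_driver (clock_increments n k \<omega>) \<delta> t p = - clock_walk p \<omega> (n * nat \<lfloor>t / \<delta>\<rfloor> div k) / sqrt (real n)"
proof -
  have "(\<Sum>j<J. clock_increments n k \<omega> (p, j)) = - clock_walk p \<omega> (n * J div k) / sqrt (real n)" for J
  proof (induction J)
    case 0
    then show ?case by (simp add: clock_walk_def)
  next
    case (Suc J)
    have le: "n * J div k \<le> n * Suc J div k" by (intro div_le_mono) simp
    have "clock_walk p \<omega> (n * Suc J div k) =
        clock_walk p \<omega> (n * J div k) + (\<Sum>i\<in>{n * J div k..<n * Suc J div k}. \<xi> p i \<omega> - 1)"
      using sum.atLeastLessThan_concat[OF _ le, of 0 "\<lambda>i. \<xi> p i \<omega> - 1"]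
      by (simp add: clock_walk_def atLeast0LessThan del: mult_Suc_right)
    then show ?case using Suc
      by (simp add: clock_increments_def add_divide_distrib diff_divide_distrib del: mult_Suc_right)
  qed
  then show ?thesis by (simp add: step_driver_def)
qed

lemma regular_close:
  assumes \<omega>: "\<omega> \<in> regular_event m a k n"
    and pos: "\<forall>p\<in>gt_index N. \<forall>i. 0 < \<xi> p i \<omega>"
    and dyn: "\<forall>t>0. \<exists>z. (\<forall>\<^sub>F s in at_left t. Y s \<omega> = z) \<and>
         ((\<forall>p\<in>gt_index N. t \<notin> ring_times \<xi> \<omega> p) \<longrightarrow> Y t \<omega> = z) \<and>
         (\<forall>p\<in>gt_index N. t \<in> ring_times \<xi> \<omega> p \<longrightarrow> Y t \<omega> = tasep_jump N p z)"
    and k: "0 < k" and n: "0 < n" and a: "0 \<le> a"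
    and large: "real (m * k + 2) * a * sqrt (real n) + 1 < real (n div k)"
    and t: "t \<in> {0..real m}" and p: "p \<in> gt_index N"
  shows "discrepancy n k t \<omega> p \<le> real N * (6 * a + 4 / sqrt (real n))"
proof -
  define c where "c = sqrt (real n)"
  have c: "0 < c" using n by (simp add: c_def)
  define T where "T = real n * real m"
  define \<delta> where "\<delta> = real n / real k"
  have \<delta>: "0 < \<delta>" using n k by (simp add: \<delta>_def)
  define S where "S p i = (\<Sum>j\<le>i. \<xi> p j \<omega>)" for p i
  let ?u = "clock_increments n k \<omega>"
  let ?y = "\<lambda>t p. (real_of_int (Y t \<omega> p) - t) / c"
  let ?\<beta> = "\<lambda>t p. (real (arrivals (S p) t) - t) / c"
  have sp: "\<omega> \<in> space M" using \<omega> by (simp add: regular_event_def)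
  have close: "strict_mono (S p)" "\<exists>i. t < S p i"
      "\<bar>real (arrivals (S p) t) - t + clock_walk p \<omega> (n * nat \<lfloor>t / \<delta>\<rfloor> div k)\<bar> \<le> 2 * (a * c) + 1"
    if "p \<in> gt_index N" "t \<in> {0..T}" for p t
    unfolding S_def clock_walk_def \<delta>_def
    using \<omega> that pos large
    by (intro arrivals_close[OF _ k n, where m = m and a = "a * c"];
        force simp: regular_event_def clock_walk_def T_def c_def mult.assoc)+
  have Y_right: "((\<lambda>s. real_of_int (Y s \<omega> p)) \<longlongrightarrow> real_of_int (Y t \<omega> p)) (at_right t)"
    if "p \<in> gt_index N" "0 \<le> t" for p t
  proof -
    have ev: "\<forall>\<^sub>F s in at_right t. 0 \<le> s"
      using eventually_at_right_less[of t] by eventually_elim (use that(2) in auto)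
    from cadlag_at_right[OF Y_cadlag[OF sp] that] that
    have "((\<lambda>s. (\<lambda>t\<in>{0..}. \<lambda>p\<in>gt_index N. real_of_int (Y t \<omega> p)) s p) \<longlongrightarrow> real_of_int (Y t \<omega> p)) (at_right t)"
      by simp
    then show ?thesis
      by (rule Lim_transform_eventually) (use ev that in \<open>auto elim!: eventually_mono\<close>)
  qed
  have Y: "reflected_system N (1 / c) T ?y ?\<beta>"
  proof (rule tasep_reflected)
    have T0: "T \<in> {0..T}" by (simp add: T_def)
    show "strict_mono (S p) \<and> (\<exists>m. T < S p m)" if "p \<in> gt_index N" for p
      using close(1,2)[OF that T0] by simp
    show "Y t \<omega> \<in> GT N" if "0 \<le> t" for t using Y_in_GT[OF that sp] .
    have rings: "ring_times \<xi> \<omega> p = range (S p)" for p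
      by (auto simp: ring_times_def S_def image_def)
    show "\<exists>z. (\<forall>\<^sub>F s in at_left t. Y s \<omega> = z) \<and> ((\<forall>p\<in>gt_index N. t \<notin> range (S p)) \<longrightarrow> Y t \<omega> = z) \<and>
       (\<forall>p\<in>gt_index N. t \<in> range (S p) \<longrightarrow> Y t \<omega> = tasep_jump N p z)" if "0 < t" for t
      using dyn[rule_format, OF that] unfolding rings .
    show "((\<lambda>s. real_of_int (Y s \<omega> p)) \<longlongrightarrow> real_of_int (Y t \<omega> p)) (at_right t)"
      if "p \<in> gt_index N" "0 \<le> t" for p t
      using that by (rule Y_right)
  qed (rule c)
  have W: "reflected_system N (1 / c) T (scheme_path ?u \<delta>) (step_driver ?u \<delta>)"
    by (rule scheme_path_reflected) (use \<delta> c in auto)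
  \<comment> \<open>The slack \<open>1 / c\<close> is the rescaled lattice spacing, and
    \<open>2 * a + 1 / c\<close> is the bound from \<open>arrivals_close\<close> divided by
    \<open>c\<close>. Together they give \<open>6 * a + 4 / c\<close> per level.\<close>
  have "\<bar>?y s p - scheme_path ?u \<delta> s p\<bar> \<le> real N * (1 / c + 3 * (2 * a + 1 / c))" if s: "s \<in> {0..T}" for s
  proof (rule reflected_system_stable[OF Y W _ _ _ _ p s])
    show "0 \<le> 1 / c" using c by simp
    show "\<bar>?y 0 p - scheme_path ?u \<delta> 0 p\<bar> \<le> 2 * a + 1 / c" if "p \<in> gt_index N" for p
    proof -
      have "\<bar>real_of_int (Y 0 \<omega> p)\<bar> \<le> a * c" using \<omega> that by (simp add: regular_event_def c_def)
      then have "\<bar>?y 0 p\<bar> \<le> a" using c by (simp add: pos_divide_le_eq)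
      moreover have "0 < 1 / c" using c by simp
      ultimately show ?thesis using a by (simp add: scheme_path_def del: zero_less_divide_1_iff)
    qed
    show "\<bar>?\<beta> t p - step_driver ?u \<delta> t p\<bar> \<le> 2 * a + 1 / c" if pt: "p \<in> gt_index N" "t \<in> {0..T}" for p t
    proof -
      have "?\<beta> t p - step_driver ?u \<delta> t p =
          (real (arrivals (S p) t) - t + clock_walk p \<omega> (n * nat \<lfloor>t / \<delta>\<rfloor> div k)) / c"
        by (simp add: step_driver_clock c_def add_divide_distrib diff_divide_distrib)
      also have "\<bar>\<dots>\<bar> \<le> (2 * (a * c) + 1) / c"
        using close(3)[OF pt] c by (simp add: divide_right_mono)
      also have "\<dots> = 2 * a + 1 / c" using c by (simp add: add_divide_distrib)
      finally show ?thesis .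
    qed
    show "((\<lambda>s. ?y s p - scheme_path ?u \<delta> s p) \<longlongrightarrow> ?y t p - scheme_path ?u \<delta> t p) (at_right t)"
      if "p \<in> gt_index N" "0 \<le> t" "t < T" for p t
    proof (intro tendsto_diff)
      show "((\<lambda>s. ?y s p) \<longlongrightarrow> ?y t p) (at_right t)"
        using c Y_right[OF that(1,2)] by (intro tendsto_divide tendsto_diff tendsto_ident_at tendsto_const) auto
      show "((\<lambda>s. scheme_path ?u \<delta> s p) \<longlongrightarrow> scheme_path ?u \<delta> t p) (at_right t)"
        by (rule tendsto_eventually, rule eventually_mono[OF scheme_path_at_right[OF \<delta>, of ?u]]) simp
    qed
  qed
  moreover have "real n * t \<in> {0..T}" using t by (auto simp: T_def intro: mult_left_mono)
  \<comment> \<open>The comparison is made in unscaled time with mesh \<open>n / k\<close>; the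
    factor \<open>n\<close> cancels in the quotient of time by mesh.\<close>
  moreover have "scheme_path ?u \<delta> (real n * t) p = scheme_path ?u (1 / real k) t p"
    using n k by (simp add: scheme_path_def \<delta>_def mult.commute)
  ultimately have "\<bar>?y (real n * t) p - scheme_path ?u (1 / real k) t p\<bar> \<le> real N * (1 / c + 3 * (2 * a + 1 / c))"
    by metis
  also have "real N * (1 / c + 3 * (2 * a + 1 / c)) = real N * (6 * a + 4 / c)" by (simp add: algebra_simps)
  finally show ?thesis by (simp add: c_def mult.commute)
qed

proposition tasep_scheme_close:
  assumes \<eta>: "0 < \<eta>" and \<epsilon>: "0 < \<epsilon>"
  shows "\<forall>\<^sub>F k in sequentially. \<forall>\<^sub>F n in sequentially. \<exists>E\<in>events. 1 - \<epsilon> \<le> prob E \<and>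
    (AE \<omega> in M. \<omega> \<in> E \<longrightarrow> (\<forall>t\<in>{0..real m}. \<forall>p\<in>gt_index N.
      discrepancy n k t \<omega> p < \<eta>))"
proof -
  \<comment> \<open>Half of \<eta> pays for \<open>6 * a\<close> on each level and half for
    \<open>4 / sqrt n\<close>; \<open>N + 1\<close> keeps the quotient defined for
    \<open>N = 0\<close>.\<close>
  define a where "a = \<eta> / (12 * (real N + 1))"
  have a: "0 < a" using \<eta> by (simp add: a_def)
  have Na: "real N * (6 * a) \<le> \<eta> / 2"
  proof -
    have "real N * (6 * a) \<le> (real N + 1) * (6 * a)" using a by (intro mult_right_mono) auto
    also have "\<dots> = \<eta> / 2" by (simp add: a_def field_simps)
    finally show ?thesis .
  qed
  let ?K = "real (card (gt_index N)) * (48 * real (m + 2) / a ^ 4)"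
  \<comment> \<open>\<open>?K / k\<close> bounds the exceptional probability of all blocks uniformly
    in \<open>n \<ge> k\<close>, so \<open>k\<close> can be fixed first and the initial condition
    removed afterwards by \<open>n\<close>.\<close>
  have "(\<lambda>k. ?K / real k) \<longlonglongrightarrow> 0" by (rule lim_const_over_n)
  then have "\<forall>\<^sub>F k in sequentially. ?K / real k < \<epsilon> / 2" using \<epsilon> by (intro order_tendstoD(2)) auto
  with eventually_gt_at_top[of 0] show ?thesis
  proof eventually_elim
    case (elim k)
    then have k: "0 < k" by simp
    have "\<forall>\<^sub>F n in sequentially. prob (large_start a n) < \<epsilon> / 2"
      using \<epsilon> by (intro order_tendstoD(2)[OF initial_negligible[OF a]]) simp
    moreover have "(\<lambda>n. real N * (4 / sqrt (real n))) \<longlonglongrightarrow> real N * 0"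
      by (intro tendsto_mult tendsto_const tendsto_divide_0[OF tendsto_const]
          filterlim_at_top_imp_at_infinity sqrt_real_at_top)
    then have "\<forall>\<^sub>F n in sequentially. real N * (4 / sqrt (real n)) < \<eta> / 2"
      using \<eta> by (intro order_tendstoD(2)) auto
    ultimately show ?case
      using eventually_gt_at_top[of 0] eventually_ge_at_top[of k] eventually_sqrt_less_div[OF k, of "real (m * k + 2) * a"]
    proof eventually_elim
      case (elim n)
      show ?case
      proof (intro bexI conjI)
        show "regular_event m a k n \<in> events" by (rule regular_event_measurable)
        have "1 - prob (regular_event m a k n) \<le> \<epsilon> / 2 + ?K / real k"
          using irregular_prob[OF a k elim(4), of m] elim(1) by (simp add: mult.assoc)
        then show "1 - \<epsilon> \<le> prob (regular_event m a k n)" using \<open>?K / real k < \<epsilon> / 2\<close> by linarith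
        show "AE \<omega> in M. \<omega> \<in> regular_event m a k n \<longrightarrow> (\<forall>t\<in>{0..real m}. \<forall>p\<in>gt_index N.
          discrepancy n k t \<omega> p < \<eta>)"
          using clocks_positive dynamics
        proof eventually_elim
          case (elim \<omega>)
          show ?case
          proof (intro impI ballI)
            fix t p assume "\<omega> \<in> regular_event m a k n" "t \<in> {0..real m}" "p \<in> gt_index N"
            from regular_close[OF this(1) elim k \<open>0 < n\<close> _ \<open>real (m * k + 2) * a * sqrt (real n) + 1 < real (n div k)\<close> this(2,3)] a
            have "discrepancy n k t \<omega> p \<le> real N * (6 * a + 4 / sqrt (real n))" by simp
            also have "\<dots> = real N * (6 * a) + real N * (4 / sqrt (real n))" by (simp only: distrib_left)
            also have "\<dots> < \<eta>" using Na \<open>real N * (4 / sqrt (real n)) < \<eta> / 2\<close> by linarith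
            finally show "discrepancy n k t \<omega> p < \<eta>" .
          qed
        qed
      qed
    qed
  qed
qed

end

section \<open>Convergence of laws on the path space\<close>

lemma tendsto_product_coordinatewise:
  fixes f :: "'c \<Rightarrow> 'i \<Rightarrow> real"
  assumes "\<And>i. ((\<lambda>x. f x i) \<longlongrightarrow> l i) F"
  shows "(f \<longlongrightarrow> l) F"
proof -
  have "limitin (product_topology (\<lambda>_. euclidean) UNIV) f l F"
    using assms by (simp add: limitin_componentwise)
  then show ?thesis by (simp add: euclidean_product_topology)
qed

lemma open_finite_box:
  fixes v :: "'i \<Rightarrow> real"
  assumes "finite F"
  shows "open {u. \<forall>q\<in>F. \<bar>u q - v q\<bar> < e}"
proof -
  have "open {u :: 'i \<Rightarrow> real. \<bar>u q - v q\<bar> < e}" for q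
    by (intro open_Collect_less continuous_intros) simp
  then have "open (\<Inter>q\<in>F. {u. \<bar>u q - v q\<bar> < e})" using assms by (intro open_INT) auto
  moreover have "(\<Inter>q\<in>F. {u. \<bar>u q - v q\<bar> < e}) = {u. \<forall>q\<in>F. \<bar>u q - v q\<bar> < e}" by auto
  ultimately show ?thesis by simp
qed

text \<open>Sets open in the product topology on all functions have to be events of the product
  \<sigma>-algebra over \<open>A\<close>. Countability of the index type makes coordinates
  sufficient, and coordinates outside \<open>A\<close> are constantly
  \<open>undefined\<close>.\<close>

lemma id_measurable_PiM_borel:
  "(\<lambda>u. u) \<in> Pi\<^sub>M A (\<lambda>_. borel :: real measure) \<rightarrow>\<^sub>M (borel :: ('i::countable \<Rightarrow> real) measure)"
proof (rule measurable_coordinatewise_then_product)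
  fix i
  show "(\<lambda>u. u i) \<in> borel_measurable (Pi\<^sub>M A (\<lambda>_. borel :: real measure))"
  proof (cases "i \<in> A")
    case False
    then have "(\<lambda>u. u i) \<in> borel_measurable (Pi\<^sub>M A (\<lambda>_. borel :: real measure)) \<longleftrightarrow>
        (\<lambda>u. undefined :: real) \<in> borel_measurable (Pi\<^sub>M A (\<lambda>_. borel :: real measure))"
      by (intro measurable_cong) (auto simp: space_PiM PiE_def extensional_def)
    then show ?thesis by simp
  qed simp
qed

lemma path_measurable:
  assumes "\<And>\<omega>. \<omega> \<in> space M \<Longrightarrow> (\<lambda>t\<in>{0..}. X t \<omega>) \<in> cadlag I"
    and "\<And>t. 0 \<le> t \<Longrightarrow> X t \<in> M \<rightarrow>\<^sub>M Pi\<^sub>M I (\<lambda>_. borel)"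
  shows "(\<lambda>\<omega>. \<lambda>t\<in>{0..}. X t \<omega>) \<in> M \<rightarrow>\<^sub>M path_algebra I"
  unfolding path_algebra_def
  by (rule measurable_restrict_space2) (use assms in \<open>auto intro!: measurable_restrict\<close>)

section \<open>Uniform neighbourhoods and curves of the scheme\<close>

definition near :: "'p set \<Rightarrow> nat \<Rightarrow> real \<Rightarrow> (real \<Rightarrow> 'p \<Rightarrow> real) \<Rightarrow> (real \<Rightarrow> 'p \<Rightarrow> real) \<Rightarrow> bool" where
  "near I m \<eta> x y \<longleftrightarrow> (\<forall>t\<in>{0..real m}. \<forall>p\<in>I. \<bar>y t p - x t p\<bar> < \<eta>)"

lemma near_trans:
  assumes "near I m \<eta> x y" "near I m \<eta>' y z"
  shows "near I m (\<eta> + \<eta>') x z"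
  unfolding near_def
proof (intro ballI)
  fix t p assume "t \<in> {0..real m}" "p \<in> I"
  then have "\<bar>y t p - x t p\<bar> < \<eta>" "\<bar>z t p - y t p\<bar> < \<eta>'" using assms by (auto simp: near_def)
  then show "\<bar>z t p - x t p\<bar> < \<eta> + \<eta>'" by linarith
qed

lemma near_weaken: "near I m \<eta> x y \<Longrightarrow> m' \<le> m \<Longrightarrow> \<eta> \<le> \<eta>' \<Longrightarrow> near I m' \<eta>' x y"
  unfolding near_def
proof (intro ballI)
  fix t p assume "\<forall>t\<in>{0..real m}. \<forall>p\<in>I. \<bar>y t p - x t p\<bar> < \<eta>" "m' \<le> m" "\<eta> \<le> \<eta>'" "t \<in> {0..real m'}" "p \<in> I"
  moreover from this have "t \<in> {0..real m}" by auto
  ultimately show "\<bar>y t p - x t p\<bar> < \<eta>'" by (blast intro: order.strict_trans2)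
qed

text \<open>A single number \<open>m\<close> encodes horizon and precision, so that neighbourhoods
  shrink with \<open>m\<close>. This later turns the choice of a neighbourhood into a countable
  increasing union of events.\<close>

lemma ucc_continuousD:
  assumes f: "continuous_map (ucc_topology I) euclideanreal f" and x: "x \<in> cadlag I" and \<epsilon>: "0 < \<epsilon>"
  obtains m where "\<And>y. y \<in> cadlag I \<Longrightarrow> near I m (1 / real (Suc m)) x y \<Longrightarrow> \<bar>f y - f x\<bar> < \<epsilon>"
proof -
  have "openin (ucc_topology I) (cadlag I)"
    unfolding openin_ucc_topology by (auto intro!: exI[of _ 0] exI[of _ 1])
  then have top: "topspace (ucc_topology I) = cadlag I"
    by (auto simp: openin_ucc_topology topspace_def)
  let ?U = "{y \<in> cadlag I. f y \<in> ball (f x) \<epsilon>}"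
  have open_U: "openin (ucc_topology I) ?U"
    using openin_continuous_map_preimage[OF f, of "ball (f x) \<epsilon>"] by (simp add: top)
  have "x \<in> ?U" using x \<epsilon> by simp
  then have "\<exists>T\<ge>0. \<exists>\<eta>>0. \<forall>y\<in>cadlag I. (\<forall>t\<in>{0..T}. \<forall>p\<in>I. \<bar>y t p - x t p\<bar> < \<eta>) \<longrightarrow> y \<in> ?U"
    by (rule bspec[OF open_U[unfolded openin_ucc_topology, THEN conjunct2]])
  then obtain T \<eta> where "0 \<le> T" "0 < \<eta>"
    and U: "\<forall>y\<in>cadlag I. (\<forall>t\<in>{0..T}. \<forall>p\<in>I. \<bar>y t p - x t p\<bar> < \<eta>) \<longrightarrow> y \<in> ?U"
    by (elim exE conjE) (rule that)
  obtain m1 where m1: "T \<le> real m1" using real_arch_simple by blast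
  obtain m2 where m2: "1 / real (Suc m2) < \<eta>" using \<open>0 < \<eta>\<close> nat_approx_posE by blast
  define m where "m = max m1 m2"
  have "1 / real (Suc m) \<le> 1 / real (Suc m2)" by (intro divide_left_mono) (auto simp: m_def)
  then have m: "1 / real (Suc m) < \<eta>" "T \<le> real m" using m1 m2 by (auto simp: m_def)
  show ?thesis
  proof (rule that)
    fix y assume y: "y \<in> cadlag I" "near I m (1 / real (Suc m)) x y"
    have "\<bar>y t p - x t p\<bar> < \<eta>" if "t \<in> {0..T}" "p \<in> I" for t p
    proof -
      have "\<bar>y t p - x t p\<bar> < 1 / real (Suc m)" using y(2) that m(2) by (simp add: near_def)
      then show ?thesis using m(1) by linarith
    qed
    then have "y \<in> ?U" using bspec[OF U y(1)] by blast
    then show "\<bar>f y - f x\<bar> < \<epsilon>" by (simp add: dist_real_def abs_minus_commute)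
  qed
qed

definition scheme_curve :: "nat \<Rightarrow> nat \<Rightarrow> ((nat \<times> nat) \<times> nat \<Rightarrow> real) \<Rightarrow> real \<Rightarrow> nat \<times> nat \<Rightarrow> real" where
  "scheme_curve N k u = (\<lambda>t\<in>{0..}. \<lambda>p\<in>gt_index N. scheme_path u (1 / real k) t p)"

lemma scheme_curve_restrict:
  "scheme_curve N k (\<lambda>q\<in>gt_index N \<times> UNIV. u q) = scheme_curve N k u"
  by (auto simp: scheme_curve_def intro!: restrict_ext scheme_path_cong)

lemma scheme_curve_cadlag:
  assumes k: "0 < k"
  shows "scheme_curve N k u \<in> cadlag (gt_index N)"
proof -
  have \<delta>: "0 < 1 / real k" using k by simp
  have right: "((\<lambda>s. scheme_curve N k u s p) \<longlongrightarrow> scheme_curve N k u t p) (at_right t)"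
    if "p \<in> gt_index N" "0 \<le> t" for p t
  proof (rule tendsto_eventually)
    show "\<forall>\<^sub>F s in at_right t. scheme_curve N k u s p = scheme_curve N k u t p"
      using scheme_path_at_right[OF \<delta>, of u t] eventually_at_right_less[of t]
      by eventually_elim (use that in \<open>simp add: scheme_curve_def\<close>)
  qed
  have left: "\<exists>l. ((\<lambda>s. scheme_curve N k u s p) \<longlongrightarrow> l) (at_left t)" if p: "p \<in> gt_index N" and t: "0 < t" for p t
  proof -
    obtain j where "\<forall>\<^sub>F s in at_left t. \<forall>p. scheme_path u (1 / real k) s p = clamp_scheme u (snd p) j (fst p) \<and>
       step_driver u (1 / real k) s p = (\<Sum>j'<j. u (p, j'))"
      by (rule scheme_path_at_left[OF \<delta> t])
    moreover have "\<forall>\<^sub>F s in at_left t. s \<in> {0<..<t}"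
      using t by (auto simp: eventually_at_left_field intro!: exI[of _ 0])
    ultimately have "\<forall>\<^sub>F s in at_left t. scheme_curve N k u s p = clamp_scheme u (snd p) j (fst p)"
    proof eventually_elim
      case (elim s)
      have "scheme_path u (1 / real k) s p = clamp_scheme u (snd p) j (fst p)" using elim(1) by blast
      then show ?case using p elim(2) by (simp add: scheme_curve_def)
    qed
    then show ?thesis by (intro exI tendsto_eventually)
  qed
  show ?thesis
    unfolding cadlag_def using left right by (auto simp: scheme_curve_def)
qed

lemma clamp_scheme_measurable:
  assumes "(i, l) \<in> gt_index N"
  shows "(\<lambda>u. clamp_scheme u l j i) \<in> borel_measurable (Pi\<^sub>M (gt_index N \<times> UNIV) (\<lambda>_. borel))"
  using assms
proof (induction l arbitrary: i j)
  case 0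
  then show ?case by simp
next
  case (Suc l)
  note IH = Suc.IH
  from Suc.prems show ?case
  proof (induction j)
    case 0
    then show ?case by simp
  next
    case (Suc j)
    let ?P = "Pi\<^sub>M (gt_index N \<times> UNIV) (\<lambda>_. borel :: real measure)"
    have x: "(\<lambda>u. clamp_scheme u (Suc l) j i + u ((i, Suc l), j)) \<in> borel_measurable ?P"
      using Suc by (intro borel_measurable_add Suc.IH measurable_component_singleton) auto
    have up: "(\<lambda>u. clamp_scheme u l (Suc j) i) \<in> borel_measurable ?P" if "i < Suc l"
      using gt_index_parents(2)[OF Suc.prems that] by (intro IH) simp
    have low: "(\<lambda>u. clamp_scheme u l (Suc j) (i - 1)) \<in> borel_measurable ?P" if "1 < i"
      using gt_index_parents(1)[OF Suc.prems that] by (intro IH) simp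
    have x': "(\<lambda>u. if i < Suc l then min (clamp_scheme u (Suc l) j i + u ((i, Suc l), j)) (clamp_scheme u l (Suc j) i)
        else clamp_scheme u (Suc l) j i + u ((i, Suc l), j)) \<in> borel_measurable ?P"
      using x up by (cases "i < Suc l") (simp_all only: if_True if_False borel_measurable_min)
    show ?case
      unfolding clamp_scheme.simps Let_def
      using x' low by (cases "1 < i") (simp_all only: if_True if_False borel_measurable_max)
  qed
qed

lemma scheme_curve_measurable:
  assumes "0 < k"
  shows "scheme_curve N k \<in> Pi\<^sub>M (gt_index N \<times> UNIV) (\<lambda>_. borel) \<rightarrow>\<^sub>M path_algebra (gt_index N)"
  unfolding scheme_curve_def[abs_def]
proof (rule path_measurable)
  show "(\<lambda>t\<in>{0..}. \<lambda>p\<in>gt_index N. scheme_path u (1 / real k) t p) \<in> cadlag (gt_index N)" for u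
    using scheme_curve_cadlag[OF assms, of N u] by (simp only: scheme_curve_def)
  show "(\<lambda>u. \<lambda>p\<in>gt_index N. scheme_path u (1 / real k) t p) \<in>
      Pi\<^sub>M (gt_index N \<times> UNIV) (\<lambda>_. borel) \<rightarrow>\<^sub>M Pi\<^sub>M (gt_index N) (\<lambda>_. borel)" for t
    unfolding scheme_path_def by (intro measurable_restrict clamp_scheme_measurable) simp
qed

lemma scheme_curve_near:
  assumes k: "0 < k" and \<eta>: "0 < \<eta>"
  obtains e J where "0 < e"
    "\<And>u v. (\<forall>q\<in>gt_index N \<times> {..<J}. \<bar>u q - v q\<bar> < e) \<Longrightarrow> near (gt_index N) m \<eta> (scheme_curve N k v) (scheme_curve N k u)"
proof (rule that[of "\<eta> / (real (m * k) + 1)" "m * k"])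
  \<comment> \<open>The horizon \<open>m\<close> contains \<open>m * k\<close> steps, over which the
    Lipschitz bound accumulates; the \<open>+ 1\<close> makes the final inequality strict.\<close>
  let ?e = "\<eta> / (real (m * k) + 1)"
  show e: "0 < ?e" by (rule divide_pos_pos[OF \<eta>]) linarith
  fix u v :: "(nat \<times> nat) \<times> nat \<Rightarrow> real"
  assume uv: "\<forall>q\<in>gt_index N \<times> {..<m * k}. \<bar>u q - v q\<bar> < ?e"
  show "near (gt_index N) m \<eta> (scheme_curve N k v) (scheme_curve N k u)"
    unfolding near_def
  proof (intro ballI)
    fix t p assume t: "t \<in> {0..real m}" and p: "p \<in> gt_index N"
    let ?j = "nat \<lfloor>t / (1 / real k)\<rfloor>"
    have "t * real k \<le> real m * real k" using t by (intro mult_right_mono) auto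
    then have "t * real k \<le> real (m * k)" by simp
    then have "\<lfloor>t * real k\<rfloor> \<le> int (m * k)" by linarith
    then have j: "?j \<le> m * k" by (simp add: nat_le_iff)
    have "\<bar>clamp_scheme u (snd p) ?j (fst p) - clamp_scheme v (snd p) ?j (fst p)\<bar> \<le> real ?j * ?e"
      by (rule clamp_scheme_lipschitz[where J = "m * k" and N = N]) (use uv p j in \<open>auto intro: less_imp_le\<close>)
    also have "\<dots> \<le> real (m * k) * ?e" using j e by (intro mult_right_mono) linarith+
    also have "\<dots> < (real (m * k) + 1) * ?e" using e by (intro mult_strict_right_mono) auto
    also have "\<dots> = \<eta>"
    proof -
      have "real (m * k) + 1 \<noteq> 0" by linarith
      then show ?thesis by simp
    qed
    finally show "\<bar>scheme_curve N k u t p - scheme_curve N k v t p\<bar> < \<eta>"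
      using t p by (simp add: scheme_curve_def scheme_path_def)
  qed
qed

section \<open>Convergence of the scheme to reflected Brownian motions\<close>

context reflected_interlacing_bm
begin

lemma step_driver_grid:
  "step_driver (grid_increments k b) \<delta> t p = b p (real (nat \<lfloor>t / \<delta>\<rfloor>) / real k) - b p 0"
proof -
  have "(\<Sum>j<J. grid_increments k b (p, j)) = b p (real J / real k) - b p 0" for J
    by (induction J) (simp_all add: grid_increments_def)
  then show ?thesis by (simp add: step_driver_def)
qed

lemma grid_driver_close:
  fixes f :: "real \<Rightarrow> real"
  assumes cont: "continuous_on {0..} f" and \<epsilon>: "0 < \<epsilon>"
  shows "\<forall>\<^sub>F k in sequentially. \<forall>t\<in>{0..real m}. \<bar>f (real (nat \<lfloor>t / (1 / real k)\<rfloor>) / real k) - f t\<bar> < \<epsilon>"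
proof -
  have "uniformly_continuous_on {0..real m} f"
    by (rule compact_uniformly_continuous[OF continuous_on_subset[OF cont]]) auto
  then obtain d where d: "0 < d" "\<And>s t. s \<in> {0..real m} \<Longrightarrow> t \<in> {0..real m} \<Longrightarrow> dist s t < d \<Longrightarrow> dist (f s) (f t) < \<epsilon>"
    unfolding uniformly_continuous_on_def using \<epsilon> by metis
  have "(\<lambda>k. 1 / real k) \<longlonglongrightarrow> 0" by (rule lim_1_over_n)
  then have "\<forall>\<^sub>F k in sequentially. 1 / real k < d" using d(1) by (rule order_tendstoD(2))
  with eventually_gt_at_top[of 0] show ?thesis
  proof eventually_elim
    case (elim k)
    show ?case
    proof
      fix t assume t: "t \<in> {0..real m}"
      define j where "j = nat \<lfloor>t * real k\<rfloor>"
      have "0 \<le> t * real k" using t by simp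
      then have j: "real j \<le> t * real k" "t * real k < real j + 1"
        unfolding j_def by (simp_all add: of_nat_floor)
      have le: "real j / real k \<le> t" using j(1) elim by (simp add: pos_divide_le_eq)
      have "t < (real j + 1) / real k" using j(2) elim by (simp add: pos_less_divide_eq)
      then have "t - real j / real k < 1 / real k" by (simp add: add_divide_distrib)
      then have "dist (real j / real k) t < d" using le elim by (simp add: dist_real_def)
      then have "dist (f (real j / real k)) (f t) < \<epsilon>" using le t by (intro d(2)) auto
      then show "\<bar>f (real (nat \<lfloor>t / (1 / real k)\<rfloor>) / real k) - f t\<bar> < \<epsilon>"
        by (simp add: j_def dist_real_def)
    qed
  qed
qed

text \<open>A pathwise statement: sampling a continuous driver on the grid changes it little on a
  compact interval, and stability with zero slack transfers this to the solutions. The exceptional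
  null set is independent of \<open>m\<close> and \<eta>.\<close>

proposition scheme_converges:
  assumes W0: "\<And>p. p \<in> gt_index N \<Longrightarrow> AE \<omega> in M. W 0 \<omega> p = 0"
  shows "AE \<omega> in M. \<forall>m. \<forall>\<eta>>0. \<forall>\<^sub>F k in sequentially.
    near (gt_index N) m \<eta> (\<lambda>t\<in>{0..}. W t \<omega>) (scheme_curve N k (grid_increments k (\<lambda>p t. B p t \<omega>)))"
proof -
  have "AE \<omega> in M. \<forall>p\<in>gt_index N. W 0 \<omega> p = 0"
    using W0 by (intro AE_finite_allI finite_gt_index)
  moreover have "AE \<omega> in M. \<forall>p\<in>gt_index N. B p 0 \<omega> = 0"
    by (intro AE_finite_allI finite_gt_index standard_brownian_motion.B_zero[OF B_brownian])
  moreover have "AE \<omega> in M. \<forall>p\<in>gt_index N. continuous_on {0..} (\<lambda>t. B p t \<omega>)"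
    by (intro AE_finite_allI finite_gt_index standard_brownian_motion.B_continuous[OF B_brownian])
  ultimately show ?thesis
    using L_regular decomposition reflection_from_below reflection_from_above AE_space
  proof eventually_elim
    case (elim \<omega>)
    note W0 = elim(1) and B0 = elim(2) and Bcont = elim(3) and L = elim(4) and dec = elim(5)
      and below = elim(6) and above = elim(7) and sp = elim(8)
    let ?w = "\<lambda>t. W t \<omega>" and ?b = "\<lambda>t p. B p t \<omega>"
    let ?u = "\<lambda>k. grid_increments k (\<lambda>p t. B p t \<omega>)"
    let ?g = "\<lambda>k. scheme_path (?u k) (1 / real k)"
    have refl: "reflected_system N 0 T ?w ?b" for T
    proof (rule reflected_interlacing_system[where lm = "\<lambda>p t. Lm p t \<omega>" and lp = "\<lambda>p t. Lp p t \<omega>"])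
      show "W t \<omega> p - B p t \<omega> = Lm p t \<omega> - Lp p t \<omega>" if "p \<in> gt_index N" "0 \<le> t" for p t
        using dec that W0 by simp
      show "W t \<omega> \<in> GTc N" if "0 \<le> t" for t using W_in_GTc[OF that sp] .
      show "mono_on {0..} (\<lambda>t. Lm p t \<omega>) \<and> mono_on {0..} (\<lambda>t. Lp p t \<omega>)" if "p \<in> gt_index N" for p
        using L that by simp
      show "if i = 1 then \<forall>t\<ge>0. Lm (i, k) t \<omega> = 0
        else increases_only_on (\<lambda>t. Lm (i, k) t \<omega>) {t. W t \<omega> (i, k) = W t \<omega> (i - 1, k - 1)}"
        if "(i, k) \<in> gt_index N" for i k
        using bspec[OF below that] by simp
      show "if i = k then \<forall>t\<ge>0. Lp (i, k) t \<omega> = 0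
        else increases_only_on (\<lambda>t. Lp (i, k) t \<omega>) {t. W t \<omega> (i, k) = W t \<omega> (i, k - 1)}"
        if "(i, k) \<in> gt_index N" for i k
        using bspec[OF above that] by simp
    qed simp
    show ?case
    proof (intro allI impI)
      fix m :: nat and \<eta> :: real assume \<eta>: "0 < \<eta>"
      \<comment> \<open>The stability constant is \<open>3 * N\<close>; the \<open>+ 1\<close> gives
        strict inequality and covers \<open>N = 0\<close>.\<close>
      define \<epsilon> where "\<epsilon> = \<eta> / (3 * (real N + 1))"
      have \<epsilon>: "0 < \<epsilon>" using \<eta> by (simp add: \<epsilon>_def)
      have N\<epsilon>: "real N * (0 + 3 * \<epsilon>) < \<eta>"
      proof -
        have "real N * (3 * \<epsilon>) < (real N + 1) * (3 * \<epsilon>)" using \<epsilon> by (intro mult_strict_right_mono) auto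
        also have "\<dots> = \<eta>" by (simp add: \<epsilon>_def field_simps)
        finally show ?thesis by simp
      qed
      have "\<forall>\<^sub>F k in sequentially. \<forall>p\<in>gt_index N. \<forall>t\<in>{0..real m}.
          \<bar>B p (real (nat \<lfloor>t / (1 / real k)\<rfloor>) / real k) \<omega> - B p t \<omega>\<bar> < \<epsilon>"
        using Bcont \<epsilon> by (intro eventually_ball_finite finite_gt_index ballI grid_driver_close) auto
      with eventually_gt_at_top[of 0]
      show "\<forall>\<^sub>F k in sequentially. near (gt_index N) m \<eta> (\<lambda>t\<in>{0..}. W t \<omega>) (scheme_curve N k (?u k))"
      proof eventually_elim
        case (elim k)
        have \<delta>: "0 < 1 / real k" using elim by simp
        show ?case
          unfolding near_def
        proof (intro ballI)
          fix t p assume t: "t \<in> {0..real m}" and p: "p \<in> gt_index N"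
          have "\<bar>?w t p - ?g k t p\<bar> \<le> real N * (0 + 3 * \<epsilon>)"
          proof (rule reflected_system_stable[OF refl scheme_path_reflected[OF \<delta> order_refl] order_refl _ _ _ p t])
            show "\<bar>W 0 \<omega> p - ?g k 0 p\<bar> \<le> \<epsilon>" if "p \<in> gt_index N" for p
              using W0 that \<epsilon> by (simp add: scheme_path_def)
            show "\<bar>B p t \<omega> - step_driver (?u k) (1 / real k) t p\<bar> \<le> \<epsilon>" if "p \<in> gt_index N" "t \<in> {0..real m}" for p t
            proof -
              have "\<bar>B p (real (nat \<lfloor>t / (1 / real k)\<rfloor>) / real k) \<omega> - B p t \<omega>\<bar> < \<epsilon>"
                using elim(2) that by blast
              then show ?thesis
                unfolding step_driver_grid using B0 that by simp
            qed
            show "((\<lambda>s. W s \<omega> p - ?g k s p) \<longlongrightarrow> W t \<omega> p - ?g k t p) (at_right t)"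
              if "p \<in> gt_index N" "0 \<le> t" "t < real m" for p t
            proof (intro tendsto_diff)
              have "((\<lambda>s. W s \<omega> p) \<longlongrightarrow> W t \<omega> p) (at t within {0..})"
                using W_continuous[OF that(1) sp] that(2) by (simp add: continuous_on_def)
              then show "((\<lambda>s. W s \<omega> p) \<longlongrightarrow> W t \<omega> p) (at_right t)"
                by (rule tendsto_within_subset) (use that in auto)
              show "((\<lambda>s. ?g k s p) \<longlongrightarrow> ?g k t p) (at_right t)"
                by (rule tendsto_eventually, rule eventually_mono[OF scheme_path_at_right[OF \<delta>, of "?u k"]]) simp
            qed
          qed
          then show "\<bar>scheme_curve N k (?u k) t p - (\<lambda>t\<in>{0..}. W t \<omega>) t p\<bar> < \<eta>"
            using N\<epsilon> t p by (simp add: scheme_curve_def abs_minus_commute)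
        qed
      qed
    qed
  qed
qed

lemma W_cadlag:
  assumes "\<omega> \<in> space M"
  shows "(\<lambda>t\<in>{0..}. W t \<omega>) \<in> cadlag (gt_index N)"
proof -
  have ext: "W t \<omega> \<in> gt_index N \<rightarrow>\<^sub>E UNIV" if "0 \<le> t" for t
    using W_in_GTc[OF that assms] by (simp add: GTc_def)
  have lim: "((\<lambda>s. W s \<omega> p) \<longlongrightarrow> W t \<omega> p) (at t within {0..})" if "p \<in> gt_index N" "0 \<le> t" for p t
    using W_continuous[OF that(1) assms] that(2) by (simp add: continuous_on_def)
  have "((\<lambda>s. (\<lambda>t\<in>{0..}. W t \<omega>) s p) \<longlongrightarrow> (\<lambda>t\<in>{0..}. W t \<omega>) t p) (at_right t)"
    if "p \<in> gt_index N" "0 \<le> t" for p t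
  proof -
    have "((\<lambda>s. W s \<omega> p) \<longlongrightarrow> W t \<omega> p) (at_right t)"
      by (rule tendsto_within_subset[OF lim[OF that]]) (use that in auto)
    moreover have "\<forall>\<^sub>F s in at_right t. W s \<omega> p = (\<lambda>t\<in>{0..}. W t \<omega>) s p"
      using eventually_at_right_less[of t] by eventually_elim (use that in simp)
    ultimately show ?thesis using that by (simp add: Lim_transform_eventually)
  qed
  moreover have "\<exists>l. ((\<lambda>s. (\<lambda>t\<in>{0..}. W t \<omega>) s p) \<longlongrightarrow> l) (at_left t)"
    if "p \<in> gt_index N" "0 < t" for p t
  proof -
    have "((\<lambda>s. W s \<omega> p) \<longlongrightarrow> W t \<omega> p) (at t)"
      using lim[OF that(1), of t] that(2) at_within_nhd[of t "{0<..}" "{0..}" UNIV] by fastforce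
    then have "((\<lambda>s. W s \<omega> p) \<longlongrightarrow> W t \<omega> p) (at_left t)"
      by (rule tendsto_within_subset) auto
    moreover have "\<forall>\<^sub>F s in at_left t. W s \<omega> p = (\<lambda>t\<in>{0..}. W t \<omega>) s p"
      unfolding eventually_at_left_field using that by (auto intro!: exI[of _ 0])
    ultimately show ?thesis by (intro exI) (rule Lim_transform_eventually)
  qed
  ultimately show ?thesis unfolding cadlag_def using ext by auto
qed

lemma W_path_measurable:
  "(\<lambda>\<omega>. \<lambda>t\<in>{0..}. W t \<omega>) \<in> M \<rightarrow>\<^sub>M path_algebra (gt_index N)"
  by (rule path_measurable) (rule W_cadlag W_measurable; assumption)+

end

section \<open>Test functionals along scheme curves\<close>

locale path_functional =
  fixes N :: nat and f :: "(real \<Rightarrow> nat \<times> nat \<Rightarrow> real) \<Rightarrow> real" and C :: real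
  assumes f_measurable: "f \<in> borel_measurable (path_algebra (gt_index N))"
    and f_continuous: "continuous_map (ucc_topology (gt_index N)) euclideanreal f"
    and f_bounded: "\<And>x. x \<in> cadlag (gt_index N) \<Longrightarrow> \<bar>f x\<bar> \<le> C"
begin

abbreviation "I \<equiv> gt_index N"
abbreviation "P \<equiv> Pi\<^sub>M (I \<times> (UNIV :: nat set)) (\<lambda>_. borel :: real measure)"

definition h :: "nat \<Rightarrow> ((nat \<times> nat) \<times> nat \<Rightarrow> real) \<Rightarrow> real" where
  "h k u = f (scheme_curve N k u)"

lemma C_nonneg: "0 \<le> C"
  using f_bounded[OF scheme_curve_cadlag[of 1 N "\<lambda>_. 0"]] by simp

lemma h_measurable: "0 < k \<Longrightarrow> h k \<in> borel_measurable P"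
  unfolding h_def by (rule measurable_compose[OF scheme_curve_measurable f_measurable])

lemma h_bounded: "0 < k \<Longrightarrow> \<bar>h k u\<bar> \<le> C"
  unfolding h_def by (intro f_bounded scheme_curve_cadlag)

text \<open>Up to a fixed horizon the curve is a Lipschitz function of finitely many increments.
  Coordinatewise convergence of increments thus becomes locally uniform convergence of curves, and
  continuity of \<open>f\<close> at the limit curve applies.\<close>

lemma h_continuous:
  assumes k: "0 < k" and lim: "\<And>q. q \<in> I \<times> UNIV \<Longrightarrow> (\<lambda>n. us n q) \<longlonglongrightarrow> u q"
  shows "(\<lambda>n. h k (us n)) \<longlonglongrightarrow> h k u"
proof (rule tendstoI)
  fix \<epsilon> :: real assume "0 < \<epsilon>"
  obtain m where m: "\<And>y. y \<in> cadlag I \<Longrightarrow> near I m (1 / real (Suc m)) (scheme_curve N k u) y \<Longrightarrow>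
      \<bar>f y - f (scheme_curve N k u)\<bar> < \<epsilon>"
    using ucc_continuousD[OF f_continuous scheme_curve_cadlag[OF k] \<open>0 < \<epsilon>\<close>] by blast
  have "0 < 1 / real (Suc m)" by simp
  from scheme_curve_near[OF k this] obtain e J where e: "0 < e"
    and box: "\<And>v u. (\<forall>q\<in>I \<times> {..<J}. \<bar>v q - u q\<bar> < e) \<Longrightarrow>
      near I m (1 / real (Suc m)) (scheme_curve N k u) (scheme_curve N k v)" by metis
  have "\<forall>\<^sub>F n in sequentially. \<forall>q\<in>I \<times> {..<J}. \<bar>us n q - u q\<bar> < e"
  proof (rule eventually_ball_finite)
    show "finite (I \<times> {..<J})" by (intro finite_cartesian_product finite_gt_index) auto
    show "\<forall>q\<in>I \<times> {..<J}. \<forall>\<^sub>F n in sequentially. \<bar>us n q - u q\<bar> < e"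
    proof
      fix q assume "q \<in> I \<times> {..<J}"
      then have "(\<lambda>n. us n q) \<longlonglongrightarrow> u q" by (intro lim) auto
      from tendstoD[OF this e] show "\<forall>\<^sub>F n in sequentially. \<bar>us n q - u q\<bar> < e"
        by (simp add: dist_real_def)
    qed
  qed
  then show "\<forall>\<^sub>F n in sequentially. dist (h k (us n)) (h k u) < \<epsilon>"
    by eventually_elim (use m[OF scheme_curve_cadlag[OF k] box] in \<open>simp add: h_def dist_real_def\<close>)
qed

text \<open>On the open set \<open>stable\<close>, the value of \<open>f\<close> at a scheme curve is insensitive to perturbations of
  that curve within \<open>cadlag\<close>; this replaces uniform continuity of \<open>f\<close>.\<close>

definition stable :: "real \<Rightarrow> nat \<Rightarrow> nat \<Rightarrow> ((nat \<times> nat) \<times> nat \<Rightarrow> real) set" where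
  "stable \<epsilon> m k = interior {u. \<forall>y\<in>cadlag I. near I m (1 / real (Suc m)) (scheme_curve N k u) y \<longrightarrow>
     \<bar>f y - f (scheme_curve N k u)\<bar> \<le> \<epsilon>}"

lemma stableD:
  assumes "u \<in> stable \<epsilon> m k" "y \<in> cadlag I" "near I m (1 / real (Suc m)) (scheme_curve N k u) y"
  shows "\<bar>f y - h k u\<bar> \<le> \<epsilon>"
proof -
  have "u \<in> {u. \<forall>y\<in>cadlag I. near I m (1 / real (Suc m)) (scheme_curve N k u) y \<longrightarrow>
     \<bar>f y - f (scheme_curve N k u)\<bar> \<le> \<epsilon>}"
    using assms(1) interior_subset unfolding stable_def by blast
  then show ?thesis using assms(2,3) by (simp add: h_def)
qed

lemma stable_mono:
  assumes "m \<le> m'"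
  shows "stable \<epsilon> m k \<subseteq> stable \<epsilon> m' k"
proof -
  have "1 / real (Suc m') \<le> 1 / real (Suc m)" using assms by (intro divide_left_mono) auto
  then have "near I m' (1 / real (Suc m')) x y \<Longrightarrow> near I m (1 / real (Suc m)) x y" for x y :: "real \<Rightarrow> nat \<times> nat \<Rightarrow> real"
    using near_weaken assms by blast
  then show ?thesis unfolding stable_def by (intro interior_mono) blast
qed

text \<open>The condition under \<open>interior\<close> quantifies over uncountably many paths;
  passing to the interior is what makes it measurable. Openness is used again to carry its
  probability from the limit to large \<open>n\<close>.\<close>

lemma stable_set: "{u \<in> space P. u \<in> stable \<epsilon> m k} \<in> sets P"
proof -
  have "stable \<epsilon> m k \<in> sets borel" unfolding stable_def by simp
  note measurable_sets[OF id_measurable_PiM_borel[of "I \<times> UNIV"] this]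
  also have "(\<lambda>u. u) -` stable \<epsilon> m k \<inter> space P = {u \<in> space P. u \<in> stable \<epsilon> m k}" by auto
  finally show ?thesis .
qed

text \<open>\<open>x\<close> is the limit path. The index \<open>m\<close> depends on the path but
  not on \<open>k\<close>, so that it can be absorbed into an increasing union.\<close>

lemma eventually_stable:
  assumes x: "x \<in> cadlag I" and \<epsilon>: "0 < \<epsilon>"
    and lim: "\<And>m \<eta>. 0 < \<eta> \<Longrightarrow> \<forall>\<^sub>F k in sequentially. near I m \<eta> x (scheme_curve N k (u k))"
  obtains m where "\<forall>\<^sub>F k in sequentially. u k \<in> stable \<epsilon> m k"
proof -
  have "0 < \<epsilon> / 2" using \<epsilon> by simp
  from ucc_continuousD[OF f_continuous x this] obtain m0 where m0:
    "\<And>y. y \<in> cadlag I \<Longrightarrow> near I m0 (1 / real (Suc m0)) x y \<Longrightarrow> \<bar>f y - f x\<bar> < \<epsilon> / 2" by blast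
  \<comment> \<open>This makes \<open>1 / (m + 1)\<close> half of \<open>1 / (m0 + 1)\<close>. Two
    such steps, from \<open>x\<close> to a perturbed curve and on to \<open>y\<close>, remain where
    \<open>f\<close> differs from \<open>f x\<close> by less than \<epsilon> / 2.\<close>
  define m where "m = 2 * m0 + 1"
  let ?\<eta> = "1 / real (Suc m)"
  have \<eta>: "0 < ?\<eta>" "0 < ?\<eta> / 2" by simp_all
  have two: "?\<eta> + ?\<eta> \<le> 1 / real (Suc m0)" by (simp add: m_def field_simps)
  have "\<forall>\<^sub>F k in sequentially. u k \<in> stable \<epsilon> m k"
    using eventually_gt_at_top[of 0] lim[OF \<eta>(2), of m]
  proof eventually_elim
    case (elim k)
    from scheme_curve_near[OF elim(1) \<eta>(2)] obtain e J where e: "0 < e"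
      and box: "\<And>v u. (\<forall>q\<in>I \<times> {..<J}. \<bar>v q - u q\<bar> < e) \<Longrightarrow>
        near I m (?\<eta> / 2) (scheme_curve N k u) (scheme_curve N k v)" by metis
    let ?box = "{v. \<forall>q\<in>I \<times> {..<J}. \<bar>v q - u k q\<bar> < e}"
    show "u k \<in> stable \<epsilon> m k"
      unfolding stable_def
    proof (rule interiorI[of ?box])
      show "open ?box" by (intro open_finite_box finite_cartesian_product finite_gt_index) auto
      show "u k \<in> ?box" using e by simp
      show "?box \<subseteq> {u. \<forall>y\<in>cadlag I. near I m ?\<eta> (scheme_curve N k u) y \<longrightarrow> \<bar>f y - f (scheme_curve N k u)\<bar> \<le> \<epsilon>}"
      proof (rule subsetI, rule CollectI, intro ballI impI)
        fix v y assume "v \<in> ?box" and y: "y \<in> cadlag I" "near I m ?\<eta> (scheme_curve N k v) y"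
        then have "near I m (?\<eta> / 2) (scheme_curve N k (u k)) (scheme_curve N k v)" by (intro box) simp
        from near_trans[OF elim(2) this] have xv: "near I m ?\<eta> x (scheme_curve N k v)"
          unfolding field_sum_of_halves .
        have m0m: "m0 \<le> m" by (simp add: m_def)
        have "\<bar>f (scheme_curve N k v) - f x\<bar> < \<epsilon> / 2"
          by (rule m0[OF scheme_curve_cadlag[OF elim(1)] near_weaken[OF xv m0m]]) (use two \<eta> in linarith)
        moreover have "\<bar>f y - f x\<bar> < \<epsilon> / 2"
          by (rule m0[OF y(1) near_weaken[OF near_trans[OF xv y(2)] m0m two]])
        ultimately show "\<bar>f y - f (scheme_curve N k v)\<bar> \<le> \<epsilon>" by linarith
      qed
    qed
  qed
  then show ?thesis by (rule that)
qed

end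

lemma integral_distr_eq:
  fixes g :: "'c \<Rightarrow> real"
  assumes "distr Q P V = distr M P U" "V \<in> Q \<rightarrow>\<^sub>M P" "U \<in> M \<rightarrow>\<^sub>M P" "g \<in> borel_measurable P"
  shows "(\<integral>x. g (V x) \<partial>Q) = (\<integral>x. g (U x) \<partial>M)"
  using integral_distr[OF assms(2,4)] integral_distr[OF assms(3,4)] assms(1) by simp

lemma measure_distr_eq:
  assumes "distr Q P V = distr M P U" "V \<in> Q \<rightarrow>\<^sub>M P" "U \<in> M \<rightarrow>\<^sub>M P" "{u \<in> space P. R u} \<in> sets P"
  shows "measure Q {x \<in> space Q. R (V x)} = measure M {x \<in> space M. R (U x)}"
proof -
  have "V -` {u \<in> space P. R u} \<inter> space Q = {x \<in> space Q. R (V x)}"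
    "U -` {u \<in> space P. R u} \<inter> space M = {x \<in> space M. R (U x)}"
    using measurable_space[OF assms(2)] measurable_space[OF assms(3)] by auto
  then show ?thesis
    using measure_distr[OF assms(2,4)] measure_distr[OF assms(3,4)] assms(1) by simp
qed

section \<open>Passage to the limit in the expectations\<close>

locale tasep_limit = tasep: multilevel_tasep M N \<xi> Y + limit: reflected_interlacing_bm M' N B Lm Lp W +
    path_functional N f C
  for M :: "'a measure" and M' :: "'b measure" and N \<xi> Y B Lm Lp W f C +
  assumes nonempty: "gt_index N \<noteq> {}"
    and start: "\<And>p. p \<in> gt_index N \<Longrightarrow> AE \<omega> in M'. W 0 \<omega> p = 0"
begin

definition U :: "nat \<Rightarrow> nat \<Rightarrow> 'a \<Rightarrow> (nat \<times> nat) \<times> nat \<Rightarrow> real" where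
  "U n k \<omega> = (\<lambda>q\<in>I \<times> UNIV. tasep.clock_increments n k \<omega> q)"

definition V :: "nat \<Rightarrow> 'b \<Rightarrow> (nat \<times> nat) \<times> nat \<Rightarrow> real" where
  "V k \<omega> = (\<lambda>q\<in>I \<times> UNIV. grid_increments k (\<lambda>p t. B p t \<omega>) q)"

definition X :: "nat \<Rightarrow> real \<Rightarrow> 'a \<Rightarrow> nat \<times> nat \<Rightarrow> real" where
  "X n t \<omega> = (\<lambda>p\<in>I. tasep.scaled n t \<omega> p)"

lemma U_measurable: "U n k \<in> M \<rightarrow>\<^sub>M P"
  unfolding U_def by (intro measurable_restrict tasep.clock_increments_measurable)

lemma V_measurable: "V k \<in> M' \<rightarrow>\<^sub>M P"
  unfolding V_def
  by (rule measurable_restrict)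
    (auto simp: grid_increments_def intro!: borel_measurable_diff limit.B_measurable)

text \<open>Both parts are read off from the coupling: bounded convergence for the continuous
  \<open>h k\<close>, and the portmanteau inequality for the open set \<open>stable\<close>.\<close>

lemma increments_converge:
  assumes k: "0 < k"
  shows "(\<lambda>n. \<integral>\<omega>. h k (U n k \<omega>) \<partial>M) \<longlonglongrightarrow> (\<integral>\<omega>. h k (V k \<omega>) \<partial>M')"
    and "0 < \<epsilon> \<Longrightarrow> \<forall>\<^sub>F n in sequentially. measure M' {\<omega>\<in>space M'. V k \<omega> \<in> stable \<epsilon>' m k} - \<epsilon> <
      measure M {\<omega>\<in>space M. U n k \<omega> \<in> stable \<epsilon>' m k}"
proof -
  obtain Q :: "((nat \<times> nat) \<times> nat \<Rightarrow> real) measure" and Us Vs where Q: "prob_space Q"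
    and Us: "\<And>n. Us n \<in> Q \<rightarrow>\<^sub>M P" and Vs: "Vs \<in> Q \<rightarrow>\<^sub>M P"
    and Us_law: "\<And>n. distr Q P (Us n) = distr M P (\<lambda>\<omega>. \<lambda>q\<in>I \<times> UNIV. tasep.clock_increments n k \<omega> q)"
    and Vs_law: "distr Q P Vs = Pi\<^sub>M (I \<times> UNIV) (\<lambda>_. density lborel (normal_density 0 (1 / sqrt (real k))))"
    and lim: "\<And>x q. x \<in> space Q \<Longrightarrow> q \<in> I \<times> UNIV \<Longrightarrow> (\<lambda>n. Us n x q) \<longlonglongrightarrow> Vs x q"
    using tasep.clock_increments_representation[OF k nonempty] by blast
  interpret Q: prob_space Q by fact
  have U_law: "distr Q P (Us n) = distr M P (U n k)" for n
    using Us_law[of n] by (simp add: U_def[abs_def])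
  have V_law: "distr Q P Vs = distr M' P (V k)"
    using limit.grid_increments_law[OF k] Vs_law by (simp add: V_def[abs_def])
  note h_meas = h_measurable[OF k]
  have "(\<lambda>n. \<integral>x. h k (Us n x) \<partial>Q) \<longlonglongrightarrow> (\<integral>x. h k (Vs x) \<partial>Q)"
  proof (rule integral_dominated_convergence[where w = "\<lambda>_. C"])
    show "(\<lambda>x. h k (Vs x)) \<in> borel_measurable Q" by (rule measurable_compose[OF Vs h_meas])
    show "(\<lambda>x. h k (Us n x)) \<in> borel_measurable Q" for n by (rule measurable_compose[OF Us h_meas])
    show "AE x in Q. (\<lambda>n. h k (Us n x)) \<longlonglongrightarrow> h k (Vs x)"
      by (rule AE_I2) (rule h_continuous[OF k lim])
  qed (use h_bounded[OF k] in auto)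
  then show "(\<lambda>n. \<integral>\<omega>. h k (U n k \<omega>) \<partial>M) \<longlonglongrightarrow> (\<integral>\<omega>. h k (V k \<omega>) \<partial>M')"
    using integral_distr_eq[OF U_law Us U_measurable h_meas] integral_distr_eq[OF V_law Vs V_measurable h_meas]
    by simp
  let ?S = "stable \<epsilon>' m k"
  let ?A = "\<lambda>n. {x\<in>space Q. Us n x \<in> ?S}" and ?B = "{x\<in>space Q. Vs x \<in> ?S}"
  have sets: "(?A n) \<in> sets Q" "?B \<in> sets Q" for n
    using measurable_sets[OF Us stable_set[of \<epsilon>' m k], of n] measurable_sets[OF Vs stable_set[of \<epsilon>' m k]]
      measurable_space[OF Us] measurable_space[OF Vs]
    by (auto simp: vimage_def Int_def conj_commute cong: conj_cong)
  have eventually_in: "\<forall>\<^sub>F n in sequentially. Us n x \<in> ?S" if x: "x \<in> space Q" "Vs x \<in> ?S" for x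
  proof -
    have "(\<lambda>n. Us n x q) \<longlonglongrightarrow> Vs x q" for q
    proof (cases "q \<in> I \<times> UNIV")
      case True
      then show ?thesis by (rule lim[OF x(1)])
    next
      case False
      \<comment> \<open>Openness refers to all coordinates; outside the index set both sides are
        \<open>undefined\<close>, so they converge trivially.\<close>
      have ext: "Us n x \<in> I \<times> UNIV \<rightarrow>\<^sub>E UNIV" "Vs x \<in> I \<times> UNIV \<rightarrow>\<^sub>E UNIV" for n
        using measurable_space[OF Us x(1), of n] measurable_space[OF Vs x(1)] by (simp_all add: space_PiM)
      have "Us n x q = Vs x q" for n
        using PiE_arb[OF ext(1) False] PiE_arb[OF ext(2) False] by simp
      then show ?thesis by simp
    qed
    then have "(\<lambda>n. Us n x) \<longlonglongrightarrow> Vs x" by (rule tendsto_product_coordinatewise)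
    from topological_tendstoD[OF this _ x(2)] show ?thesis by (simp add: stable_def)
  qed
  \<comment> \<open>The intersection with \<open>?B\<close> is what converges: if the limit point
    lies outside \<open>?S\<close>, the approximations may enter and leave it forever. Hence only a
    lower bound for \<open>?A n\<close> results.\<close>
  have int: "(\<lambda>n. \<integral>x. indicat_real ((?A n) \<inter> ?B) x \<partial>Q)
      \<longlonglongrightarrow> (\<integral>x. indicat_real ?B x \<partial>Q)"
  proof (rule integral_dominated_convergence[where w = "\<lambda>_. 1"])
    show "indicat_real ?B \<in> borel_measurable Q"
      "indicat_real ((?A n) \<inter> ?B) \<in> borel_measurable Q" for n
      using sets by (auto intro!: borel_measurable_indicator)
    show "AE x in Q. (\<lambda>n. indicat_real ((?A n) \<inter> ?B) x)
        \<longlonglongrightarrow> indicat_real ?B x"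
    proof (rule AE_I2, rule tendsto_eventually)
      fix x assume x: "x \<in> space Q"
      show "\<forall>\<^sub>F n in sequentially. indicat_real ((?A n) \<inter> ?B) x =
          indicat_real ?B x"
      proof (cases "Vs x \<in> ?S")
        case True
        show ?thesis using eventually_in[OF x True] by eventually_elim (simp add: x True)
      qed simp
    qed
  qed (auto simp: indicator_def)
  show "\<forall>\<^sub>F n in sequentially. measure M' {\<omega>\<in>space M'. V k \<omega> \<in> ?S} - \<epsilon> < measure M {\<omega>\<in>space M. U n k \<omega> \<in> ?S}"
    if "0 < \<epsilon>"
  proof -
    have "(\<lambda>n. measure Q ((?A n) \<inter> ?B)) \<longlonglongrightarrow>
        measure Q ?B"
      using int sets by (simp add: sets.Int)
    then have "\<forall>\<^sub>F n in sequentially. measure Q ?B - \<epsilon> <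
        measure Q ((?A n) \<inter> ?B)"
      using that by (intro order_tendstoD(1)) auto
    then show ?thesis
    proof eventually_elim
      case (elim n)
      also have "measure Q ((?A n) \<inter> ?B) \<le> measure Q (?A n)"
        using sets by (intro Q.finite_measure_mono) auto
      finally show ?case
        using measure_distr_eq[OF U_law Us U_measurable stable_set]
          measure_distr_eq[OF V_law Vs V_measurable stable_set] by simp
    qed
  qed
qed

lemma X_measurable: "0 \<le> t \<Longrightarrow> X n t \<in> M \<rightarrow>\<^sub>M Pi\<^sub>M I (\<lambda>_. borel)"
  unfolding X_def
  by (intro measurable_restrict borel_measurable_divide borel_measurable_diff
      tasep.Y_coordinate_measurable measurable_const) auto

abbreviation "X_path n \<omega> \<equiv> \<lambda>t\<in>{0..}. X n t \<omega>"

abbreviation "W_path \<omega> \<equiv> \<lambda>t\<in>{0..}. W t \<omega>"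

lemma X_cadlag:
  assumes n: "0 < n" and \<omega>: "\<omega> \<in> space M"
  shows "X_path n \<omega> \<in> cadlag I"
proof -
  have n': "0 < real n" using n by simp
  let ?Y = "\<lambda>t p. (\<lambda>t\<in>{0..}. \<lambda>p\<in>I. real_of_int (Y t \<omega> p)) t p"
  let ?g = "\<lambda>l t. (l - t * real n) / sqrt (real n)"
  have X_Y: "X_path n \<omega> t p = ?g (?Y (real n * t) p) t" if "0 \<le> t" "p \<in> I" for t p
    using that by (simp add: X_def)
  have scale: "((\<lambda>s. X_path n \<omega> s p) \<longlongrightarrow> ?g l t) F"
    if "p \<in> I" and lim: "((\<lambda>s. ?Y (real n * s) p) \<longlongrightarrow> l) F" and F: "F \<le> at t" "\<forall>\<^sub>F s in F. 0 \<le> s" for p l t F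
  proof (rule Lim_transform_eventually)
    have "((\<lambda>s. s) \<longlongrightarrow> t) F" using F(1) by (rule tendsto_mono) (rule tendsto_ident_at)
    then show "((\<lambda>s. ?g (?Y (real n * s) p) s) \<longlongrightarrow> ?g l t) F"
      using n' by (intro tendsto_divide tendsto_diff tendsto_mult lim tendsto_const) auto
    show "\<forall>\<^sub>F s in F. ?g (?Y (real n * s) p) s = X_path n \<omega> s p"
      using F(2) by eventually_elim (rule X_Y[symmetric, OF _ that(1)])
  qed
  have Yc: "(\<lambda>t\<in>{0..}. \<lambda>p\<in>I. real_of_int (Y t \<omega> p)) \<in> cadlag I" by (rule tasep.Y_cadlag[OF \<omega>])
  have "((\<lambda>s. X_path n \<omega> s p) \<longlongrightarrow> X_path n \<omega> t p) (at_right t)"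
    if p: "p \<in> I" and t: "0 \<le> t" for p t
  proof -
    have "0 \<le> real n * t" using t by simp
    from cadlag_at_right[OF Yc p this]
    have "((\<lambda>s. ?Y s p) \<longlongrightarrow> ?Y (real n * t) p) (filtermap (times (real n)) (at_right t))"
      using filtermap_times_pos_at_right[OF n', of t] by simp
    then have "((\<lambda>s. ?Y (real n * s) p) \<longlongrightarrow> ?Y (real n * t) p) (at_right t)"
      unfolding filterlim_filtermap .
    moreover have "\<forall>\<^sub>F s in at_right t. 0 \<le> s"
      using eventually_at_right_less[of t] by eventually_elim (use t in auto)
    ultimately show ?thesis using scale[OF p _ at_le] X_Y[OF t p] by simp
  qed
  moreover have "\<exists>l. ((\<lambda>s. X_path n \<omega> s p) \<longlongrightarrow> l) (at_left t)"
    if p: "p \<in> I" and t: "0 < t" for p t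
  proof -
    have "0 < real n * t" using t n' by simp
    then obtain l where l: "((\<lambda>s. ?Y s p) \<longlongrightarrow> l) (at_left (real n * t))"
      using Yc p unfolding cadlag_def by blast
    have "filterlim (\<lambda>s. real n * s) (at_left (real n * t)) (at_left t)"
    proof (rule tendsto_imp_filterlim_at_left)
      show "((\<lambda>s. real n * s) \<longlongrightarrow> real n * t) (at_left t)" by (intro tendsto_intros)
      show "\<forall>\<^sub>F s in at_left t. real n * s < real n * t"
        using n' by (simp add: eventually_at_filter)
    qed
    from filterlim_compose[OF l this] have "((\<lambda>s. ?Y (real n * s) p) \<longlongrightarrow> l) (at_left t)" .
    moreover have "\<forall>\<^sub>F s in at_left t. 0 \<le> s"
      unfolding eventually_at_left_field using t by (auto intro!: exI[of _ 0])
    ultimately show ?thesis using scale[OF p _ at_le] by blast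
  qed
  ultimately show ?thesis unfolding cadlag_def by (auto simp: X_def)
qed

lemma X_path_measurable: "0 < n \<Longrightarrow> X_path n \<in> M \<rightarrow>\<^sub>M path_algebra I"
  by (rule path_measurable) (rule X_cadlag X_measurable; assumption)+

lemma scheme_curve_U: "scheme_curve N k (U n k \<omega>) = scheme_curve N k (tasep.clock_increments n k \<omega>)"
  unfolding U_def by (rule scheme_curve_restrict)

lemma V_converges:
  "AE \<omega> in M'. \<forall>m. \<forall>\<eta>>0. \<forall>\<^sub>F k in sequentially. near I m \<eta> (W_path \<omega>) (scheme_curve N k (V k \<omega>))"
  using limit.scheme_converges[OF start] unfolding V_def scheme_curve_restrict by simp

lemma scheme_expectation_converges:
  "(\<lambda>k. \<integral>\<omega>. h k (V k \<omega>) \<partial>M') \<longlonglongrightarrow> (\<integral>\<omega>. f (W_path \<omega>) \<partial>M')"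
proof (rule LIMSEQ_imp_Suc, rule integral_dominated_convergence[where w = "\<lambda>_. C"])
  show "(\<lambda>\<omega>. f (W_path \<omega>)) \<in> borel_measurable M'"
    by (rule measurable_compose[OF limit.W_path_measurable f_measurable])
  \<comment> \<open>The sequence is shifted by one because the mesh \<open>1 / k\<close> degenerates
    at \<open>k = 0\<close>, where neither measurability nor the bound is available.\<close>
  show "(\<lambda>\<omega>. h (Suc k) (V (Suc k) \<omega>)) \<in> borel_measurable M'" for k
    by (rule measurable_compose[OF V_measurable h_measurable]) simp
  show "AE \<omega> in M'. (\<lambda>k. h (Suc k) (V (Suc k) \<omega>)) \<longlonglongrightarrow> f (W_path \<omega>)"
    using V_converges AE_space
  proof eventually_elim
    case (elim \<omega>)
    note x = limit.W_cadlag[OF elim(2)]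
    have "(\<lambda>k. h k (V k \<omega>)) \<longlonglongrightarrow> f (W_path \<omega>)"
    proof (rule tendstoI)
      fix \<epsilon> :: real assume "0 < \<epsilon>"
      from ucc_continuousD[OF f_continuous x this] obtain m where m:
        "\<And>y. y \<in> cadlag I \<Longrightarrow> near I m (1 / real (Suc m)) (W_path \<omega>) y \<Longrightarrow> \<bar>f y - f (W_path \<omega>)\<bar> < \<epsilon>"
        by blast
      have "0 < 1 / real (Suc m)" by simp
      with elim(1) have "\<forall>\<^sub>F k in sequentially. near I m (1 / real (Suc m)) (W_path \<omega>) (scheme_curve N k (V k \<omega>))"
        by blast
      with eventually_gt_at_top[of 0]
      show "\<forall>\<^sub>F k in sequentially. dist (h k (V k \<omega>)) (f (W_path \<omega>)) < \<epsilon>"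
      proof eventually_elim
        case (elim k)
        from m[OF scheme_curve_cadlag[OF elim(1)] elim(2)] show ?case by (simp add: h_def dist_real_def)
      qed
    qed
    then show ?case by (rule LIMSEQ_Suc)
  qed
qed (use h_bounded in auto)

abbreviation "stable_U \<epsilon> j n k \<equiv> {\<omega>\<in>space M. U n k \<omega> \<in> stable \<epsilon> j k}"

abbreviation "stable_V \<epsilon> j k \<equiv> {\<omega>\<in>space M'. V k \<omega> \<in> stable \<epsilon> j k}"

text \<open>The precision needed at a path is random, yet one \<open>j\<close> must serve all
  \<open>k \<ge> j\<close>. Using \<open>j\<close> both as precision and as starting index makes the
  events \<open>A j\<close> increase, by \<open>stable_mono\<close>, to an almost sure
  event.\<close>

lemma stable_probability:
  assumes \<epsilon>: "0 < \<epsilon>"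
  obtains j where "\<And>k. j \<le> k \<Longrightarrow> 1 - \<epsilon> < measure M' (stable_V \<epsilon> j k)"
proof -
  have sets: "stable_V \<epsilon> j k \<in> sets M'" for j k
  proof -
    have "stable_V \<epsilon> j k = V k -` {u \<in> space P. u \<in> stable \<epsilon> j k} \<inter> space M'"
      using measurable_space[OF V_measurable, of _ k] by blast
    then show ?thesis using measurable_sets[OF V_measurable stable_set] by simp
  qed
  define A where "A j = {\<omega>\<in>space M'. \<forall>k\<in>{j..}. V k \<omega> \<in> stable \<epsilon> j k}" for j
  have A: "A j \<in> sets M'" for j
    unfolding A_def by (intro sets.sets_Collect_countable_Ball sets)
  have inc: "incseq A"
  proof (rule incseq_SucI)
    fix j show "A j \<subseteq> A (Suc j)"
      unfolding A_def using stable_mono[of j "Suc j"] by fastforce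
  qed
  have "AE \<omega> in M'. \<omega> \<in> (\<Union>j. A j)"
    using V_converges AE_space
  proof eventually_elim
    case (elim \<omega>)
    obtain m where "\<forall>\<^sub>F k in sequentially. V k \<omega> \<in> stable \<epsilon> m k"
      using eventually_stable[OF limit.W_cadlag[OF elim(2)] \<epsilon>, of "\<lambda>k. V k \<omega>"] elim(1) by blast
    then obtain K where K: "\<And>k. K \<le> k \<Longrightarrow> V k \<omega> \<in> stable \<epsilon> m k" by (auto simp: eventually_sequentially)
    have "V k \<omega> \<in> stable \<epsilon> (max m K) k" if "max m K \<le> k" for k
      using K[of k] stable_mono[of m "max m K" \<epsilon> k] that by auto
    then have "\<omega> \<in> A (max m K)" using elim(2) by (simp add: A_def)
    then show ?case by blast
  qed
  then have "measure M' (\<Union>j. A j) = 1"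
    using A by (subst limit.prob_eq_1) auto
  moreover have "(\<lambda>j. measure M' (A j)) \<longlonglongrightarrow> measure M' (\<Union>j. A j)"
    using A inc by (intro limit.finite_Lim_measure_incseq) auto
  ultimately have "\<forall>\<^sub>F j in sequentially. 1 - \<epsilon> < measure M' (A j)"
    using \<epsilon> by (intro order_tendstoD(1)[where y = 1]) auto
  then obtain j where j: "1 - \<epsilon> < measure M' (A j)" by (auto dest: eventually_happens)
  show ?thesis
  proof (rule that)
    fix k assume "j \<le> k"
    then have "measure M' (A j) \<le> measure M' (stable_V \<epsilon> j k)"
      by (intro limit.finite_measure_mono sets) (auto simp: A_def)
    with j show "1 - \<epsilon> < measure M' (stable_V \<epsilon> j k)" by linarith
  qed
qed

text \<open>On \<open>E\<close> and the stable event \<open>f\<close> varies by at most \<epsilon>;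
  elsewhere the trivial bound \<open>2 * C\<close> is used. The exceptional probabilities \<epsilon>
  and \<open>2 * \<epsilon>\<close> produce \<open>6 * C * \<epsilon>\<close>; the second is doubled
  because stability is transferred from the Brownian increments at the cost of a further
  \<epsilon>.\<close>

lemma expectation_close:
  assumes n: "0 < n" and k: "0 < k" and \<epsilon>: "0 < \<epsilon>"
    and E: "E \<in> sets M" "1 - \<epsilon> \<le> measure M E"
    and S: "1 - 2 * \<epsilon> \<le> measure M (stable_U \<epsilon> j n k)"
    and close: "AE \<omega> in M. \<omega> \<in> E \<longrightarrow> near I j (1 / real (Suc j)) (scheme_curve N k (U n k \<omega>)) (X_path n \<omega>)"
  shows "\<bar>(\<integral>\<omega>. f (X_path n \<omega>) \<partial>M) - (\<integral>\<omega>. h k (U n k \<omega>) \<partial>M)\<bar> \<le> \<epsilon> + 6 * C * \<epsilon>"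
proof -
  let ?S = "stable_U \<epsilon> j n k"
  let ?f = "\<lambda>\<omega>. f (X_path n \<omega>)" and ?h = "\<lambda>\<omega>. h k (U n k \<omega>)"
  have S_set: "?S \<in> sets M"
  proof -
    have "?S = U n k -` {u \<in> space P. u \<in> stable \<epsilon> j k} \<inter> space M"
      using measurable_space[OF U_measurable, of _ n k] by blast
    then show ?thesis using measurable_sets[OF U_measurable stable_set] by simp
  qed
  have f_int: "integrable M ?f"
    using measurable_compose[OF X_path_measurable[OF n] f_measurable] f_bounded[OF X_cadlag[OF n]]
    by (intro tasep.integrable_const_bound[where B = C]) auto
  have h_int: "integrable M ?h"
    using measurable_compose[OF U_measurable h_measurable[OF k]] h_bounded[OF k]
    by (intro tasep.integrable_const_bound[where B = C]) auto
  let ?b = "\<lambda>\<omega>. \<epsilon> + 2 * C * indicat_real (space M - E) \<omega> + 2 * C * indicat_real (space M - ?S) \<omega>"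
  have ind_int: "integrable M (indicat_real (space M - E))" "integrable M (indicat_real (space M - ?S))"
    using E(1) S_set by (auto simp: integrable_real_indicator tasep.emeasure_eq_measure)
  have "\<bar>(\<integral>\<omega>. ?f \<omega> \<partial>M) - (\<integral>\<omega>. ?h \<omega> \<partial>M)\<bar> = \<bar>\<integral>\<omega>. ?f \<omega> - ?h \<omega> \<partial>M\<bar>"
    using f_int h_int by simp
  also have "\<dots> \<le> (\<integral>\<omega>. \<bar>?f \<omega> - ?h \<omega>\<bar> \<partial>M)" by (rule integral_abs_bound)
  also have "\<dots> \<le> (\<integral>\<omega>. ?b \<omega> \<partial>M)"
  proof (rule integral_mono_AE)
    show "integrable M (\<lambda>\<omega>. \<bar>?f \<omega> - ?h \<omega>\<bar>)" using f_int h_int by auto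
    show "integrable M ?b" using ind_int by auto
    show "AE \<omega> in M. \<bar>?f \<omega> - ?h \<omega>\<bar> \<le> ?b \<omega>"
      using close AE_space
    proof eventually_elim
      case (elim \<omega>)
      have triv: "\<bar>?f \<omega> - ?h \<omega>\<bar> \<le> 2 * C"
        using f_bounded[OF X_cadlag[OF n elim(2)]] h_bounded[OF k, of "U n k \<omega>"] by linarith
      show ?case
      proof (cases "\<omega> \<in> E \<and> \<omega> \<in> ?S")
        case True
        have "\<bar>?f \<omega> - ?h \<omega>\<bar> \<le> \<epsilon>"
          by (rule stableD[OF _ X_cadlag[OF n elim(2)]]) (use True elim(1) in auto)
        then show ?thesis using True by simp
      next
        case False
        then have "2 * C \<le> 2 * C * indicat_real (space M - E) \<omega> + 2 * C * indicat_real (space M - ?S) \<omega>"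
          using elim(2) C_nonneg by (auto simp: indicator_def)
        then show ?thesis using triv \<epsilon> by linarith
      qed
    qed
  qed
  also have "\<dots> = \<epsilon> + 2 * C * (1 - measure M E) + 2 * C * (1 - measure M ?S)"
    using ind_int E(1) S_set by (simp add: tasep.prob_space tasep.prob_compl)
  also have "\<dots> \<le> \<epsilon> + 2 * C * \<epsilon> + 2 * C * (2 * \<epsilon>)"
    using E(2) S C_nonneg by (intro add_mono mult_left_mono) auto
  finally show ?thesis by (simp add: algebra_simps)
qed

text \<open>Order of choices: \<open>j\<close> from the limit process alone, then a mesh index
  \<open>k \<ge> j\<close>, then \<open>n\<close>. \<open>j\<close> comes first because it fixes the
  horizon and precision to which TASEP has to follow the scheme.\<close>

theorem expectation_converges:
  "(\<lambda>n. \<integral>\<omega>. f (X_path n \<omega>) \<partial>M) \<longlonglongrightarrow> (\<integral>\<omega>. f (W_path \<omega>) \<partial>M')"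
proof (rule tendstoI)
  fix r :: real assume r: "0 < r"
  \<comment> \<open>The three \<epsilon> come from the stable event, from the convergence of
    increments at fixed \<open>k\<close>, and from refining the mesh; \<open>6 * C\<close> belongs
    to the exceptional events.\<close>
  define \<epsilon> where "\<epsilon> = r / (2 * (3 + 6 * C))"
  have \<epsilon>: "0 < \<epsilon>" using r C_nonneg by (simp add: \<epsilon>_def)
  have "(3 + 6 * C) * \<epsilon> = r / 2" using C_nonneg by (simp add: \<epsilon>_def field_simps)
  then have \<epsilon>_r: "3 * \<epsilon> + 6 * C * \<epsilon> < r" using r by (simp add: algebra_simps)
  obtain j where j: "\<And>k. j \<le> k \<Longrightarrow> 1 - \<epsilon> < measure M' (stable_V \<epsilon> j k)"
    using stable_probability[OF \<epsilon>] by blast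
  have \<eta>: "0 < 1 / real (Suc j)" by simp
  have "\<forall>\<^sub>F k in sequentially. dist (\<integral>\<omega>. h k (V k \<omega>) \<partial>M') (\<integral>\<omega>. f (W_path \<omega>) \<partial>M') < \<epsilon>"
    by (rule tendstoD[OF scheme_expectation_converges \<epsilon>])
  from eventually_happens[OF eventually_conj[OF eventually_conj[OF tasep.tasep_scheme_close[OF \<eta> \<epsilon>, of j] this]
      eventually_conj[OF eventually_gt_at_top[of 0] eventually_ge_at_top[of j]]]]
  obtain k where k: "0 < k" "j \<le> k"
    and kV: "dist (\<integral>\<omega>. h k (V k \<omega>) \<partial>M') (\<integral>\<omega>. f (W_path \<omega>) \<partial>M') < \<epsilon>"
    and kX: "\<forall>\<^sub>F n in sequentially. \<exists>E\<in>sets M. 1 - \<epsilon> \<le> measure M E \<and>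
      (AE \<omega> in M. \<omega> \<in> E \<longrightarrow> (\<forall>t\<in>{0..real j}. \<forall>p\<in>I.
        tasep.discrepancy n k t \<omega> p < 1 / real (Suc j)))"
    by auto
  show "\<forall>\<^sub>F n in sequentially. dist (\<integral>\<omega>. f (X_path n \<omega>) \<partial>M) (\<integral>\<omega>. f (W_path \<omega>) \<partial>M') < r"
    using kX eventually_gt_at_top[of 0] tendstoD[OF increments_converge(1)[OF k(1)] \<epsilon>]
      increments_converge(2)[OF k(1) \<epsilon>, of \<epsilon> j]
  proof eventually_elim
    case (elim n)
    obtain E where E: "E \<in> sets M" "1 - \<epsilon> \<le> measure M E"
      and close: "AE \<omega> in M. \<omega> \<in> E \<longrightarrow> (\<forall>t\<in>{0..real j}. \<forall>p\<in>I.
        tasep.discrepancy n k t \<omega> p < 1 / real (Suc j))"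
      using elim(1) by blast
    have "AE \<omega> in M. \<omega> \<in> E \<longrightarrow> near I j (1 / real (Suc j)) (scheme_curve N k (U n k \<omega>)) (X_path n \<omega>)"
      using close unfolding scheme_curve_U near_def
      by eventually_elim (simp add: scheme_curve_def X_def)
    moreover have "1 - 2 * \<epsilon> \<le> measure M (stable_U \<epsilon> j n k)"
      using elim(4) j[OF k(2)] by linarith
    ultimately have "\<bar>(\<integral>\<omega>. f (X_path n \<omega>) \<partial>M) - (\<integral>\<omega>. h k (U n k \<omega>) \<partial>M)\<bar> \<le> \<epsilon> + 6 * C * \<epsilon>"
      by (intro expectation_close[OF elim(2) k(1) \<epsilon> E])
    with elim(3) kV \<epsilon>_r show ?case unfolding dist_real_def by linarith
  qed
qed

end

lemma cadlag_empty:
  assumes "x \<in> cadlag {}"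
  shows "x = (\<lambda>t\<in>{0..}. \<lambda>p. undefined)"
  using assms by (auto simp: cadlag_def PiE_def extensional_def fun_eq_iff)

theorem mainTheorem2:
  fixes N :: nat
    and M :: "'a measure" and M' :: "'b measure"
    and \<xi> :: "nat \<times> nat \<Rightarrow> nat \<Rightarrow> 'a \<Rightarrow> real"
    and Y :: "real \<Rightarrow> 'a \<Rightarrow> nat \<times> nat \<Rightarrow> int"
    and B Lm Lp :: "nat \<times> nat \<Rightarrow> real \<Rightarrow> 'b \<Rightarrow> real"
    and W :: "real \<Rightarrow> 'b \<Rightarrow> nat \<times> nat \<Rightarrow> real"
  assumes "multilevel_tasep M N \<xi> Y"
    and "reflected_interlacing_bm M' N B Lm Lp W"
    and "\<And>p. p \<in> gt_index N \<Longrightarrow> AE \<omega> in M'. W 0 \<omega> p = 0"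
  shows "laws_converge (gt_index N)
    (\<lambda>n. path_law M (gt_index N)
       (\<lambda>t \<omega>. \<lambda>p\<in>gt_index N.
          (real_of_int (Y (real n * t) \<omega> p) - t * real n) / sqrt (real n)))
    (path_law M' (gt_index N) W)"
  unfolding laws_converge_def
proof (intro allI impI, elim conjE exE)
  fix f :: "(real \<Rightarrow> nat \<times> nat \<Rightarrow> real) \<Rightarrow> real" and C :: real
  assume f: "f \<in> borel_measurable (path_algebra (gt_index N))"
    "continuous_map (ucc_topology (gt_index N)) euclideanreal f" "\<forall>x\<in>cadlag (gt_index N). \<bar>f x\<bar> \<le> C"
  let ?X = "\<lambda>n t \<omega>. \<lambda>p\<in>gt_index N. (real_of_int (Y (real n * t) \<omega> p) - t * real n) / sqrt (real n)"
  interpret Y: multilevel_tasep M N \<xi> Y by fact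
  interpret W: reflected_interlacing_bm M' N B Lm Lp W by fact
  have W_int: "(\<integral>x. f x \<partial>path_law M' (gt_index N) W) = (\<integral>\<omega>. f (\<lambda>t\<in>{0..}. W t \<omega>) \<partial>M')"
    unfolding path_law_def by (rule integral_distr[OF W.W_path_measurable f(1)])
  show "(\<lambda>n. \<integral>x. f x \<partial>path_law M (gt_index N) (?X n)) \<longlonglongrightarrow> (\<integral>x. f x \<partial>path_law M' (gt_index N) W)"
  proof (cases "gt_index N = {}")
    case True
    \<comment> \<open>For \<open>N = 0\<close> the path space is a single point. The case is split
      off because the coupling of increments starts from the clock of some particle.\<close>
    let ?c = "\<lambda>t\<in>{0..}. \<lambda>p :: nat \<times> nat. undefined :: real"
    have X: "(\<lambda>t\<in>{0..}. ?X n t \<omega>) = ?c" for n \<omega> by (simp add: True restrict_def fun_eq_iff)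
    have "?c \<in> cadlag (gt_index N)" by (auto simp: cadlag_def True)
    then have c: "(\<lambda>\<omega>. ?c) \<in> M \<rightarrow>\<^sub>M path_algebra (gt_index N)"
      by (intro measurable_const) (auto simp: path_algebra_def space_restrict_space space_PiM cadlag_def True)
    have "(\<integral>x. f x \<partial>path_law M (gt_index N) (?X n)) = f ?c" for n
      unfolding path_law_def X using integral_distr[OF c f(1)] by (simp add: Y.prob_space)
    moreover have "(\<integral>\<omega>. f (\<lambda>t\<in>{0..}. W t \<omega>) \<partial>M') = (\<integral>\<omega>. f ?c \<partial>M')"
    proof (rule Bochner_Integration.integral_cong[OF refl])
      fix \<omega> assume "\<omega> \<in> space M'"
      from cadlag_empty[OF W.W_cadlag[OF this, unfolded True]]
      show "f (\<lambda>t\<in>{0..}. W t \<omega>) = f ?c" by (rule arg_cong)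
    qed
    ultimately show ?thesis by (simp add: W_int W.prob_space)
  next
    case False
    interpret tasep_limit M M' N \<xi> Y B Lm Lp W f C
      by unfold_locales (use f assms(3) False in auto)
    \<comment> \<open>Path measurability is established for positive \<open>n\<close>, as the
      rescaling degenerates at \<open>n = 0\<close>; eventual equality is enough for the
      limit.\<close>
    have eq: "\<forall>\<^sub>F n in sequentially. (\<integral>\<omega>. f (\<lambda>t\<in>{0..}. X n t \<omega>) \<partial>M) =
        (\<integral>x. f x \<partial>path_law M (gt_index N) (?X n))"
      using eventually_gt_at_top[of 0]
    proof eventually_elim
      case (elim n)
      show ?case
        unfolding path_law_def using integral_distr[OF X_path_measurable[OF elim] f(1)] by (simp add: X_def)
    qed
    show ?thesis
      unfolding W_int by (rule Lim_transform_eventually[OF expectation_converges eq])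
  qed
qed

end
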